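(* Let $\varepsilon_2>0$ be fixed, and let $\delta=\delta(h)>0$ and $\varepsilon_1=\varepsilon_1(h)>0$ with $(\delta,\varepsilon_1)\to0$ as $h\to0$. If $h^2\varepsilon_1^{-1}\to0$, then the constrained functionals $E_{\delta,\varepsilon,h}$, $\varepsilon=(\varepsilon_1,\varepsilon_2)$, are $\Gamma$-convergent to the constrained functional $E_{0,\varepsilon_2}$ as $(\delta,\varepsilon_1,h)\to0$ (with respect to weak convergence in $V$).
   Context: Let $L>0$, $V=H^2(0,L;\mathbb{R}^3)\times H^1(0,L;\mathbb{R}^3)$, and let $L_{\rm bc}$ be a bounded linear operator on $V$ that depends only on the boundary values (at $0$ and $L$) of $y$, $y'$ and $b$; $\ell_{\rm bc}$ is given data. Set $$\mathcal{A}_{\rm frame}=\{(y,b)\in V:\ [y',b,y'\times b]\in SO(3)\text{ a.e. in }(0,L),\ L_{\rm bc}[y,b]=\ell_{\rm bc}\}.$$ Define $\overline{Q}(\alpha,\beta)=(\alpha^2+\beta^2)^2/\alpha^2$ if $|\alpha|>|\beta|$, and $\overline{Q}(\alpha,\beta)=4\beta^2$ if $|\alpha|\le|\beta|$. The constrained functional $E_{0,\varepsilon_2}:V\to[0,\infty]$ is $$E_{0,\varepsilon_2}[y,b]=\int_0^L\overline{Q}(|y''|,|b'|)\,dx+\frac1{2\varepsilon_2}\int_0^L(y'\cdot b')^2dx$$ if $(y,b)\in\mathcal{A}_{\rm frame}$, and $+\infty$ otherwise (the relation $y'\cdot b'=0$ is not imposed). Regularized modulus: for every $\delta>0$ a function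 $|\cdot|_\delta\in C^2(\mathbb{R};\mathbb{R}_{\ge0})$ is given such that, with constants $c_0,c_1,c_2,c_{\rm uni}>0$ independent of $\delta$, $|x|_\delta\ge c_0\delta$, $\big|(|\cdot|_\delta)'\big|\le c_1$, $\big|(|\cdot|_\delta)''\big|\le c_2\delta^{-1}$, and $\big||x|_\delta-|x|\big|\le c_{\rm uni}\delta$ for all $x\in\mathbb{R}$. Set $$\psi_\delta(\alpha^2,\beta^2)=|\alpha^2-\beta^2|_\delta+\frac{4\beta^4}{\alpha^2+\beta^2+|\alpha^2-\beta^2|_\delta}.$$ Discretization: $\mathcal{T}_h$ is a quasiuniform family (minimal element length $\ge c\,h$) of partitions $0=x_0<x_1<\dots<x_N=L$ of $(0,L)$ with maximal element length $h$. $\mathcal{S}^{p,k}(\mathcal{T}_h)$ is the space of $C^k$ functions on $[0,L]$ that are polynomials of degree at most $p$ on each element. $V_h=\mathcal{S}^{3,1}(\mathcal{T}_h)^3\times\mathcal{S}^{1,0}(\mathcal{T}_h)^3\subset V$. A pair $(y_h,b_h)\in V_h$ is called discrete admissible if $|y_h'(x_j)|=|b_h(x_j)|=1$ for $j=0,\dots,N$ and $L_{\rm bc}[y_h,b_h]=\ell_{\rm bc}$. For such pairs, $$E_{\delta,\varepsilon,h}[y_h,b_h]=\frac12\int_0^L|y_h''|^2+5|b_h'|^2+\psi_\delta(|y_h''|^2,|b_h'|^2)\,dx+\frac1{2\varepsilon_1}\int_0^L(y_h'\cdot b_h)^2dx+\frac1{2\varepsilon_2}\int_0^L(y_h'\cdot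 b_h')^2dx,$$ and $E_{\delta,\varepsilon,h}=+\infty$ on all other elements of $V$. $\Gamma$-convergence of $F_h$ to $F$ on $V$ means: (a) $F[y,b]\le\liminf F_h[y_h,b_h]$ whenever $(y_h,b_h)\rightharpoonup(y,b)$ weakly in $V$; (b) for each $(y,b)\in V$ there are $(y_h,b_h)\rightharpoonup(y,b)$ in $V$ with $F_h[y_h,b_h]\to F[y,b]$. *)

theory Defs
  imports "HOL-Analysis.Analysis" "HOL-Computational_Algebra.Polynomial"
begin

section \<open>Functions of class $C^k$ and Sobolev spaces on an interval\<close>

text \<open>At boundary points of \<^term>\<open>S\<close> the derivatives are one-sided.\<close>

definition Ck_on :: "nat \<Rightarrow> real set \<Rightarrow> (real \<Rightarrow> real) \<Rightarrow> bool" where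
  "Ck_on k S f \<longleftrightarrow>
     (\<exists>D :: nat \<Rightarrow> real \<Rightarrow> real.
        (\<forall>x\<in>S. D 0 x = f x) \<and>
        (\<forall>i<k. \<forall>x\<in>S. (D i has_real_derivative D (Suc i) x) (at x within S)) \<and>
        (\<forall>i\<le>k. continuous_on S (D i)))"

text \<open>The space $C^1_c(0,L)$, each function being extended by zero to the whole line.\<close>

definition test_function :: "real \<Rightarrow> (real \<Rightarrow> real) \<Rightarrow> bool" where
  "test_function L \<phi> \<longleftrightarrow> Ck_on 1 UNIV \<phi> \<and> closure {x. \<phi> x \<noteq> 0} \<subseteq> {0<..<L}"

definition square_integrable :: "real \<Rightarrow> (real \<Rightarrow> real^3) \<Rightarrow> bool" where
  "square_integrable L g \<longleftrightarrow>
     g \<in> borel_measurable (lebesgue_on {0<..<L}) \<and>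
     integrable (lebesgue_on {0<..<L}) (\<lambda>x. (norm (g x))\<^sup>2)"

definition has_weak_derivative :: "real \<Rightarrow> (real \<Rightarrow> real^3) \<Rightarrow> (real \<Rightarrow> real^3) \<Rightarrow> bool" where
  "has_weak_derivative L u g \<longleftrightarrow>
     (\<forall>\<phi>. test_function L \<phi> \<longrightarrow>
        (LINT x|lebesgue_on {0<..<L}. deriv \<phi> x *\<^sub>R u x) =
        - (LINT x|lebesgue_on {0<..<L}. \<phi> x *\<^sub>R g x))"

text \<open>
  A class in $H^1(0,L;\mathbb{R}^3)$ is represented by its continuous representative on
  $[0,L]$, so that point values are meaningful. Values outside $[0,L]$ are irrelevant.
\<close>

definition H1 :: "real \<Rightarrow> (real \<Rightarrow> real^3) set" where
  "H1 L = {u. continuous_on {0..L} u \<and> square_integrable L u \<and>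
              (\<exists>g. square_integrable L g \<and> has_weak_derivative L u g)}"

definition H2 :: "real \<Rightarrow> (real \<Rightarrow> real^3) set" where
  "H2 L = {u \<in> H1 L. \<exists>v\<in>H1 L. has_weak_derivative L u v}"

text \<open>
  The weak derivative of an $H^1$ function is determined almost everywhere, and that of an
  $H^2$ function has a continuous representative, which is determined everywhere on $[0,L]$.
\<close>

definition D_H1 :: "real \<Rightarrow> (real \<Rightarrow> real^3) \<Rightarrow> (real \<Rightarrow> real^3)" where
  "D_H1 L u = (SOME g. square_integrable L g \<and> has_weak_derivative L u g)"

definition D_H2 :: "real \<Rightarrow> (real \<Rightarrow> real^3) \<Rightarrow> (real \<Rightarrow> real^3)" where
  "D_H2 L u = (SOME v. v \<in> H1 L \<and> has_weak_derivative L u v)"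

definition DD_H2 :: "real \<Rightarrow> (real \<Rightarrow> real^3) \<Rightarrow> (real \<Rightarrow> real^3)" where
  "DD_H2 L u = D_H1 L (D_H2 L u)"

section \<open>The space $V$\<close>

type_synonym conf = "(real \<Rightarrow> real^3) \<times> (real \<Rightarrow> real^3)"

definition V :: "real \<Rightarrow> conf set" where
  "V L = H2 L \<times> H1 L"

definition V_norm :: "real \<Rightarrow> conf \<Rightarrow> real" where
  "V_norm L = (\<lambda>(y, b). sqrt
     ((LINT x|lebesgue_on {0<..<L}.
         (norm (y x))\<^sup>2 + (norm (D_H2 L y x))\<^sup>2 + (norm (DD_H2 L y x))\<^sup>2) +
      (LINT x|lebesgue_on {0<..<L}. (norm (b x))\<^sup>2 + (norm (D_H1 L b x))\<^sup>2)))"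

definition lincomb :: "real \<Rightarrow> conf \<Rightarrow> real \<Rightarrow> conf \<Rightarrow> conf" where
  "lincomb r v s w =
     ((\<lambda>x. r *\<^sub>R fst v x + s *\<^sub>R fst w x), (\<lambda>x. r *\<^sub>R snd v x + s *\<^sub>R snd w x))"

text \<open>
  Boundedness forces such an operator to vanish on configurations of norm zero, hence not to
  depend on the values outside $[0,L]$.
\<close>

definition bounded_linear_V :: "real \<Rightarrow> (conf \<Rightarrow> 'w::real_normed_vector) \<Rightarrow> bool" where
  "bounded_linear_V L f \<longleftrightarrow>
     (\<forall>v\<in>V L. \<forall>w\<in>V L. \<forall>r s. f (lincomb r v s w) = r *\<^sub>R f v + s *\<^sub>R f w) \<and>
     (\<exists>C. \<forall>v\<in>V L. norm (f v) \<le> C * V_norm L v)"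

definition weakly_convergent_V ::
    "real \<Rightarrow> ('i \<Rightarrow> conf) \<Rightarrow> conf \<Rightarrow> 'i filter \<Rightarrow> bool" where
  "weakly_convergent_V L w v F \<longleftrightarrow>
     (\<forall>f :: conf \<Rightarrow> real. bounded_linear_V L f \<longrightarrow> ((\<lambda>i. f (w i)) \<longlongrightarrow> f v) F)"

definition boundary_values ::
    "real \<Rightarrow> conf \<Rightarrow> (real^3) \<times> (real^3) \<times> (real^3) \<times> (real^3) \<times> (real^3) \<times> (real^3)" where
  "boundary_values L = (\<lambda>(y, b). (y 0, y L, D_H2 L y 0, D_H2 L y L, b 0, b L))"

definition boundary_operator :: "real \<Rightarrow> (conf \<Rightarrow> 'w::real_normed_vector) \<Rightarrow> bool" where
  "boundary_operator L B \<longleftrightarrow>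
     bounded_linear_V L B \<and>
     (\<forall>v\<in>V L. \<forall>w\<in>V L. boundary_values L v = boundary_values L w \<longrightarrow> B v = B w)"

definition Gamma_convergent_V ::
    "real \<Rightarrow> ('i \<Rightarrow> conf \<Rightarrow> ennreal) \<Rightarrow> (conf \<Rightarrow> ennreal) \<Rightarrow> 'i filter \<Rightarrow> bool" where
  "Gamma_convergent_V L E E0 F \<longleftrightarrow>
     (\<forall>v\<in>V L. \<forall>w. (\<forall>i. w i \<in> V L) \<and> weakly_convergent_V L w v F \<longrightarrow>
        E0 v \<le> Liminf F (\<lambda>i. E i (w i))) \<and>
     (\<forall>v\<in>V L. \<exists>w. (\<forall>i. w i \<in> V L) \<and> weakly_convergent_V L w v F \<and>
        ((\<lambda>i. E i (w i)) \<longlongrightarrow> E0 v) F)"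

section \<open>The limit functional\<close>

definition frame :: "real^3 \<Rightarrow> real^3 \<Rightarrow> real^3^3" where
  "frame t b = (\<chi> i j. (vector [t, b, cross3 t b] :: real^3^3) $ j $ i)"

definition A_frame ::
    "real \<Rightarrow> (conf \<Rightarrow> 'w::real_normed_vector) \<Rightarrow> 'w \<Rightarrow> conf set" where
  "A_frame L Lbc lbc =
     {(y, b) \<in> V L.
        (AE x in lebesgue_on {0<..<L}. rotation_matrix (frame (D_H2 L y x) (b x))) \<and>
        Lbc (y, b) = lbc}"

definition Qbar :: "real \<Rightarrow> real \<Rightarrow> real" where
  "Qbar \<alpha> \<beta> = (if \<bar>\<alpha>\<bar> > \<bar>\<beta>\<bar> then (\<alpha>\<^sup>2 + \<beta>\<^sup>2)\<^sup>2 / \<alpha>\<^sup>2 else 4 * \<beta>\<^sup>2)"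

definition E_limit ::
    "real \<Rightarrow> (conf \<Rightarrow> 'w::real_normed_vector) \<Rightarrow> 'w \<Rightarrow> real \<Rightarrow> conf \<Rightarrow> ennreal" where
  "E_limit L Lbc lbc \<epsilon>2 = (\<lambda>(y, b).
     if (y, b) \<in> A_frame L Lbc lbc then
       (\<integral>\<^sup>+x. ennreal (Qbar (norm (DD_H2 L y x)) (norm (D_H1 L b x))) \<partial>lebesgue_on {0<..<L})
       + ennreal (1 / (2 * \<epsilon>2)) *
         (\<integral>\<^sup>+x. ennreal ((D_H2 L y x \<bullet> D_H1 L b x)\<^sup>2) \<partial>lebesgue_on {0<..<L})
     else \<infinity>)"

section \<open>The regularized and discretized functionals\<close>

text \<open>\<^term>\<open>m \<delta> x\<close> stands for $|x|_\delta$.\<close>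

definition regularized_modulus ::
    "real \<Rightarrow> real \<Rightarrow> real \<Rightarrow> real \<Rightarrow> (real \<Rightarrow> real \<Rightarrow> real) \<Rightarrow> bool" where
  "regularized_modulus c0 c1 c2 cuni m \<longleftrightarrow>
     0 < c0 \<and> 0 < c1 \<and> 0 < c2 \<and> 0 < cuni \<and>
     (\<forall>\<delta>>0. Ck_on 2 UNIV (m \<delta>) \<and>
        (\<forall>x. 0 \<le> m \<delta> x \<and> c0 * \<delta> \<le> m \<delta> x \<and>
             \<bar>deriv (m \<delta>) x\<bar> \<le> c1 \<and> \<bar>deriv (deriv (m \<delta>)) x\<bar> \<le> c2 / \<delta> \<and>
             \<bar>m \<delta> x - \<bar>x\<bar>\<bar> \<le> cuni * \<delta>))"

text \<open>The arguments \<^term>\<open>a\<close> and \<^term>\<open>b\<close> are the squares $\alpha^2$ and $\beta^2$.\<close>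

definition psi :: "(real \<Rightarrow> real \<Rightarrow> real) \<Rightarrow> real \<Rightarrow> real \<Rightarrow> real \<Rightarrow> real" where
  "psi m \<delta> a b = m \<delta> (a - b) + 4 * b\<^sup>2 / (a + b + m \<delta> (a - b))"

definition partition :: "real \<Rightarrow> nat \<Rightarrow> (nat \<Rightarrow> real) \<Rightarrow> bool" where
  "partition L N X \<longleftrightarrow> 0 < N \<and> X 0 = 0 \<and> X N = L \<and> (\<forall>j<N. X j < X (Suc j))"

definition mesh_size :: "nat \<Rightarrow> (nat \<Rightarrow> real) \<Rightarrow> real" where
  "mesh_size N X = Max ((\<lambda>j. X (Suc j) - X j) ` {..<N})"

text \<open>A family of partitions with nodes \<^term>\<open>X h 0\<close>, \dots, \<^term>\<open>X h (N h)\<close>, indexed by its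
  mesh sizes \<^term>\<open>h \<in> H\<close>.\<close>

definition quasiuniform_family ::
    "real \<Rightarrow> real set \<Rightarrow> (real \<Rightarrow> nat) \<Rightarrow> (real \<Rightarrow> nat \<Rightarrow> real) \<Rightarrow> bool" where
  "quasiuniform_family L H N X \<longleftrightarrow>
     (\<forall>h\<in>H. partition L (N h) (X h) \<and> mesh_size (N h) (X h) = h) \<and>
     (\<exists>c>0. \<forall>h\<in>H. \<forall>j<N h. c * h \<le> X h (Suc j) - X h j)"

definition spline_space ::
    "real \<Rightarrow> nat \<Rightarrow> nat \<Rightarrow> nat \<Rightarrow> (nat \<Rightarrow> real) \<Rightarrow> (real \<Rightarrow> real) set" where
  "spline_space L p k N X =
     {f. Ck_on k {0..L} f \<and>
         (\<forall>j<N. \<exists>q :: real poly. degree q \<le> p \<and> (\<forall>x\<in>{X j..X (Suc j)}. f x = poly q x))}"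

definition Vh :: "real \<Rightarrow> nat \<Rightarrow> (nat \<Rightarrow> real) \<Rightarrow> conf set" where
  "Vh L N X =
     {(y, b) \<in> V L. \<forall>i. (\<lambda>x. y x $ i) \<in> spline_space L 3 1 N X \<and>
                       (\<lambda>x. b x $ i) \<in> spline_space L 1 0 N X}"

definition discrete_admissible ::
    "real \<Rightarrow> (conf \<Rightarrow> 'w::real_normed_vector) \<Rightarrow> 'w \<Rightarrow> nat \<Rightarrow> (nat \<Rightarrow> real) \<Rightarrow> conf set" where
  "discrete_admissible L Lbc lbc N X =
     {(y, b) \<in> Vh L N X.
        (\<forall>j\<le>N. norm (D_H2 L y (X j)) = 1 \<and> norm (b (X j)) = 1) \<and> Lbc (y, b) = lbc}"

definition E_discrete ::
    "real \<Rightarrow> (conf \<Rightarrow> 'w::real_normed_vector) \<Rightarrow> 'w \<Rightarrow> (real \<Rightarrow> real \<Rightarrow> real) \<Rightarrow>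
     real \<Rightarrow> real \<Rightarrow> real \<Rightarrow> nat \<Rightarrow> (nat \<Rightarrow> real) \<Rightarrow> conf \<Rightarrow> ennreal" where
  "E_discrete L Lbc lbc m \<delta> \<epsilon>1 \<epsilon>2 N X = (\<lambda>(y, b).
     if (y, b) \<in> discrete_admissible L Lbc lbc N X then
       ennreal (1 / 2) *
         (\<integral>\<^sup>+x. ennreal ((norm (DD_H2 L y x))\<^sup>2 + 5 * (norm (D_H1 L b x))\<^sup>2
                 + psi m \<delta> ((norm (DD_H2 L y x))\<^sup>2) ((norm (D_H1 L b x))\<^sup>2))
            \<partial>lebesgue_on {0<..<L})
       + ennreal (1 / (2 * \<epsilon>1)) *
         (\<integral>\<^sup>+x. ennreal ((D_H2 L y x \<bullet> b x)\<^sup>2) \<partial>lebesgue_on {0<..<L})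
       + ennreal (1 / (2 * \<epsilon>2)) *
         (\<integral>\<^sup>+x. ennreal ((D_H2 L y x \<bullet> D_H1 L b x)\<^sup>2) \<partial>lebesgue_on {0<..<L})
     else \<infinity>)"

end

theory Submission
  imports Defs
begin

text \<open>
  The limit density is the maximum over $t \in [0,1]$ of the convex quadratic forms
  $(1-t^2)\alpha^2 + 2(1+t)\beta^2$, and the regularized density differs from it by at most a
  multiple of $\delta$, uniformly in $\alpha$ and $\beta$. For the lower bound one passes to a
  sequence of bounded energy. The nodal constraints and the $\varepsilon_1$ term then yield the frame
  condition of the limit, since point values converge under weak convergence, and the subgradients
  of the maximizing quadratic form give weak lower semicontinuity without Mazur's lemma.
  The recovery sequence is the nodal interpolant, cubic Hermite for $y$ and affine for $b$. It
  inherits the nodal and boundary constraints, and $y_h''$ and $b_h'$ are the elementwise $L^2$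
  projections of $y''$ and $b'$, hence converge strongly. Errors that vanish at the nodes gain a
  factor $h$ over their derivatives, and this makes the $\varepsilon_1$ term of order
  $h^2/\varepsilon_1$.
\<close>

section \<open>Integration on an interval\<close>

text \<open>Derivatives enter only weakly, through C^1 test functions, and \<open>D_H1\<close> and
  \<open>D_H2\<close> are picked by Hilbert choice. The argument therefore runs on the relation
  \<open>has_H1_derivative\<close>, and all control of point values rests on one fact: integration
  by parts up to the endpoints of an arbitrary subinterval. It yields uniqueness of the derivative
  (which pins the chosen ones down), the Hoelder bound, and the orthogonality of the interpolation
  error. Two nonlinear terms have to pass to a weak limit. In the density the parameter t is frozen
  at its maximizer for the limit, which leaves a convex quadratic form. In the coupling term a
  weakly convergent b_h' is multiplied by a strongly convergent y_h'; there s^2 >= 2 g s - g^2, with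
  g = y'.b' taken from the limit, makes the square linear in b_h'. All bounds used for this come
  from the energy, so no boundedness principle for weakly convergent families is invoked. In the
  recovery step the factor 1/\<epsilon>1 is affordable because y'.b = 0 holds exactly for the limit:
  y_h'.b_h is then linear in the interpolation errors.\<close>

abbreviation I0 :: "real \<Rightarrow> real measure" where
  "I0 L \<equiv> lebesgue_on {0<..<L}"

lemma space_I0 [simp]: "space (I0 L) = {0<..<L}"
  by simp

lemma finite_measure_I0: "finite_measure (I0 L)"
  by (rule finite_measure_lebesgue_on) simp

lemmas integrable_I0_const = finite_measure.integrable_const[OF finite_measure_I0]

text \<open>Fresh names, because the short original ones also denote facts about the
  Henstock-Kurzweil integral.\<close>

lemmas integrable_plus = Bochner_Integration.integrable_add
  and LINT_plus = Bochner_Integration.integral_add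
  and integrable_minus_fun = Bochner_Integration.integrable_diff
  and LINT_minus = Bochner_Integration.integral_diff
  and LINT_cong = Bochner_Integration.integral_cong

lemma measure_I0: "0 \<le> L \<Longrightarrow> measure (I0 L) (space (I0 L)) = L"
  by (simp add: measure_restrict_space)

lemma borel_measurable_I0:
  "f \<in> borel_measurable borel \<Longrightarrow> f \<in> borel_measurable (I0 L)"
  by (intro measurable_restrict_space1 measurable_completion) simp

lemma continuous_measurable_I0:
  fixes f :: "real \<Rightarrow> 'a::euclidean_space"
  assumes "continuous_on {0..L} f"
  shows "f \<in> borel_measurable (I0 L)"
proof (rule continuous_imp_measurable_on_sets_lebesgue)
  show "continuous_on {0<..<L} f"
    by (rule continuous_on_subset[OF assms]) auto
qed simp

lemma continuous_on_Icc_bounded: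
  fixes f :: "real \<Rightarrow> 'a::euclidean_space"
  assumes "continuous_on {0..L} f"
  shows "\<exists>B>0. \<forall>x\<in>{0..L}. norm (f x) \<le> B"
  using compact_imp_bounded[OF compact_continuous_image[OF assms compact_Icc]]
  unfolding bounded_pos by blast

lemma integrable_I0_bounded:
  fixes f :: "real \<Rightarrow> 'a::euclidean_space"
  assumes "f \<in> borel_measurable (I0 L)" "\<And>x. x \<in> {0<..<L} \<Longrightarrow> norm (f x) \<le> B"
  shows "integrable (I0 L) f"
proof (rule finite_measure.integrable_const_bound[OF finite_measure_I0])
  show "AE x in I0 L. norm (f x) \<le> B"
    by (rule AE_I2) (use assms(2) in simp)
qed (rule assms(1))

lemma integrable_I0_continuous:
  fixes f :: "real \<Rightarrow> 'a::euclidean_space"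
  assumes "continuous_on {0..L} f"
  shows "integrable (I0 L) f"
proof -
  obtain B where "\<forall>x\<in>{0..L}. norm (f x) \<le> B"
    using continuous_on_Icc_bounded[OF assms] by blast
  then show ?thesis
    by (intro integrable_I0_bounded[where B = B] continuous_measurable_I0 assms) auto
qed

lemma integrable_I0_bounded_scaleR:
  fixes f :: "real \<Rightarrow> 'a::euclidean_space"
  assumes f: "integrable (I0 L) f" and k: "k \<in> borel_measurable (I0 L)"
    and B: "\<And>x. x \<in> {0<..<L} \<Longrightarrow> \<bar>k x\<bar> \<le> B"
  shows "integrable (I0 L) (\<lambda>x. k x *\<^sub>R f x)"
proof (rule Bochner_Integration.integrable_bound[OF integrable_scaleR_right[OF f, of B]])
  show "(\<lambda>x. k x *\<^sub>R f x) \<in> borel_measurable (I0 L)"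
    by (intro borel_measurable_scaleR k borel_measurable_integrable f)
  show "AE x in I0 L. norm (k x *\<^sub>R f x) \<le> norm (B *\<^sub>R f x)"
  proof (rule AE_I2)
    fix x assume "x \<in> space (I0 L)"
    then have "\<bar>k x\<bar> \<le> \<bar>B\<bar>" using B[of x] by simp
    then show "norm (k x *\<^sub>R f x) \<le> norm (B *\<^sub>R f x)"
      by (simp add: mult_right_mono)
  qed
qed

lemma integrable_I0_indicator:
  fixes f :: "real \<Rightarrow> 'a::euclidean_space"
  assumes "integrable (I0 L) f" "A \<in> sets borel"
  shows "integrable (I0 L) (\<lambda>x. indicator A x *\<^sub>R f x)"
  by (rule integrable_I0_bounded_scaleR[where B = 1])
     (use assms in \<open>auto simp: indicator_def intro!: borel_measurable_I0 borel_measurable_indicator\<close>)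

text \<open>Bridge to the gauge integral, so that its fundamental theorem of calculus can evaluate
  Lebesgue integrals; passing from the open to the closed interval adds two null points.\<close>

lemma has_integral_I0:
  fixes f :: "real \<Rightarrow> 'a::euclidean_space"
  assumes "integrable (I0 L) f"
  shows "(f has_integral integral\<^sup>L (I0 L) f) {0..L}"
proof -
  have "(f has_integral integral\<^sup>L (I0 L) f) {0<..<L}"
    by (rule has_integral_integral_lebesgue_on) (use assms in auto)
  then show ?thesis
    by (simp add: has_integral_Icc_iff_Ioo)
qed

lemma LINT_I0_eq:
  fixes f :: "real \<Rightarrow> 'a::euclidean_space"
  assumes "integrable (I0 L) f" "(f has_integral y) {0..L}"
  shows "integral\<^sup>L (I0 L) f = y"
  using has_integral_I0[OF assms(1)] assms(2) has_integral_unique by blast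

section \<open>Truncated powers and C^1 cutoff functions\<close>

lemma DERIV_pos_part_power:
  "((\<lambda>x::real. max 0 (x - p) ^ Suc (Suc n)) has_real_derivative
     real (Suc (Suc n)) * max 0 (x - p) ^ Suc n) (at x)"
proof -
  consider "x < p" | "x > p" | "x = p" by linarith
  then show ?thesis
  proof cases
    case 1
    show ?thesis
      by (rule has_field_derivative_transform_within_open[of "\<lambda>_. 0" _ _ "{..<p}"]) (use 1 in auto)
  next
    case 2
    have "((\<lambda>x::real. (x - p) ^ Suc (Suc n)) has_real_derivative
     real (Suc (Suc n)) * (x - p) ^ Suc n) (at x)"
      by (rule DERIV_cong[OF DERIV_power[OF DERIV_diff[OF DERIV_ident DERIV_const]]]) simp
    moreover have "real (Suc (Suc n)) * (x - p) ^ Suc n = real (Suc (Suc n)) * max 0 (x - p) ^ Suc n"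
      using 2 by simp
    ultimately show ?thesis
      using 2 by (auto intro: has_field_derivative_transform_within_open[of _ _ _ "{p<..}"])
  next
    case 3
    \<comment> \<open>At the kink the difference quotient is at most
      \<open>\<bar>h\<bar> ^ Suc n\<close>, whose exponent is at least one, so the derivative is
      0.\<close>
    have "((\<lambda>h. \<bar>h\<bar> ^ Suc n) \<longlongrightarrow> \<bar>0::real\<bar> ^ Suc n) (at 0)"
      by (intro tendsto_intros)
    then have l: "((\<lambda>h. \<bar>h\<bar> ^ Suc n) \<longlongrightarrow> (0::real)) (at 0)" by simp
    have "norm ((max 0 (p + h - p) ^ Suc (Suc n) - max 0 (p - p) ^ Suc (Suc n)) / h) \<le> \<bar>h\<bar> ^ Suc n"
      for h :: real
      by (cases "h > 0") (auto simp: max_def mult_nonpos_nonneg)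
    then have "((\<lambda>h. (max 0 (p + h - p) ^ Suc (Suc n) - max 0 (p - p) ^ Suc (Suc n)) / h) \<longlongrightarrow> 0) (at 0)"
      by (intro Lim_null_comparison[OF _ l] always_eventually) blast
    then show ?thesis
      unfolding DERIV_def 3 by simp
  qed
qed

text \<open>The tent on [0,1] with peak 2 and hence mass 1. Test functions need only be C^1, so the
  antiderivative of a tent is smooth enough for a cutoff.\<close>

definition hat :: "real \<Rightarrow> real" where
  "hat t = 4 * max 0 (t - 0) - 8 * max 0 (t - 1/2) + 4 * max 0 (t - 1)"

text \<open>The antiderivative of \<open>hat\<close>, rising from 0 to 1 on [0,1]. Writing
  \<open>t - 0\<close> keeps all three terms in the shape of one derivative rule for truncated
  powers.\<close>

definition smooth_step :: "real \<Rightarrow> real" where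
  "smooth_step t = 2 * max 0 (t - 0) ^ 2 - 4 * max 0 (t - 1/2) ^ 2 + 2 * max 0 (t - 1) ^ 2"

lemma DERIV_pos_part_square:
  "((\<lambda>x::real. (max 0 (x - p))\<^sup>2) has_real_derivative 2 * max 0 (x - p)) (at x)"
  using DERIV_pos_part_power[of p 0 x] by (simp add: numeral_2_eq_2)

lemma DERIV_smooth_step: "(smooth_step has_real_derivative hat t) (at t)"
proof -
  have "((\<lambda>t. 2 * (max 0 (t - 0))\<^sup>2 - 4 * (max 0 (t - 1/2))\<^sup>2 + 2 * (max 0 (t - 1))\<^sup>2) has_real_derivative
      2 * (2 * max 0 (t - 0)) - 4 * (2 * max 0 (t - 1/2)) + 2 * (2 * max 0 (t - 1))) (at t)"
    by (intro DERIV_add DERIV_diff DERIV_cmult DERIV_pos_part_square)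
  then show ?thesis
    unfolding smooth_step_def[abs_def] hat_def by simp
qed

lemma smooth_step_le0: "t \<le> 0 \<Longrightarrow> smooth_step t = 0"
  by (simp add: smooth_step_def)

lemma smooth_step_ge1: "t \<ge> 1 \<Longrightarrow> smooth_step t = 1"
  by (simp add: smooth_step_def max_def power2_eq_square field_simps)

lemma hat_nonneg: "0 \<le> hat t"
  by (auto simp: hat_def max_def)

lemma hat_eq_0: "t \<le> 0 \<or> 1 \<le> t \<Longrightarrow> hat t = 0"
  by (auto simp: hat_def max_def)

lemma continuous_hat [continuous_intros]: "continuous_on S hat"
  unfolding hat_def[abs_def] by (intro continuous_intros)

lemma continuous_smooth_step: "continuous_on S smooth_step"
  unfolding smooth_step_def[abs_def] by (intro continuous_intros)

lemma smooth_step_bounds: "0 \<le> smooth_step t" "smooth_step t \<le> 1"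
proof -
  have m: "x \<le> y \<Longrightarrow> smooth_step x \<le> smooth_step y" for x y
    by (rule DERIV_nonneg_imp_nondecreasing) (use DERIV_smooth_step hat_nonneg in blast)+
  show "0 \<le> smooth_step t"
    using m[of "min t 0" t] smooth_step_le0[of "min t 0"] by simp
  show "smooth_step t \<le> 1"
    using m[of t "max t 1"] smooth_step_ge1[of "max t 1"] by simp
qed

text \<open>The rescaled tent is an approximate identity. It is one-sided, supported in
  [P n, P n + 1/n], so its whole mass can stay inside (0,L) even when the limit point p is an
  endpoint; this is what later produces the boundary terms at 0 and L.\<close>

lemma hat_kernel_tendsto:
  fixes F :: "real \<Rightarrow> 'a::euclidean_space"
  assumes F: "continuous_on {0..L} F" and p: "P \<longlonglongrightarrow> p" "p \<in> {0..L}"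
    and P: "eventually (\<lambda>n. 0 \<le> P n \<and> P n + 1 / real n \<le> L) sequentially"
  shows "(\<lambda>n. LINT x|I0 L. (real n * hat (real n * (x - P n))) *\<^sub>R F x) \<longlonglongrightarrow> F p"
proof (rule tendstoI)
  fix e :: real assume e: "e > 0"
  obtain d where d: "d > 0" "\<And>x. x \<in> {0..L} \<Longrightarrow> dist x p < d \<Longrightarrow> dist (F x) (F p) < e/2"
    using F p(2) e unfolding continuous_on_iff by (metis half_gt_zero)
  \<comment> \<open>Half of d pays for the drift of \<open>P n\<close>, the other half for the width
    1/n of the support.\<close>
  have e1: "eventually (\<lambda>n. dist (P n) p < d/2) sequentially"
    using p(1) d(1) by (intro tendstoD) auto
  have e2: "eventually (\<lambda>n. 1 / real n < d/2) sequentially"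
    using d(1) by (intro order_tendstoD[OF lim_1_over_n]) auto
  have e3: "eventually (\<lambda>n. n > 0) sequentially"
    by (rule eventually_gt_at_top)
  show "eventually (\<lambda>n. dist (LINT x|I0 L. (real n * hat (real n * (x - P n))) *\<^sub>R F x) (F p) < e) sequentially"
    using P e1 e2 e3
  proof eventually_elim
    case (elim n)
    let ?r = "\<lambda>x. real n * hat (real n * (x - P n))"
    have L: "0 \<le> L" using elim by (smt (verit) divide_nonneg_nonneg of_nat_0_le_iff)
    have rc: "continuous_on {0..L} ?r"
      by (intro continuous_intros continuous_on_compose2[OF continuous_hat]) auto
    have "(?r has_integral (smooth_step (real n * (L - P n)) - smooth_step (real n * (0 - P n)))) {0..L}"
    proof (rule fundamental_theorem_of_calculus[OF L])
      fix x
      have "((\<lambda>x. smooth_step (real n * (x - P n))) has_real_derivative hat (real n * (x - P n)) * real n) (at x)"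
        by (rule DERIV_chain2[OF DERIV_smooth_step]) (auto intro!: derivative_eq_intros)
      then show "((\<lambda>x. smooth_step (real n * (x - P n))) has_vector_derivative ?r x) (at x within {0..L})"
        by (simp add: has_real_derivative_iff_has_vector_derivative mult.commute has_vector_derivative_at_within)
    qed
    moreover have "smooth_step (real n * (L - P n)) = 1"
      using elim by (intro smooth_step_ge1) (simp add: field_simps)
    moreover have "smooth_step (real n * (0 - P n)) = 0"
      using elim by (intro smooth_step_le0) (simp add: mult_nonneg_nonpos)
    ultimately have r1: "(LINT x|I0 L. ?r x) = 1"
      by (intro LINT_I0_eq integrable_I0_continuous rc) simp
    have i1: "integrable (I0 L) ?r" by (intro integrable_I0_continuous rc)
    have i2: "integrable (I0 L) (\<lambda>x. ?r x *\<^sub>R F x)"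
      by (intro integrable_I0_continuous continuous_intros rc F)
    have "(LINT x|I0 L. ?r x *\<^sub>R F x) - F p = (LINT x|I0 L. ?r x *\<^sub>R (F x - F p))"
    proof -
      have "(LINT x|I0 L. ?r x *\<^sub>R (F x - F p)) = (LINT x|I0 L. ?r x *\<^sub>R F x) - (LINT x|I0 L. ?r x *\<^sub>R F p)"
        unfolding scaleR_diff_right by (intro LINT_minus i2 integrable_scaleR_left i1)
      also have "(LINT x|I0 L. ?r x *\<^sub>R F p) = F p"
        using i1 r1 by simp
      finally show ?thesis by simp
    qed
    also have "norm \<dots> \<le> (LINT x|I0 L. norm (?r x *\<^sub>R (F x - F p)))"
      by (rule integral_norm_bound)
    also have "\<dots> \<le> (LINT x|I0 L. ?r x * (e/2))"
    proof (intro integral_mono)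
      show "integrable (I0 L) (\<lambda>x. norm (?r x *\<^sub>R (F x - F p)))"
        by (intro integrable_I0_continuous continuous_intros rc F)
      show "integrable (I0 L) (\<lambda>x. ?r x * (e/2))" using i1 by simp
      fix x assume "x \<in> space (I0 L)"
      then have x: "x \<in> {0..L}" by auto
      show "norm (?r x *\<^sub>R (F x - F p)) \<le> ?r x * (e/2)"
      proof (cases "?r x = 0")
        case False
        then have "0 < real n * (x - P n)" "real n * (x - P n) < 1"
          using hat_eq_0 by (metis mult_zero_right not_le)+
        then have "0 < x - P n" "x - P n < 1 / real n"
          using elim(4) by (auto simp: field_simps zero_less_mult_iff)
        then have "dist x p < d"
          using elim(2,3) unfolding dist_real_def by linarith
        then have "norm (F x - F p) \<le> e/2" using d(2)[OF x] by (simp add: dist_norm)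
        moreover have "0 \<le> ?r x" by (intro mult_nonneg_nonneg hat_nonneg) simp
        ultimately show ?thesis
          using mult_left_mono[of "norm (F x - F p)" "e/2" "?r x"] by (metis abs_of_nonneg norm_scaleR)
      next
        case True
        show ?thesis unfolding True by simp
      qed
    qed
    also have "\<dots> = e/2" using r1 by simp
    also have "\<dots> < e" using e by simp
    finally show ?case by (simp add: dist_norm)
  qed
qed

section \<open>Square-integrable functions and integration by parts in $H^1$\<close>

definition L2sq :: "real \<Rightarrow> (real \<Rightarrow> real^3) \<Rightarrow> real" where
  "L2sq L g = (LINT x|I0 L. (norm (g x))\<^sup>2)"

lemma measurable_norm_comp:
  fixes f :: "'a \<Rightarrow> 'b::real_normed_vector"
  shows "f \<in> borel_measurable M \<Longrightarrow> (\<lambda>x. norm (f x)) \<in> borel_measurable M"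
  by measurable

lemma L2sq_nonneg: "0 \<le> L2sq L g"
  unfolding L2sq_def by simp

lemma square_integrable_measurable:
  "square_integrable L g \<Longrightarrow> g \<in> borel_measurable (I0 L)"
  by (simp add: square_integrable_def)

lemma square_integrableD:
  "square_integrable L g \<Longrightarrow> integrable (I0 L) (\<lambda>x. (norm (g x))\<^sup>2)"
  by (simp add: square_integrable_def)

lemma square_integrable_bound:
  assumes f: "f \<in> borel_measurable (I0 L)" and k: "integrable (I0 L) k"
    and le: "\<And>x. x \<in> {0<..<L} \<Longrightarrow> (norm (f x))\<^sup>2 \<le> k x"
  shows "square_integrable L f"
  unfolding square_integrable_def
proof (intro conjI f Bochner_Integration.integrable_bound[OF k])
  show "(\<lambda>x. (norm (f x))\<^sup>2) \<in> borel_measurable (I0 L)"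
    using f by (intro borel_measurable_power measurable_norm_comp)
  show "AE x in I0 L. norm ((norm (f x))\<^sup>2) \<le> norm (k x)"
  proof (rule AE_I2)
    fix x assume "x \<in> space (I0 L)"
    then show "norm ((norm (f x))\<^sup>2) \<le> norm (k x)"
      using le[of x] by (simp add: order_trans[OF _ abs_ge_self])
  qed
qed

lemma norm_add_sq_le: "(norm (a + b))\<^sup>2 \<le> 2 * (norm a)\<^sup>2 + 2 * (norm b)\<^sup>2"
proof -
  have "(norm (a + b))\<^sup>2 \<le> (norm a + norm b)\<^sup>2"
    by (intro power_mono norm_triangle_ineq norm_ge_zero)
  also have "\<dots> \<le> 2 * (norm a)\<^sup>2 + 2 * (norm b)\<^sup>2"
    using sum_squares_bound[of "norm a" "norm b"] by (simp add: power2_sum)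
  finally show ?thesis .
qed

lemma square_integrable_lincomb:
  assumes f: "square_integrable L f" and g: "square_integrable L g"
  shows "square_integrable L (\<lambda>x. r *\<^sub>R f x + s *\<^sub>R g x)"
proof (rule square_integrable_bound)
  show "(\<lambda>x. r *\<^sub>R f x + s *\<^sub>R g x) \<in> borel_measurable (I0 L)"
    using square_integrable_measurable[OF f] square_integrable_measurable[OF g] 
    by (intro borel_measurable_add borel_measurable_scaleR borel_measurable_const)
  show "integrable (I0 L) (\<lambda>x. 2 * r\<^sup>2 * (norm (f x))\<^sup>2 + 2 * s\<^sup>2 * (norm (g x))\<^sup>2)"
    using square_integrableD[OF f] square_integrableD[OF g] 
    by (intro integrable_plus integrable_mult_right)
  show "(norm (r *\<^sub>R f x + s *\<^sub>R g x))\<^sup>2 \<le> 2 * r\<^sup>2 * (norm (f x))\<^sup>2 + 2 * s\<^sup>2 * (norm (g x))\<^sup>2" for x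
    using norm_add_sq_le[of "r *\<^sub>R f x" "s *\<^sub>R g x"] by (simp add: power_mult_distrib)
qed

lemma square_integrable_diff:
  assumes "square_integrable L f" "square_integrable L g"
  shows "square_integrable L (\<lambda>x. f x - g x)"
  using square_integrable_lincomb[OF assms, of 1 "-1"] by simp

lemma square_integrable_bounded:
  assumes "f \<in> borel_measurable (I0 L)" "\<And>x. x \<in> {0<..<L} \<Longrightarrow> norm (f x) \<le> B"
  shows "square_integrable L f"
proof (rule square_integrable_bound[OF assms(1)])
  show "integrable (I0 L) (\<lambda>x. B\<^sup>2)"
    by (rule integrable_I0_const)
  show "(norm (f x))\<^sup>2 \<le> B\<^sup>2" if "x \<in> {0<..<L}" for x
    using assms(2)[OF that] by (intro power_mono) auto
qed

lemma square_integrable_continuous: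
  assumes "continuous_on {0..L} f"
  shows "square_integrable L f"
proof -
  obtain B where "\<forall>x\<in>{0..L}. norm (f x) \<le> B"
    using continuous_on_Icc_bounded[OF assms] by blast
  then show ?thesis
    by (intro square_integrable_bounded[where B = B] continuous_measurable_I0 assms) simp
qed

lemma square_integrable_bounded_scaleR:
  assumes g: "square_integrable L g" and k: "k \<in> borel_measurable (I0 L)"
    and B: "\<And>x. x \<in> {0<..<L} \<Longrightarrow> \<bar>k x\<bar> \<le> B"
  shows "square_integrable L (\<lambda>x. k x *\<^sub>R g x)"
proof (rule square_integrable_bound)
  show "(\<lambda>x. k x *\<^sub>R g x) \<in> borel_measurable (I0 L)"
    by (intro borel_measurable_scaleR k square_integrable_measurable[OF g])
  show "integrable (I0 L) (\<lambda>x. B\<^sup>2 * (norm (g x))\<^sup>2)"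
    using square_integrableD[OF g] by (rule integrable_mult_right)
  show "(norm (k x *\<^sub>R g x))\<^sup>2 \<le> B\<^sup>2 * (norm (g x))\<^sup>2" if "x \<in> {0<..<L}" for x
  proof -
    have "\<bar>k x\<bar>\<^sup>2 \<le> B\<^sup>2" using B[OF that] by (intro power_mono) auto
    then show ?thesis by (simp add: power_mult_distrib mult_right_mono)
  qed
qed

lemma square_integrable_norm_mult:
  assumes f: "square_integrable L f" and g: "square_integrable L g"
  shows "integrable (I0 L) (\<lambda>x. norm (f x) * norm (g x))"
proof (rule Bochner_Integration.integrable_bound)
  show "integrable (I0 L) (\<lambda>x. (norm (f x))\<^sup>2 + (norm (g x))\<^sup>2)"
    using square_integrableD[OF f] square_integrableD[OF g] by (rule integrable_plus)
  show "(\<lambda>x. norm (f x) * norm (g x)) \<in> borel_measurable (I0 L)"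
    using square_integrable_measurable[OF f] square_integrable_measurable[OF g]
    by (intro borel_measurable_times measurable_norm_comp)
  have "norm (norm (f x) * norm (g x)) \<le> norm ((norm (f x))\<^sup>2 + (norm (g x))\<^sup>2)" for x
  proof -
    have "2 * (norm (f x) * norm (g x)) \<le> (norm (f x))\<^sup>2 + (norm (g x))\<^sup>2"
      using sum_squares_bound[of "norm (f x)" "norm (g x)"] by (simp add: mult.assoc)
    moreover have "0 \<le> norm (f x) * norm (g x)" by simp
    ultimately show ?thesis by (simp only: real_norm_def)
  qed
  then show "AE x in I0 L. norm (norm (f x) * norm (g x)) \<le> norm ((norm (f x))\<^sup>2 + (norm (g x))\<^sup>2)"
    by simp
qed

lemma square_integrable_inner:
  assumes f: "square_integrable L f" and g: "square_integrable L g"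
  shows "integrable (I0 L) (\<lambda>x. f x \<bullet> g x)"
proof (rule Bochner_Integration.integrable_bound[OF square_integrable_norm_mult[OF f g]])
  show "(\<lambda>x. f x \<bullet> g x) \<in> borel_measurable (I0 L)"
    using square_integrable_measurable[OF f] square_integrable_measurable[OF g]
    by (intro borel_measurable_inner)
  show "AE x in I0 L. norm (f x \<bullet> g x) \<le> norm (norm (f x) * norm (g x))"
    by (simp add: Cauchy_Schwarz_ineq2)
qed

lemma square_integrable_integrable:
  assumes f: "square_integrable L f"
  shows "integrable (I0 L) f"
proof (rule Bochner_Integration.integrable_bound)
  show "integrable (I0 L) (\<lambda>x. 1 + (norm (f x))\<^sup>2)"
    using square_integrableD[OF f] integrable_I0_const
    by (intro integrable_plus)
  have "norm (f x) \<le> norm (1 + (norm (f x))\<^sup>2)" for x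
  proof -
    have "2 * norm (f x) \<le> (norm (f x))\<^sup>2 + 1"
      using sum_squares_bound[of "norm (f x)" 1] by simp
    then show ?thesis using norm_ge_zero[of "f x"] by (simp only: real_norm_def)
  qed
  then show "AE x in I0 L. norm (f x) \<le> norm (1 + (norm (f x))\<^sup>2)" by simp
qed (rule square_integrable_measurable[OF f])

text \<open>Transferred from the inequality for nonnegative extended integrals; square integrability
  makes all three integrals finite, so they are real numbers.\<close>

lemma L2_Cauchy_Schwarz:
  assumes f: "square_integrable L f" and g: "square_integrable L g"
  shows "(LINT x|I0 L. norm (f x) * norm (g x)) \<le> sqrt (L2sq L f) * sqrt (L2sq L g)"
proof -
  have m: "(\<lambda>x. ennreal (norm (f x))) \<in> borel_measurable (I0 L)" "(\<lambda>x. ennreal (norm (g x))) \<in> borel_measurable (I0 L)"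
    using square_integrable_measurable[OF f] square_integrable_measurable[OF g]
    by (auto intro!: measurable_compose[OF _ measurable_ennreal] measurable_norm_comp)
  have "(\<integral>\<^sup>+ x. ennreal (norm (f x)) * ennreal (norm (g x)) \<partial>I0 L)\<^sup>2
      \<le> (\<integral>\<^sup>+ x. (ennreal (norm (f x)))\<^sup>2 \<partial>I0 L) * (\<integral>\<^sup>+ x. (ennreal (norm (g x)))\<^sup>2 \<partial>I0 L)"
    by (rule Cauchy_Schwarz_nn_integral[OF m])
  moreover have "(\<integral>\<^sup>+ x. ennreal (norm (f x)) * ennreal (norm (g x)) \<partial>I0 L) = ennreal (LINT x|I0 L. norm (f x) * norm (g x))"
    using nn_integral_eq_integral[OF square_integrable_norm_mult[OF f g]] by (simp add: ennreal_mult)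
  moreover have "(\<integral>\<^sup>+ x. (ennreal (norm (f x)))\<^sup>2 \<partial>I0 L) = ennreal (L2sq L f)"
    using nn_integral_eq_integral[OF square_integrableD[OF f]] by (simp add: ennreal_power L2sq_def)
  moreover have "(\<integral>\<^sup>+ x. (ennreal (norm (g x)))\<^sup>2 \<partial>I0 L) = ennreal (L2sq L g)"
    using nn_integral_eq_integral[OF square_integrableD[OF g]] by (simp add: ennreal_power L2sq_def)
  ultimately have "ennreal ((LINT x|I0 L. norm (f x) * norm (g x))\<^sup>2) \<le> ennreal (L2sq L f * L2sq L g)"
    by (simp add: ennreal_power ennreal_mult L2sq_nonneg)
  then have "(LINT x|I0 L. norm (f x) * norm (g x))\<^sup>2 \<le> L2sq L f * L2sq L g"
    by (simp add: L2sq_nonneg)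
  from real_le_rsqrt[OF this] show ?thesis
    by (simp add: real_sqrt_mult)
qed

lemma L2_inner_le:
  assumes f: "square_integrable L f" and g: "square_integrable L g"
  shows "\<bar>LINT x|I0 L. f x \<bullet> g x\<bar> \<le> sqrt (L2sq L f) * sqrt (L2sq L g)"
proof -
  have "\<bar>LINT x|I0 L. f x \<bullet> g x\<bar> \<le> (LINT x|I0 L. \<bar>f x \<bullet> g x\<bar>)"
    by (rule integral_abs_bound)
  also have "\<dots> \<le> (LINT x|I0 L. norm (f x) * norm (g x))"
    by (intro integral_mono integrable_abs square_integrable_inner square_integrable_norm_mult assms Cauchy_Schwarz_ineq2)
  finally show ?thesis using L2_Cauchy_Schwarz[OF f g] by simp
qed

lemma L1_le_L2:
  assumes f: "square_integrable L f" and L: "0 \<le> L"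
  shows "(LINT x|I0 L. norm (f x)) \<le> sqrt L * sqrt (L2sq L f)"
proof -
  \<comment> \<open>A constant unit vector plays the scalar function 1, since Cauchy-Schwarz is
    available for vector-valued functions.\<close>
  have c: "square_integrable L (\<lambda>x. axis 1 1 :: real^3)"
    by (intro square_integrable_continuous continuous_intros)
  have "L2sq L (\<lambda>x. axis 1 1) = L"
    using measure_I0[OF L] by (simp add: L2sq_def)
  then show ?thesis
    using L2_Cauchy_Schwarz[OF f c] by (simp add: mult.commute)
qed

lemma L2sq_add_le:
  assumes f: "square_integrable L f" and g: "square_integrable L g"
  shows "L2sq L (\<lambda>x. f x + g x) \<le> 2 * L2sq L f + 2 * L2sq L g"
proof -
  have "square_integrable L (\<lambda>x. f x + g x)"
    using square_integrable_lincomb[OF f g, of 1 1] by simp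
  then have "L2sq L (\<lambda>x. f x + g x) \<le> (LINT x|I0 L. 2 * (norm (f x))\<^sup>2 + 2 * (norm (g x))\<^sup>2)"
    unfolding L2sq_def
    by (intro integral_mono integrable_plus integrable_mult_right square_integrableD f g norm_add_sq_le)
  also have "\<dots> = 2 * L2sq L f + 2 * L2sq L g"
    unfolding L2sq_def using square_integrableD[OF f] square_integrableD[OF g]
    by (subst LINT_plus) (auto intro: integrable_mult_right)
  finally show ?thesis .
qed

lemma L2sq_cong_AE:
  assumes "AE x in I0 L. f x = g x" "f \<in> borel_measurable (I0 L)" "g \<in> borel_measurable (I0 L)"
  shows "L2sq L f = L2sq L g"
  unfolding L2sq_def
  by (rule integral_cong_AE) (use assms in \<open>auto intro!: borel_measurable_power measurable_norm_comp elim: eventually_mono\<close>)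

text \<open>The derivative is an explicit argument, so that a concrete function with a concrete
  derivative can be handled without reference to the choice operator in \<open>D_H1\<close>.\<close>

definition has_H1_derivative :: "real \<Rightarrow> (real \<Rightarrow> real^3) \<Rightarrow> (real \<Rightarrow> real^3) \<Rightarrow> bool" where
  "has_H1_derivative L u g \<longleftrightarrow>
     continuous_on {0..L} u \<and> square_integrable L g \<and> has_weak_derivative L u g"

lemma in_H1_iff: "u \<in> H1 L \<longleftrightarrow> (\<exists>g. has_H1_derivative L u g)"
  unfolding H1_def has_H1_derivative_def using square_integrable_continuous by blast

lemma test_functionD:
  assumes "test_function L \<phi>"
  shows "continuous_on UNIV \<phi>" "continuous_on UNIV (deriv \<phi>)"
    "\<And>x. (\<phi> has_real_derivative deriv \<phi> x) (at x)"
    "\<And>x. x \<notin> {0<..<L} \<Longrightarrow> \<phi> x = 0"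
proof -
  obtain D where D: "\<And>x. D 0 x = \<phi> x" "\<And>x. (D 0 has_real_derivative D 1 x) (at x)"
      "continuous_on UNIV (D 0)" "continuous_on UNIV (D (Suc 0))"
  proof -
    obtain D where "\<forall>x. D 0 x = \<phi> x" "\<forall>i<1. \<forall>x. (D i has_real_derivative D (Suc i) x) (at x)"
      "\<forall>i\<le>1. continuous_on UNIV (D i)"
      using assms unfolding test_function_def Ck_on_def by auto
    then show thesis by (intro that[of D]) auto
  qed
  have "D 0 = \<phi>" using D(1) by auto
  with D(2) have d: "(\<phi> has_real_derivative D 1 x) (at x)" for x by metis
  then have "deriv \<phi> = D 1" using DERIV_imp_deriv by blast
  then show "continuous_on UNIV \<phi>" "continuous_on UNIV (deriv \<phi>)"
    "\<And>x. (\<phi> has_real_derivative deriv \<phi> x) (at x)"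
    using d D \<open>D 0 = \<phi>\<close> by auto
  have "{x. \<phi> x \<noteq> 0} \<subseteq> {0<..<L}"
    by (rule order_trans[OF closure_subset]) (use assms in \<open>simp add: test_function_def\<close>)
  then show "\<And>x. x \<notin> {0<..<L} \<Longrightarrow> \<phi> x = 0" by auto
qed

lemma test_functionI:
  assumes "continuous_on UNIV \<phi>'" "\<And>x. (\<phi> has_real_derivative \<phi>' x) (at x)"
    and "0 < a" "b < L" "\<And>x. x \<notin> {a..b} \<Longrightarrow> \<phi> x = 0"
  shows "test_function L \<phi>" "deriv \<phi> = \<phi>'"
proof -
  have c: "continuous_on UNIV \<phi>"
    using assms(2) DERIV_continuous_on has_field_derivative_at_within by blast
  have "closure {x. \<phi> x \<noteq> 0} \<subseteq> {a..b}"
    by (rule closure_minimal) (use assms(5) in blast, simp)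
  also have "\<dots> \<subseteq> {0<..<L}" using assms by auto
  finally have s: "closure {x. \<phi> x \<noteq> 0} \<subseteq> {0<..<L}" .
  have "Ck_on 1 UNIV \<phi>"
    unfolding Ck_on_def
    by (rule exI[of _ "\<lambda>i. if i = 0 then \<phi> else \<phi>'"]) (use assms c in \<open>auto simp: le_Suc_eq\<close>)
  with s show "test_function L \<phi>" by (simp add: test_function_def)
  show "deriv \<phi> = \<phi>'" using assms(2) DERIV_imp_deriv by blast
qed

lemma integrable_I0_continuous_scaleR:
  fixes f :: "real \<Rightarrow> real^3"
  assumes k: "continuous_on {0..L} k" and f: "integrable (I0 L) f"
  shows "integrable (I0 L) (\<lambda>x. k x *\<^sub>R f x)"
proof -
  obtain B where "\<forall>x\<in>{0..L}. norm (k x) \<le> B"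
    using continuous_on_Icc_bounded[OF k] by blast
  then show ?thesis
    by (intro integrable_I0_bounded_scaleR[where B = B] f continuous_measurable_I0 k) auto
qed

lemma has_H1_derivative_lincomb:
  assumes u: "has_H1_derivative L u g" and v: "has_H1_derivative L v k"
  shows "has_H1_derivative L (\<lambda>x. r *\<^sub>R u x + s *\<^sub>R v x) (\<lambda>x. r *\<^sub>R g x + s *\<^sub>R k x)"
proof -
  have "(LINT x|I0 L. deriv \<phi> x *\<^sub>R (r *\<^sub>R u x + s *\<^sub>R v x)) =
      - (LINT x|I0 L. \<phi> x *\<^sub>R (r *\<^sub>R g x + s *\<^sub>R k x))" if t: "test_function L \<phi>" for \<phi>
  proof -
    have c: "continuous_on {0..L} \<phi>" "continuous_on {0..L} (deriv \<phi>)"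
      using test_functionD[OF t] continuous_on_subset by blast+
    have *: "(LINT x|I0 L. \<psi> x *\<^sub>R (r *\<^sub>R f x + s *\<^sub>R f' x)) = r *\<^sub>R (LINT x|I0 L. \<psi> x *\<^sub>R f x) + s *\<^sub>R (LINT x|I0 L. \<psi> x *\<^sub>R f' x)"
      if \<psi>: "continuous_on {0..L} \<psi>" and f: "integrable (I0 L) f" "integrable (I0 L) f'" for \<psi> and f f' :: "real \<Rightarrow> real^3"
    proof -
      note i = integrable_I0_continuous_scaleR[OF \<psi> f(1)] integrable_I0_continuous_scaleR[OF \<psi> f(2)]
      have "(LINT x|I0 L. \<psi> x *\<^sub>R (r *\<^sub>R f x + s *\<^sub>R f' x)) = (LINT x|I0 L. r *\<^sub>R (\<psi> x *\<^sub>R f x) + s *\<^sub>R (\<psi> x *\<^sub>R f' x))"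
        by (simp add: scaleR_add_right mult.commute)
      also have "\<dots> = (LINT x|I0 L. r *\<^sub>R (\<psi> x *\<^sub>R f x)) + (LINT x|I0 L. s *\<^sub>R (\<psi> x *\<^sub>R f' x))"
        using i by (intro LINT_plus integrable_scaleR_right)
      finally show ?thesis by (simp only: integral_scaleR_right)
    qed
    have i: "integrable (I0 L) u" "integrable (I0 L) v" "integrable (I0 L) g" "integrable (I0 L) k"
      using u v by (auto simp: has_H1_derivative_def intro: integrable_I0_continuous square_integrable_integrable)
    show ?thesis
      unfolding *[OF c(2) i(1,2)] *[OF c(1) i(3,4)]
      using u v t by (simp add: has_H1_derivative_def has_weak_derivative_def)
  qed
  then show ?thesis
    using u v unfolding has_H1_derivative_def has_weak_derivative_def
    by (intro conjI continuous_intros square_integrable_lincomb) auto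
qed

text \<open>Test the weak derivative with \<open>cut n * \<phi>\<close>, where the cutoffs tend to
  the indicator of (a,b). The derivative of the cutoff is a difference of two approximate
  identities, which converge to evaluation at a and at b because u is continuous; the remaining
  integral converges by domination.\<close>

lemma H1_integration_by_parts:
  assumes u: "has_H1_derivative L u g"
    and \<phi>: "\<And>x. (\<phi> has_real_derivative \<phi>' x) (at x)" "continuous_on UNIV \<phi>'"
    and ab: "0 \<le> a" "a < b" "b \<le> L"
  shows "(LINT x|I0 L. indicator {a<..<b} x *\<^sub>R (\<phi>' x *\<^sub>R u x + \<phi> x *\<^sub>R g x)) = \<phi> b *\<^sub>R u b - \<phi> a *\<^sub>R u a"
proof -
  \<comment> \<open>The cutoff rises on [a + 1/n, a + 2/n] and falls on [b - 2/n, b - 1/n], so its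
    support is compact in (0,L) even if a = 0 or b = L.\<close>
  define cut where "cut n x = smooth_step (real n * (x - (a + 1 / real n))) - smooth_step (real n * (x - (b - 2 / real n)))" for n x
  define cut' where "cut' n x = real n * hat (real n * (x - (a + 1 / real n))) - real n * hat (real n * (x - (b - 2 / real n)))" for n x
  have cu: "continuous_on {0..L} u" and gi: "integrable (I0 L) g"
    using u by (auto simp: has_H1_derivative_def intro: square_integrable_integrable)
  have c\<phi>: "continuous_on S \<phi>" for S
    using \<phi>(1) DERIV_continuous_on has_field_derivative_at_within by blast
  have c\<phi>': "continuous_on S \<phi>'" for S
    using \<phi>(2) continuous_on_subset by blast
  have ui: "integrable (I0 L) u" by (rule integrable_I0_continuous[OF cu])
  have dcut: "(cut n has_real_derivative cut' n x) (at x)" for n x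
  proof -
    have "((\<lambda>x. smooth_step (real n * (x - p))) has_real_derivative real n * hat (real n * (x - p))) (at x)" for p
      by (rule DERIV_cong[OF DERIV_chain2[OF DERIV_smooth_step]]) (auto intro!: derivative_eq_intros)
    then show ?thesis unfolding cut_def[abs_def] cut'_def by (intro DERIV_diff)
  qed
  have ccut': "continuous_on S (cut' n)" for S n
    unfolding cut'_def[abs_def] by (intro continuous_intros continuous_on_compose2[OF continuous_hat]) auto
  have ccut: "continuous_on S (cut n)" for S n
    unfolding cut_def[abs_def] by (intro continuous_intros continuous_on_compose2[OF continuous_smooth_step]) auto
  have cutb: "\<bar>cut n x\<bar> \<le> 1" for n x
    unfolding cut_def using smooth_step_bounds by (smt (verit))
  have lim1: "(\<lambda>n. a + 1 / real n) \<longlonglongrightarrow> a"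
    using tendsto_add[OF tendsto_const lim_1_over_n, of a] by simp
  have lim2: "(\<lambda>n. b - 2 / real n) \<longlonglongrightarrow> b"
    using tendsto_diff[OF tendsto_const tendsto_mult[OF tendsto_const[of 2] lim_1_over_n], of b] by simp
  \<comment> \<open>With 3/n < b - a the rise is complete at a + 2/n before the fall ends at b -
    1/n; beyond that point both steps equal 1 and cancel.\<close>
  have ev: "eventually (\<lambda>n. 0 < n \<and> 3 / real n < b - a) sequentially"
  proof (rule eventually_conj)
    have "(\<lambda>n. 3 / real n) \<longlonglongrightarrow> 0"
      using tendsto_mult[OF tendsto_const[of 3] lim_1_over_n] by simp
    then show "eventually (\<lambda>n. 3 / real n < b - a) sequentially"
      using ab by (intro order_tendstoD) auto
  qed (rule eventually_gt_at_top)
  have cut0: "cut n x = 0" if "0 < n" "3 / real n < b - a" "x \<notin> {a + 1 / real n..b - 1 / real n}" for n x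
  proof (cases "x < a + 1 / real n")
    case True
    then have "real n * (x - (a + 1 / real n)) \<le> 0" "real n * (x - (b - 2 / real n)) \<le> 0"
      using that True by (intro mult_nonneg_nonpos; simp add: field_simps)+
    then show ?thesis by (simp add: cut_def smooth_step_le0)
  next
    case False
    then have x: "b - 1 / real n < x" using that by auto
    have s: "1 \<le> real n * t" if "1 / real n \<le> t" for t
      using that \<open>0 < n\<close> by (simp add: field_simps)
    have d2: "2 / real n = 1 / real n + 1 / real n" by simp
    have "1 \<le> real n * (x - (b - 2 / real n))"
      by (rule s) (use x d2 in linarith)
    moreover have "1 \<le> real n * (x - (a + 1 / real n))"
    proof (rule s)
      have "3 / real n = 1 / real n + 2 / real n" by (simp add: add_divide_distrib[symmetric])
      then show "1 / real n \<le> x - (a + 1 / real n)" using x that(2) d2 by linarith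
    qed
    ultimately show ?thesis by (simp add: cut_def smooth_step_ge1)
  qed
  have cutlim: "(\<lambda>n. cut n x) \<longlonglongrightarrow> indicator {a<..<b} x" for x
  proof -
    have "eventually (\<lambda>n. cut n x = indicator {a<..<b} x) sequentially"
    proof (cases "x \<in> {a<..<b}")
      case False
      show ?thesis using ev
      proof eventually_elim
        case (elim n)
        then have "0 < 1 / real n" by simp
        then have "x \<notin> {a + 1 / real n..b - 1 / real n}"
          using False unfolding greaterThanLessThan_iff atLeastAtMost_iff by linarith
        then show ?case using cut0 elim False by simp
      qed
    next
      case True
      have "(\<lambda>n. 2 / real n) \<longlonglongrightarrow> 0"
        using tendsto_mult[OF tendsto_const[of 2] lim_1_over_n] by simp
      then have "eventually (\<lambda>n. 2 / real n < min (x - a) (b - x)) sequentially"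
        using True by (intro order_tendstoD) auto
      then show ?thesis using ev
      proof eventually_elim
        case (elim n)
        have "1 \<le> real n * (x - (a + 1 / real n))" "real n * (x - (b - 2 / real n)) \<le> 0"
        proof -
          have "2 / real n = 1 / real n + 1 / real n" by simp
          then have "1 / real n \<le> x - (a + 1 / real n)" using elim(1) by linarith
          then show "1 \<le> real n * (x - (a + 1 / real n))"
            using elim(2) by (simp only: divide_le_eq split: if_splits) (simp add: mult.commute)
          show "real n * (x - (b - 2 / real n)) \<le> 0"
            using elim by (intro mult_nonneg_nonpos) auto
        qed
        then show ?case using True by (simp add: cut_def smooth_step_le0 smooth_step_ge1)
      qed
    qed
    then show ?thesis by (rule tendsto_eventually)
  qed
  \<comment> \<open>The weak formulation for the product test function, rearranged so that the
    concentrating part with \<open>cut'\<close> stands alone on the left.\<close>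
  have weak: "eventually (\<lambda>n. (LINT x|I0 L. cut' n x *\<^sub>R (\<phi> x *\<^sub>R u x)) =
       - (LINT x|I0 L. cut n x *\<^sub>R (\<phi>' x *\<^sub>R u x + \<phi> x *\<^sub>R g x))) sequentially"
    using ev
  proof eventually_elim
    case (elim n)
    define a' b' where "a' = a + 1 / real n" and "b' = b - 1 / real n"
    have *: "((\<lambda>x. cut n x * \<phi> x) has_real_derivative cut' n x * \<phi> x + cut n x * \<phi>' x) (at x)" for x
      by (rule DERIV_cong[OF DERIV_mult[OF dcut \<phi>(1)]]) simp
    have t: "test_function L (\<lambda>x. cut n x * \<phi> x)" "deriv (\<lambda>x. cut n x * \<phi> x) = (\<lambda>x. cut' n x * \<phi> x + cut n x * \<phi>' x)"
    proof -
      have p: "0 < 1 / real n" using elim by simp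
      have "0 < a'" "b' < L" using p ab unfolding a'_def b'_def by linarith+
      moreover have "cut n x * \<phi> x = 0" if "x \<notin> {a'..b'}" for x
        using cut0[of n x] elim that by (simp add: a'_def b'_def)
      moreover have "continuous_on UNIV (\<lambda>x. cut' n x * \<phi> x + cut n x * \<phi>' x)"
        by (intro continuous_intros ccut ccut' c\<phi> c\<phi>')
      ultimately show "test_function L (\<lambda>x. cut n x * \<phi> x)" "deriv (\<lambda>x. cut n x * \<phi> x) = (\<lambda>x. cut' n x * \<phi> x + cut n x * \<phi>' x)"
        using test_functionI[OF _ *, of a' b'] by blast+
    qed
    have i1: "integrable (I0 L) (\<lambda>x. cut' n x *\<^sub>R (\<phi> x *\<^sub>R u x))"
      by (rule integrable_I0_continuous_scaleR[OF ccut' integrable_I0_continuous_scaleR[OF c\<phi> ui]])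
    have i2: "integrable (I0 L) (\<lambda>x. cut n x *\<^sub>R (\<phi>' x *\<^sub>R u x))"
      by (rule integrable_I0_continuous_scaleR[OF ccut integrable_I0_continuous_scaleR[OF c\<phi>' ui]])
    have i3: "integrable (I0 L) (\<lambda>x. cut n x *\<^sub>R (\<phi> x *\<^sub>R g x))"
      by (rule integrable_I0_continuous_scaleR[OF ccut integrable_I0_continuous_scaleR[OF c\<phi> gi]])
    have "(LINT x|I0 L. (cut' n x * \<phi> x + cut n x * \<phi>' x) *\<^sub>R u x) = - (LINT x|I0 L. (cut n x * \<phi> x) *\<^sub>R g x)"
    proof -
      have "(LINT x|I0 L. deriv (\<lambda>x. cut n x * \<phi> x) x *\<^sub>R u x) = - (LINT x|I0 L. (cut n x * \<phi> x) *\<^sub>R g x)"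
        using u t(1) unfolding has_H1_derivative_def has_weak_derivative_def by blast
      then show ?thesis unfolding t(2) .
    qed
    moreover have "(LINT x|I0 L. (cut' n x * \<phi> x + cut n x * \<phi>' x) *\<^sub>R u x) =
        (LINT x|I0 L. cut' n x *\<^sub>R (\<phi> x *\<^sub>R u x)) + (LINT x|I0 L. cut n x *\<^sub>R (\<phi>' x *\<^sub>R u x))"
      by (subst LINT_plus[OF i1 i2, symmetric]) (simp add: scaleR_add_left)
    moreover have "(LINT x|I0 L. cut n x *\<^sub>R (\<phi>' x *\<^sub>R u x + \<phi> x *\<^sub>R g x)) =
       (LINT x|I0 L. cut n x *\<^sub>R (\<phi>' x *\<^sub>R u x)) + (LINT x|I0 L. (cut n x * \<phi> x) *\<^sub>R g x)"
      unfolding scaleR_add_right by (subst LINT_plus[OF i2 i3]) simp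
    ultimately show ?case by (simp add: algebra_simps)
  qed
  have c\<phi>u: "continuous_on {0..L} (\<lambda>x. \<phi> x *\<^sub>R u x)"
    by (intro continuous_intros cu c\<phi>)
  have A: "(\<lambda>n. LINT x|I0 L. cut' n x *\<^sub>R (\<phi> x *\<^sub>R u x)) \<longlonglongrightarrow> \<phi> a *\<^sub>R u a - \<phi> b *\<^sub>R u b"
  proof -
    have 1: "(\<lambda>n. LINT x|I0 L. (real n * hat (real n * (x - (a + 1 / real n)))) *\<^sub>R (\<phi> x *\<^sub>R u x)) \<longlonglongrightarrow> \<phi> a *\<^sub>R u a"
    proof (rule hat_kernel_tendsto[OF c\<phi>u lim1])
      show "\<forall>\<^sub>F n in sequentially. 0 \<le> a + 1 / real n \<and> a + 1 / real n + 1 / real n \<le> L"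
        using ev
      proof eventually_elim
        case (elim n)
        have "1 / real n + 1 / real n \<le> 3 / real n" "0 \<le> 1 / real n" by (auto simp: divide_right_mono)
        then show ?case using elim ab by linarith
      qed
    qed (use ab in auto)
    have 2: "(\<lambda>n. LINT x|I0 L. (real n * hat (real n * (x - (b - 2 / real n)))) *\<^sub>R (\<phi> x *\<^sub>R u x)) \<longlonglongrightarrow> \<phi> b *\<^sub>R u b"
    proof (rule hat_kernel_tendsto[OF c\<phi>u lim2])
      show "\<forall>\<^sub>F n in sequentially. 0 \<le> b - 2 / real n \<and> b - 2 / real n + 1 / real n \<le> L"
        using ev
      proof eventually_elim
        case (elim n)
        have "2 / real n \<le> 3 / real n" "1 / real n \<le> 2 / real n" by (auto simp: divide_right_mono)
        then show ?case using elim ab by linarith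
      qed
    qed (use ab in auto)
    have c1: "continuous_on {0..L} (\<lambda>x. real n * hat (real n * (x - p)))" for n p
      by (intro continuous_intros continuous_on_compose2[OF continuous_hat]) auto
    have "(LINT x|I0 L. cut' n x *\<^sub>R (\<phi> x *\<^sub>R u x)) =
        (LINT x|I0 L. (real n * hat (real n * (x - (a + 1 / real n)))) *\<^sub>R (\<phi> x *\<^sub>R u x)) -
        (LINT x|I0 L. (real n * hat (real n * (x - (b - 2 / real n)))) *\<^sub>R (\<phi> x *\<^sub>R u x))" for n
      unfolding cut'_def scaleR_diff_left
      by (rule LINT_minus) (rule integrable_I0_continuous_scaleR[OF c1 integrable_I0_continuous_scaleR[OF c\<phi> ui]])+
    then show ?thesis using tendsto_diff[OF 1 2] by simp
  qed
  have B: "(\<lambda>n. LINT x|I0 L. cut n x *\<^sub>R (\<phi>' x *\<^sub>R u x + \<phi> x *\<^sub>R g x)) \<longlonglongrightarrow>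
     (LINT x|I0 L. indicator {a<..<b} x *\<^sub>R (\<phi>' x *\<^sub>R u x + \<phi> x *\<^sub>R g x))"
  proof (rule integral_dominated_convergence)
    have i: "integrable (I0 L) (\<lambda>x. \<phi>' x *\<^sub>R u x + \<phi> x *\<^sub>R g x)"
      by (rule integrable_plus[OF integrable_I0_continuous_scaleR[OF c\<phi>' ui] integrable_I0_continuous_scaleR[OF c\<phi> gi]])
    then show "integrable (I0 L) (\<lambda>x. norm (\<phi>' x *\<^sub>R u x + \<phi> x *\<^sub>R g x))"
      by (rule integrable_norm)
    show "(\<lambda>x. cut n x *\<^sub>R (\<phi>' x *\<^sub>R u x + \<phi> x *\<^sub>R g x)) \<in> borel_measurable (I0 L)" for n
      by (rule borel_measurable_integrable[OF integrable_I0_continuous_scaleR[OF ccut i]])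
    show "(\<lambda>x. indicator {a<..<b} x *\<^sub>R (\<phi>' x *\<^sub>R u x + \<phi> x *\<^sub>R g x)) \<in> borel_measurable (I0 L)"
      by (rule borel_measurable_integrable[OF integrable_I0_indicator[OF i]]) simp
    show "AE x in I0 L. (\<lambda>n. cut n x *\<^sub>R (\<phi>' x *\<^sub>R u x + \<phi> x *\<^sub>R g x)) \<longlonglongrightarrow> indicator {a<..<b} x *\<^sub>R (\<phi>' x *\<^sub>R u x + \<phi> x *\<^sub>R g x)"
      by (rule AE_I2) (intro tendsto_scaleR cutlim tendsto_const)
    show "AE x in I0 L. norm (cut n x *\<^sub>R (\<phi>' x *\<^sub>R u x + \<phi> x *\<^sub>R g x)) \<le> norm (\<phi>' x *\<^sub>R u x + \<phi> x *\<^sub>R g x)" for n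
      by (rule AE_I2) (simp add: mult_left_le_one_le cutb)
  qed
  have "(\<lambda>n. LINT x|I0 L. cut' n x *\<^sub>R (\<phi> x *\<^sub>R u x)) \<longlonglongrightarrow> - (LINT x|I0 L. indicator {a<..<b} x *\<^sub>R (\<phi>' x *\<^sub>R u x + \<phi> x *\<^sub>R g x))"
    by (rule tendsto_cong[OF weak, THEN iffD2]) (rule tendsto_minus[OF B])
  from LIMSEQ_unique[OF A this] show ?thesis by (simp add: algebra_simps)
qed

lemma H1_fundamental_theorem:
  assumes u: "has_H1_derivative L u g" and ab: "0 \<le> a" "a < b" "b \<le> L"
  shows "(LINT x|I0 L. indicator {a<..<b} x *\<^sub>R g x) = u b - u a"
  using H1_integration_by_parts[OF u _ _ ab, of "\<lambda>_. 1" "\<lambda>_. 0"] by simp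

section \<open>Partitions and $L^2$ approximation\<close>

lemma AE_I0_not_in_finite:
  assumes "finite S"
  shows "AE x in I0 L. x \<notin> S"
proof -
  have "AE x in lebesgue. x \<notin> S"
    by (rule AE_not_in[OF null_sets_completionI[OF finite_imp_null_set_lborel[OF assms]]])
  then show ?thesis
    by (simp add: AE_restrict_space_iff eventually_mono)
qed

lemma partition_less:
  assumes "partition L N X" "i < j" "j \<le> N"
  shows "X i < X j"
  using assms(2,3)
proof (induction j)
  case (Suc j)
  have s: "X j < X (Suc j)" using assms(1) Suc.prems by (simp add: partition_def)
  show ?case
  proof (cases "i = j")
    case False
    then show ?thesis using Suc s by auto
  qed (use s in simp)
qed simp

lemma partition_range:
  assumes "partition L N X" "j \<le> N"
  shows "0 \<le> X j" "X j \<le> L"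
proof -
  have X: "X 0 = 0" "X N = L" using assms(1) by (auto simp: partition_def)
  show "0 \<le> X j"
    using partition_less[OF assms(1), of 0 j] assms(2) X by (cases "j = 0") auto
  show "X j \<le> L"
    using partition_less[OF assms(1), of j N] assms(2) X by (cases "j = N") auto
qed

lemma partition_mesh:
  assumes "partition L N X" "j < N"
  shows "X (Suc j) - X j \<le> mesh_size N X"
  unfolding mesh_size_def using assms(2) by (intro Max_ge) auto

text \<open>The open elements telescope to (0, X n) as long as x is no node; the induction therefore
  carries a prefix of the partition.\<close>

lemma partition_sum_indicator:
  assumes "partition L N X" "n \<le> N" "x \<notin> X ` {..N}"
  shows "(\<Sum>j<n. indicator {X j<..<X (Suc j)} x :: real) = indicator {0<..<X n} x"
  using assms(2)
proof (induction n)
  case 0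
  then show ?case using assms(1) by (simp add: partition_def)
next
  case (Suc n)
  have X: "X n < X (Suc n)" "0 \<le> X n" "x \<noteq> X n"
    using partition_range(1)[OF assms(1), of n] assms Suc.prems by (auto simp: partition_def)
  then show ?case
    using Suc by (auto simp: indicator_def)
qed

lemma partition_elem:
  assumes "partition L N X" "x \<in> {0<..<L}" "x \<notin> X ` {..N}"
  obtains j where "j < N" "x \<in> {X j<..<X (Suc j)}" 
    "\<And>i. i < N \<Longrightarrow> (indicator {X i<..<X (Suc i)} x :: real) = (if i = j then 1 else 0)"
proof -
  have s: "(\<Sum>j<N. indicator {X j<..<X (Suc j)} x :: real) = 1"
    using partition_sum_indicator[OF assms(1) order_refl assms(3)] assms(1,2) by (simp add: partition_def)
  then obtain j where j: "j < N" "x \<in> {X j<..<X (Suc j)}"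
    by (metis (no_types, lifting) indicator_simps(2) lessThan_iff sum.neutral zero_neq_one)
  have "x \<notin> {X i<..<X (Suc i)}" if "i < N" "i \<noteq> j" for i
  proof
    assume i: "x \<in> {X i<..<X (Suc i)}"
    have "X (Suc i) \<le> X j \<or> X (Suc j) \<le> X i"
    proof (cases "i < j")
      case True
      then show ?thesis using partition_less[OF assms(1), of "Suc i" j] j by (cases "Suc i = j") auto
    next
      case False
      then have "j < i" using that by simp
      then show ?thesis using partition_less[OF assms(1), of "Suc j" i] that by (cases "Suc j = i") auto
    qed
    then show False using i j by auto
  qed
  then show thesis using that[of j] j by auto
qed

lemma partition_closed_elem:
  assumes "partition L N X" "x \<in> {0..L}"
  obtains j where "j < N" "x \<in> {X j..X (Suc j)}"
proof (cases "x \<in> X ` {..N}")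
  case True
  then obtain i where i: "i \<le> N" "x = X i" by auto
  have N: "0 < N" using assms(1) by (simp add: partition_def)
  show thesis
  proof (cases i)
    case 0
    then show ?thesis using that[of 0] i N partition_less[OF assms(1), of 0 1] by auto
  next
    case (Suc j)
    then show ?thesis using that[of j] i partition_less[OF assms(1), of j i] by auto
  qed
next
  case False
  then have "x \<noteq> X 0" "x \<noteq> X N" by auto
  then have "x \<in> {0<..<L}" using assms by (auto simp: partition_def)
  then show thesis using partition_elem[OF assms(1) _ False] that by (metis atLeastAtMost_iff greaterThanLessThan_iff less_imp_le)
qed

lemma partition_LINT_sum:
  fixes f :: "real \<Rightarrow> 'a::euclidean_space"
  assumes X: "partition L N X" and f: "integrable (I0 L) f"
  shows "integral\<^sup>L (I0 L) f = (\<Sum>j<N. LINT x|I0 L. indicator {X j<..<X (Suc j)} x *\<^sub>R f x)"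
proof -
  have i: "integrable (I0 L) (\<lambda>x. indicator {X j<..<X (Suc j)} x *\<^sub>R f x)" for j
    by (rule integrable_I0_indicator[OF f]) simp
  have "integral\<^sup>L (I0 L) f = (LINT x|I0 L. (\<Sum>j<N. indicator {X j<..<X (Suc j)} x *\<^sub>R f x))"
  proof (rule integral_cong_AE)
    have "AE x in I0 L. x \<notin> X ` {..N}" by (rule AE_I0_not_in_finite) simp
    then show "AE x in I0 L. f x = (\<Sum>j<N. indicator {X j<..<X (Suc j)} x *\<^sub>R f x)"
    proof (rule AE_mp[OF _ AE_I2], intro impI)
      fix x assume x: "x \<in> space (I0 L)" "x \<notin> X ` {..N}"
      have "(\<Sum>j<N. indicator {X j<..<X (Suc j)} x :: real) = 1"
        using partition_sum_indicator[OF X order_refl x(2)] X x(1) by (simp add: partition_def)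
      then show "f x = (\<Sum>j<N. indicator {X j<..<X (Suc j)} x *\<^sub>R f x)"
        by (simp add: scaleR_sum_left[symmetric])
    qed
    show "f \<in> borel_measurable (I0 L)" by (rule borel_measurable_integrable[OF f])
    show "(\<lambda>x. \<Sum>j<N. indicator {X j<..<X (Suc j)} x *\<^sub>R f x) \<in> borel_measurable (I0 L)"
      by (rule borel_measurable_integrable[OF Bochner_Integration.integrable_sum[OF i]])
  qed
  also have "\<dots> = (\<Sum>j<N. LINT x|I0 L. indicator {X j<..<X (Suc j)} x *\<^sub>R f x)"
    by (rule Bochner_Integration.integral_sum) (rule i)
  finally show ?thesis .
qed

text \<open>Projection onto a ball is the vector-valued form of truncation: it is continuous,
  bounded, eventually the identity as r grows, and its defect is dominated by the argument
  itself.\<close>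

lemma closest_point_ball:
  fixes x y :: "'a::euclidean_space"
  assumes "0 \<le> r"
  shows "norm (closest_point (cball 0 r) x) \<le> r"
    and "norm (x - closest_point (cball 0 r) x) \<le> norm x"
    and "norm x \<le> r \<Longrightarrow> closest_point (cball 0 r) x = x"
    and "continuous_on UNIV (closest_point (cball (0::'a) r))"
proof -
  have ne: "cball 0 r \<noteq> ({} :: 'a set)" using assms by simp
  show "norm (closest_point (cball 0 r) x) \<le> r"
    using closest_point_in_set[OF closed_cball ne, of x] by simp
  show "norm (x - closest_point (cball 0 r) x) \<le> norm x"
    using closest_point_le[of "cball 0 r" 0 x] assms by (simp add: dist_norm)
  show "norm x \<le> r \<Longrightarrow> closest_point (cball 0 r) x = x"
    by (intro closest_point_self) simp
  show "continuous_on UNIV (closest_point (cball (0::'a) r))"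
    by (intro continuous_on_closest_point convex_cball closed_cball ne)
qed

text \<open>Two dominated limits. Truncation at radius m costs little because the defect is
  dominated by |z|. Truncations of continuous functions converging almost everywhere to z then
  converge boundedly on a set of finite measure.\<close>

lemma L2_dense_continuous:
  assumes z: "square_integrable L z" and e: "0 < e"
  shows "\<exists>g. continuous_on UNIV g \<and> L2sq L (\<lambda>x. z x - g x) < e"
proof -
  define P where "P r = closest_point (cball (0::real^3) r)" for r
  have Pm: "(\<lambda>x. P (real n) (f x)) \<in> borel_measurable (I0 L)" if "f \<in> borel_measurable (I0 L)" for f n
    using measurable_compose[OF that borel_measurable_continuous_onI[OF closest_point_ball(4)]]
    unfolding P_def by simp
  have zm: "z \<in> borel_measurable (I0 L)" by (rule square_integrable_measurable[OF z])
  have "(\<lambda>n. L2sq L (\<lambda>x. z x - P (real n) (z x))) \<longlonglongrightarrow> (LINT x|I0 L. 0)"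
    unfolding L2sq_def
  proof (rule integral_dominated_convergence[OF _ _ square_integrableD[OF z]])
    show "(\<lambda>x. (norm (z x - P (real n) (z x)))\<^sup>2) \<in> borel_measurable (I0 L)" for n
      by (intro borel_measurable_power measurable_norm_comp borel_measurable_diff zm Pm)
    show "AE x in I0 L. (\<lambda>n. (norm (z x - P (real n) (z x)))\<^sup>2) \<longlonglongrightarrow> 0"
    proof (rule AE_I2)
      fix x
      obtain m where m: "norm (z x) \<le> real m" using real_arch_simple by blast
      have "eventually (\<lambda>n. (norm (z x - P (real n) (z x)))\<^sup>2 = 0) sequentially"
        using eventually_ge_at_top[of m]
        by eventually_elim (use m in \<open>simp add: P_def closest_point_ball(3)\<close>)
      then show "(\<lambda>n. (norm (z x - P (real n) (z x)))\<^sup>2) \<longlonglongrightarrow> 0" by (rule tendsto_eventually)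
    qed
    show "AE x in I0 L. norm ((norm (z x - P (real n) (z x)))\<^sup>2) \<le> (norm (z x))\<^sup>2" for n
      by (rule AE_I2) (simp add: P_def power_mono closest_point_ball(2))
  qed simp
  then have "(\<lambda>n. L2sq L (\<lambda>x. z x - P (real n) (z x))) \<longlonglongrightarrow> 0" by simp
  \<comment> \<open>A quarter of e each, since \<open>L2sq_add_le\<close> doubles both of the errors
    that are added.\<close>
  then have "eventually (\<lambda>n. L2sq L (\<lambda>x. z x - P (real n) (z x)) < e/4) sequentially"
    using e by (intro order_tendstoD) auto
  then obtain m where m: "L2sq L (\<lambda>x. z x - P (real m) (z x)) < e/4"
    by (meson eventually_sequentially order_refl)
  \<comment> \<open>Unfolding \<open>measurable_on\<close> directly delivers continuous functions
    that converge to z off a negligible set.\<close>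
  have "z measurable_on {0<..<L}"
    using measurable_on_iff_borel_measurable[of "{0<..<L}" z] zm by simp
  then obtain S g where g: "negligible S" "\<And>n. continuous_on UNIV (g n)"
      "\<And>x. x \<notin> S \<Longrightarrow> (\<lambda>n. g n x) \<longlonglongrightarrow> (if x \<in> {0<..<L} then z x else 0)"
    unfolding measurable_on_def by metis
  have gc: "continuous_on A (\<lambda>x. P (real m) (g n x))" for n A
    unfolding P_def
    by (rule continuous_on_compose2[OF closest_point_ball(4)]) (auto intro: continuous_on_subset[OF g(2)])
  have gm: "(\<lambda>x. P (real m) (g n x)) \<in> borel_measurable (I0 L)" for n
    by (rule continuous_measurable_I0[OF gc])
  have "(\<lambda>n. L2sq L (\<lambda>x. P (real m) (z x) - P (real m) (g n x))) \<longlonglongrightarrow> (LINT x|I0 L. 0)"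
    unfolding L2sq_def
  proof (rule integral_dominated_convergence)
    show "(\<lambda>x. (norm (P (real m) (z x) - P (real m) (g n x)))\<^sup>2) \<in> borel_measurable (I0 L)" for n
      by (intro borel_measurable_power measurable_norm_comp borel_measurable_diff gm Pm zm)
    have "AE x in lebesgue. x \<notin> S"
      by (rule AE_not_in) (use g(1) in \<open>simp add: negligible_iff_null_sets\<close>)
    then have "AE x in I0 L. x \<notin> S" by (simp add: AE_restrict_space_iff eventually_mono) 
    then show "AE x in I0 L. (\<lambda>n. (norm (P (real m) (z x) - P (real m) (g n x)))\<^sup>2) \<longlonglongrightarrow> 0"
    proof (rule AE_mp[OF _ AE_I2], intro impI)
      fix x assume x: "x \<in> space (I0 L)" "x \<notin> S"
      have "(\<lambda>n. g n x) \<longlonglongrightarrow> z x" using g(3)[OF x(2)] x(1) by simp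
      then have "(\<lambda>n. P (real m) (g n x)) \<longlonglongrightarrow> P (real m) (z x)"
        unfolding P_def by (intro continuous_on_tendsto_compose[OF closest_point_ball(4)]) auto
      then have "(\<lambda>n. (norm (P (real m) (z x) - P (real m) (g n x)))\<^sup>2) \<longlonglongrightarrow> (norm (P (real m) (z x) - P (real m) (z x)))\<^sup>2"
        by (intro tendsto_intros)
      then show "(\<lambda>n. (norm (P (real m) (z x) - P (real m) (g n x)))\<^sup>2) \<longlonglongrightarrow> 0" by simp
    qed
    show "integrable (I0 L) (\<lambda>x. (2 * real m)\<^sup>2)"
      by (rule integrable_I0_const)
    have "norm (P (real m) a - P (real m) b) \<le> 2 * real m" for a b
      using norm_triangle_ineq4[of "P (real m) a" "P (real m) b"]
        closest_point_ball(1)[of "real m" a] closest_point_ball(1)[of "real m" b] unfolding P_def by simp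
    then have "(norm (P (real m) a - P (real m) b))\<^sup>2 \<le> (2 * real m)\<^sup>2" for a b
      by (rule power_mono) simp
    then show "AE x in I0 L. norm ((norm (P (real m) (z x) - P (real m) (g n x)))\<^sup>2) \<le> (2 * real m)\<^sup>2" for n
      by (intro AE_I2) simp
  qed simp
  then have "(\<lambda>n. L2sq L (\<lambda>x. P (real m) (z x) - P (real m) (g n x))) \<longlonglongrightarrow> 0" by simp
  then have "eventually (\<lambda>n. L2sq L (\<lambda>x. P (real m) (z x) - P (real m) (g n x)) < e/4) sequentially"
    using e by (intro order_tendstoD) auto
  then obtain n where n: "L2sq L (\<lambda>x. P (real m) (z x) - P (real m) (g n x)) < e/4"
    by (meson eventually_sequentially order_refl)
  have b: "norm (P (real m) a) \<le> real m" for a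
    unfolding P_def by (rule closest_point_ball(1)) simp
  have sq: "square_integrable L (\<lambda>x. P (real m) (z x))" "square_integrable L (\<lambda>x. P (real m) (g n x))"
    by (rule square_integrable_bounded[OF _ b]; rule Pm[OF zm] gm)+
  have "L2sq L (\<lambda>x. (z x - P (real m) (z x)) + (P (real m) (z x) - P (real m) (g n x))) < e"
    using L2sq_add_le[OF square_integrable_diff[OF z sq(1)] square_integrable_diff[OF sq]] m n by linarith
  then show ?thesis using gc[of UNIV n] by (intro exI[of _ "\<lambda>x. P (real m) (g n x)"]) simp
qed

definition step_fun :: "nat \<Rightarrow> (nat \<Rightarrow> real) \<Rightarrow> (nat \<Rightarrow> 'a) \<Rightarrow> real \<Rightarrow> 'a::real_vector" where
  "step_fun N X c x = (\<Sum>j<N. indicator {X j<..<X (Suc j)} x *\<^sub>R c j)"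

lemma step_fun_eq:
  assumes "partition L N X" "j < N" "x \<in> {X j<..<X (Suc j)}"
  shows "step_fun N X c x = c j"
proof -
  have "x \<notin> X ` {..N}"
  proof
    assume "x \<in> X ` {..N}"
    then obtain i where i: "i \<le> N" "x = X i" by auto
    show False
    proof (cases "i \<le> j")
      case True
      then show ?thesis using partition_less[OF assms(1), of i j] assms i by (cases "i = j") auto
    next
      case False
      then show ?thesis using partition_less[OF assms(1), of "Suc j" i] assms i by (cases "i = Suc j") auto
    qed
  qed
  moreover have "x \<in> {0<..<L}"
    using partition_range[OF assms(1), of j] partition_range[OF assms(1), of "Suc j"] assms by auto
  ultimately obtain i where i: "i < N" "x \<in> {X i<..<X (Suc i)}" 
    "\<And>i'. i' < N \<Longrightarrow> (indicator {X i'<..<X (Suc i')} x :: real) = (if i' = i then 1 else 0)"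
    using partition_elem[OF assms(1)] by metis
  then have "i = j" using i(3)[OF assms(2)] assms(3) by (auto split: if_splits)
  have "step_fun N X c x = (\<Sum>i'<N. if i' = i then c i' else 0)"
    unfolding step_fun_def by (rule sum.cong) (auto simp: i(3))
  then show ?thesis using i(1) \<open>i = j\<close> by simp
qed

lemma step_fun_measurable:
  fixes c :: "nat \<Rightarrow> 'a::euclidean_space"
  shows "step_fun N X c \<in> borel_measurable borel"
  unfolding step_fun_def[abs_def] by measurable

lemma step_fun_bounded:
  fixes c :: "nat \<Rightarrow> 'a::euclidean_space"
  shows "norm (step_fun N X c x) \<le> (\<Sum>j<N. norm (c j))"
  unfolding step_fun_def
  by (rule order_trans[OF norm_sum], rule sum_mono) (simp add: indicator_def)

lemma step_fun_square_integrable: "square_integrable L (step_fun N X c)"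
  by (rule square_integrable_bounded[OF borel_measurable_I0[OF step_fun_measurable] step_fun_bounded])

lemma AE_partition:
  assumes X: "partition L N X"
    and P: "\<And>j x. j < N \<Longrightarrow> x \<in> {X j<..<X (Suc j)} \<Longrightarrow> P x"
  shows "AE x in I0 L. P x"
proof -
  have "AE x in I0 L. x \<notin> X ` {..N}" by (rule AE_I0_not_in_finite) simp
  then show ?thesis
  proof (rule AE_mp[OF _ AE_I2], intro impI)
    fix x assume x: "x \<in> space (I0 L)" "x \<notin> X ` {..N}"
    then have "x \<in> {0<..<L}" by simp
    from partition_elem[OF X this x(2)] show "P x" using P by metis
  qed
qed

text \<open>The threshold d depends only on the modulus of uniform continuity of one continuous
  approximation of z. It is therefore valid for every partition with small mesh, which is needed
  because the partitions of the family are not nested.\<close>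

lemma L2_step_approx:
  assumes z: "square_integrable L z" and e: "0 < e" and L: "0 < L"
  shows "\<exists>d>0. \<forall>N X. partition L N X \<and> mesh_size N X < d \<longrightarrow>
           (\<exists>c. L2sq L (\<lambda>x. z x - step_fun N X c x) < e)"
proof -
  obtain g where g: "continuous_on UNIV g" "L2sq L (\<lambda>x. z x - g x) < e/4"
    using L2_dense_continuous[OF z, of "e/4"] e by auto
  have gs: "square_integrable L g"
    by (rule square_integrable_continuous[OF continuous_on_subset[OF g(1)]]) simp
  \<comment> \<open>A pointwise error q on (0,L) contributes q^2 L = e/4 to the squared
    norm.\<close>
  define q where "q = sqrt (e / (4 * L))"
  have q: "0 < q" "q\<^sup>2 * L = e / 4" using e L by (auto simp: q_def)
  have "uniformly_continuous_on {0..L} g"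
    by (rule compact_uniformly_continuous[OF continuous_on_subset[OF g(1)]]) auto
  then obtain d where d: "0 < d" "\<And>x y. x \<in> {0..L} \<Longrightarrow> y \<in> {0..L} \<Longrightarrow> dist y x < d \<Longrightarrow> dist (g y) (g x) < q"
    unfolding uniformly_continuous_on_def using q(1) by metis
  show ?thesis
  proof (intro exI[of _ d] conjI allI impI d(1))
    fix N X assume A: "partition L N X \<and> mesh_size N X < d"
    then have X: "partition L N X" by simp
    define s where "s = step_fun N X (\<lambda>j. g (X j))"
    have ss: "square_integrable L s" unfolding s_def by (rule step_fun_square_integrable)
    have "AE x in I0 L. (norm (g x - s x))\<^sup>2 \<le> q\<^sup>2"
    proof (rule AE_partition[OF X])
      fix j x assume j: "j < N" "x \<in> {X j<..<X (Suc j)}"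
      have "dist x (X j) < d" using partition_mesh[OF X j(1)] A j(2) by (simp add: dist_real_def)
      moreover have "X j \<in> {0..L}" "x \<in> {0..L}"
        using partition_range[OF X, of j] partition_range[OF X, of "Suc j"] j by simp_all
      ultimately have "dist (g x) (g (X j)) < q" by (simp add: d(2))
      then have "norm (g x - s x) \<le> q"
        unfolding s_def step_fun_eq[OF X j] dist_norm by simp
      then show "(norm (g x - s x))\<^sup>2 \<le> q\<^sup>2" by (rule power_mono) simp
    qed
    then have "L2sq L (\<lambda>x. g x - s x) \<le> (LINT x|I0 L. q\<^sup>2)"
      unfolding L2sq_def
      by (intro integral_mono_AE square_integrableD[OF square_integrable_diff[OF gs ss]]
          integrable_I0_const)
    also have "\<dots> = e/4" using measure_I0[of L] L q(2) by (simp add: mult.commute)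
    finally have "L2sq L (\<lambda>x. (z x - g x) + (g x - s x)) < e"
      using L2sq_add_le[OF square_integrable_diff[OF z gs] square_integrable_diff[OF gs ss]] g(2) by linarith
    then show "\<exists>c. L2sq L (\<lambda>x. z x - step_fun N X c x) < e"
      unfolding s_def by auto
  qed
qed

text \<open>Pythagoras: z - p is orthogonal to p - s for the step function s. Orthogonality is
  demanded against p - c rather than against constants because p may be elementwise affine, as a
  second derivative of a cubic is.\<close>

lemma L2_best_approx:
  assumes X: "partition L N X" and z: "square_integrable L z" and p: "square_integrable L p"
    and orth: "\<And>j. j < N \<Longrightarrow> (LINT x|I0 L. indicator {X j<..<X (Suc j)} x *\<^sub>R ((z x - p x) \<bullet> (p x - c j))) = 0"
  shows "L2sq L (\<lambda>x. z x - p x) \<le> L2sq L (\<lambda>x. z x - step_fun N X c x)"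
proof -
  let ?s = "step_fun N X c"
  have s: "square_integrable L ?s" by (rule step_fun_square_integrable)
  note zp = square_integrable_diff[OF z p] and ps = square_integrable_diff[OF p s]
  note i = square_integrable_inner[OF zp ps]
  have "(LINT x|I0 L. (z x - p x) \<bullet> (p x - ?s x)) = 
      (\<Sum>j<N. LINT x|I0 L. indicator {X j<..<X (Suc j)} x *\<^sub>R ((z x - p x) \<bullet> (p x - ?s x)))"
    by (rule partition_LINT_sum[OF X i])
  also have "\<dots> = (\<Sum>j<N. LINT x|I0 L. indicator {X j<..<X (Suc j)} x *\<^sub>R ((z x - p x) \<bullet> (p x - c j)))"
  proof (intro sum.cong refl LINT_cong)
    fix j x assume "j \<in> {..<N}"
    then show "indicator {X j<..<X (Suc j)} x *\<^sub>R ((z x - p x) \<bullet> (p x - ?s x)) =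
        indicator {X j<..<X (Suc j)} x *\<^sub>R ((z x - p x) \<bullet> (p x - c j))"
      using step_fun_eq[OF X, of j x c] by (cases "x \<in> {X j<..<X (Suc j)}") auto
  qed
  also have "\<dots> = 0" by (rule sum.neutral) (use orth in blast)
  finally have 0: "(LINT x|I0 L. (z x - p x) \<bullet> (p x - ?s x)) = 0" .
  have "L2sq L (\<lambda>x. z x - ?s x) = (LINT x|I0 L. (norm (z x - p x))\<^sup>2 + (norm (p x - ?s x))\<^sup>2 + 2 * ((z x - p x) \<bullet> (p x - ?s x)))"
    unfolding L2sq_def
  proof (intro LINT_cong refl)
    fix x
    show "(norm (z x - ?s x))\<^sup>2 = (norm (z x - p x))\<^sup>2 + (norm (p x - ?s x))\<^sup>2 + 2 * ((z x - p x) \<bullet> (p x - ?s x))"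
      using dot_norm[of "z x - p x" "p x - ?s x"] by simp
  qed
  also have "\<dots> = (LINT x|I0 L. (norm (z x - p x))\<^sup>2 + (norm (p x - ?s x))\<^sup>2) +
      (LINT x|I0 L. 2 * ((z x - p x) \<bullet> (p x - ?s x)))"
    by (rule LINT_plus[OF integrable_plus[OF
          square_integrableD[OF zp] square_integrableD[OF ps]] integrable_mult_right[OF i]])
  also have "(LINT x|I0 L. (norm (z x - p x))\<^sup>2 + (norm (p x - ?s x))\<^sup>2) =
      L2sq L (\<lambda>x. z x - p x) + L2sq L (\<lambda>x. p x - ?s x)"
    unfolding L2sq_def by (rule LINT_plus[OF square_integrableD[OF zp] square_integrableD[OF ps]])
  also have "(LINT x|I0 L. 2 * ((z x - p x) \<bullet> (p x - ?s x))) = 0"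
    unfolding integral_mult_right_zero 0 by simp
  finally show ?thesis using L2sq_nonneg[of L "\<lambda>x. p x - ?s x"] by linarith
qed

text \<open>The projection p is described by its orthogonality alone and the threshold is uniform
  over partitions and p. Any elementwise projection onto a space containing the constants is thus
  covered, without an explicit formula.\<close>

lemma L2_projection_converges:
  assumes z: "square_integrable L z" and e: "0 < e" and L: "0 < L"
  shows "\<exists>d>0. \<forall>N X p. partition L N X \<and> mesh_size N X < d \<and> square_integrable L p \<and>
     (\<forall>j<N. \<forall>c. (LINT x|I0 L. indicator {X j<..<X (Suc j)} x *\<^sub>R ((z x - p x) \<bullet> (p x - c))) = 0)
     \<longrightarrow> L2sq L (\<lambda>x. z x - p x) < e"
proof -
  obtain d where d: "d > 0" "\<And>N X. partition L N X \<Longrightarrow> mesh_size N X < d \<Longrightarrow>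
           (\<exists>c. L2sq L (\<lambda>x. z x - step_fun N X c x) < e)"
    using L2_step_approx[OF z e L] by blast
  show ?thesis
  proof (intro exI[of _ d] conjI allI impI d(1))
    fix N X p
    assume A: "partition L N X \<and> mesh_size N X < d \<and> square_integrable L p \<and>
     (\<forall>j<N. \<forall>c. (LINT x|I0 L. indicator {X j<..<X (Suc j)} x *\<^sub>R ((z x - p x) \<bullet> (p x - c))) = 0)"
    then obtain c where c: "L2sq L (\<lambda>x. z x - step_fun N X c x) < e" using d(2) by blast
    have "L2sq L (\<lambda>x. z x - p x) \<le> L2sq L (\<lambda>x. z x - step_fun N X c x)"
      by (rule L2_best_approx) (use A z in auto)
    then show "L2sq L (\<lambda>x. z x - p x) < e" using c by simp
  qed
qed

section \<open>Uniqueness of weak derivatives and the chosen representatives\<close>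

lemma uniform_partition:
  assumes "0 < L" "0 < n"
  shows "partition L n (\<lambda>j. L * real j / real n)" "mesh_size n (\<lambda>j. L * real j / real n) = L / real n"
proof -
  show "partition L n (\<lambda>j. L * real j / real n)"
    using assms by (auto simp: partition_def field_simps)
  have "L * real (Suc j) / real n - L * real j / real n = L / real n" for j
    by (simp add: field_simps add_divide_distrib)
  then have "(\<lambda>j. L * real (Suc j) / real n - L * real j / real n) ` {..<n} = {L / real n}"
    using assms(2) by (auto simp: image_def)
  then show "mesh_size n (\<lambda>j. L * real j / real n) = L / real n"
    unfolding mesh_size_def by simp
qed

lemma L2sq_eq_0_AE:
  assumes k: "square_integrable L k" and 0: "L2sq L k = 0"
  shows "AE x in I0 L. k x = 0"
proof -
  have "AE x in I0 L. (norm (k x))\<^sup>2 = 0"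
    using integral_nonneg_eq_0_iff_AE[OF square_integrableD[OF k]] 0 unfolding L2sq_def by simp
  then show ?thesis by simp
qed

text \<open>If all interval integrals of k vanish, then 0 satisfies the orthogonality relations of a
  projection of k on every partition. Since projections converge on uniform partitions, the norm of
  k lies below every positive e.\<close>

lemma L2_zero_integrals_AE:
  assumes k: "square_integrable L k" and L: "0 < L"
    and 0: "\<And>a b. 0 \<le> a \<Longrightarrow> a < b \<Longrightarrow> b \<le> L \<Longrightarrow> (LINT x|I0 L. indicator {a<..<b} x *\<^sub>R k x) = 0"
  shows "AE x in I0 L. k x = 0"
proof (rule L2sq_eq_0_AE[OF k])
  have "L2sq L k \<le> e" if e: "0 < e" for e
  proof -
    obtain d where d: "0 < d" "\<And>N X p. partition L N X \<Longrightarrow> mesh_size N X < d \<Longrightarrow> square_integrable L p \<Longrightarrow>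
      (\<forall>j<N. \<forall>c. (LINT x|I0 L. indicator {X j<..<X (Suc j)} x *\<^sub>R ((k x - p x) \<bullet> (p x - c))) = 0)
      \<Longrightarrow> L2sq L (\<lambda>x. k x - p x) < e"
      using L2_projection_converges[OF k e L] by meson
    have "eventually (\<lambda>n. L / real n < d) sequentially"
      using d(1) by (intro order_tendstoD[OF lim_const_over_n]) auto
    then have "eventually (\<lambda>n. L / real n < d \<and> 0 < n) sequentially"
      using eventually_gt_at_top[of 0] by (rule eventually_conj)
    then obtain n where n: "L / real n < d" "0 < n"
      using eventually_happens'[OF sequentially_bot] by blast
    define X where "X j = L * real j / real n" for j
    have X: "partition L n X" "mesh_size n X < d"
      using uniform_partition[OF L n(2)] n(1) unfolding X_def[abs_def] by auto
    have "L2sq L (\<lambda>x. k x - 0) < e"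
    proof (rule d(2)[OF X])
      show "square_integrable L (\<lambda>x. 0)" by (rule square_integrable_continuous) simp
      show "\<forall>j<n. \<forall>c. (LINT x|I0 L. indicator {X j<..<X (Suc j)} x *\<^sub>R ((k x - 0) \<bullet> (0 - c))) = 0"
      proof (intro allI impI)
        fix j c assume j: "j < n"
        have ki: "integrable (I0 L) (\<lambda>x. indicator {X j<..<X (Suc j)} x *\<^sub>R k x)"
          by (rule integrable_I0_indicator[OF square_integrable_integrable[OF k]]) simp
        have z: "(LINT x|I0 L. indicator {X j<..<X (Suc j)} x *\<^sub>R k x) = 0"
          using partition_range[OF X(1), of j] partition_range[OF X(1), of "Suc j"] partition_less[OF X(1), of j "Suc j"] j
          by (intro 0) auto
        have "(LINT x|I0 L. indicator {X j<..<X (Suc j)} x *\<^sub>R ((k x - 0) \<bullet> (0 - c))) =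
           (LINT x|I0 L. (indicator {X j<..<X (Suc j)} x *\<^sub>R k x) \<bullet> (- c))"
          by simp
        also have "\<dots> = (LINT x|I0 L. indicator {X j<..<X (Suc j)} x *\<^sub>R k x) \<bullet> (- c)"
          using ki by (rule integral_inner_left[rotated])
        also have "\<dots> = 0" using z by simp
        finally show "(LINT x|I0 L. indicator {X j<..<X (Suc j)} x *\<^sub>R ((k x - 0) \<bullet> (0 - c))) = 0" .
      qed
    qed
    then show ?thesis by simp
  qed
  then have "L2sq L k \<le> 0" by (rule field_le_epsilon[where y=0, simplified])
  then show "L2sq L k = 0" using L2sq_nonneg[of L k] by linarith
qed

text \<open>By the fundamental theorem the derivative of u - v has zero integral over every
  subinterval. This is the tool that identifies a derivative picked by choice with one that has been
  exhibited.\<close>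

lemma H1_derivative_unique:
  assumes u: "has_H1_derivative L u g" and v: "has_H1_derivative L v k" and L: "0 < L"
    and eq: "\<And>x. x \<in> {0..L} \<Longrightarrow> u x = v x"
  shows "AE x in I0 L. g x = k x"
proof -
  have d: "has_H1_derivative L (\<lambda>x. 1 *\<^sub>R u x + (-1) *\<^sub>R v x) (\<lambda>x. 1 *\<^sub>R g x + (-1) *\<^sub>R k x)"
    by (rule has_H1_derivative_lincomb[OF u v])
  have "AE x in I0 L. 1 *\<^sub>R g x + (-1) *\<^sub>R k x = 0"
  proof (rule L2_zero_integrals_AE[OF _ L])
    show "square_integrable L (\<lambda>x. 1 *\<^sub>R g x + (-1) *\<^sub>R k x)" using d by (simp add: has_H1_derivative_def)
    show "(LINT x|I0 L. indicator {a<..<b} x *\<^sub>R (1 *\<^sub>R g x + (-1) *\<^sub>R k x)) = 0" if "0 \<le> a" "a < b" "b \<le> L" for a b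
      using H1_fundamental_theorem[OF d that] eq[of a] eq[of b] that by simp
  qed
  then show ?thesis by simp
qed

text \<open>The closed interval matters: the conclusion also covers the endpoints, where boundary
  values and extreme nodes are read off.\<close>

lemma continuous_AE_eq_0:
  fixes f :: "real \<Rightarrow> 'a::euclidean_space"
  assumes f: "continuous_on {0..L} f" and L: "0 < L" and ae: "AE x in I0 L. f x = 0" and x: "x \<in> {0..L}"
  shows "f x = 0"
proof -
  have i: "integrable (I0 L) (\<lambda>x. norm (f x))"
    by (intro integrable_I0_continuous continuous_intros f)
  have "(LINT x|I0 L. norm (f x)) = 0"
    using ae by (intro integral_eq_zero_AE) simp
  then have "integral {0..L} (\<lambda>x. norm (f x)) = 0"
    using has_integral_I0[OF i] by (simp add: integral_unique)
  then have "norm (f x) = 0"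
    using integral_eq_0_iff[OF continuous_on_norm[OF f] L] x by simp
  then show ?thesis by simp
qed

lemma D_H1:
  assumes "u \<in> H1 L"
  shows "has_H1_derivative L u (D_H1 L u)"
proof -
  have "\<exists>g. square_integrable L g \<and> has_weak_derivative L u g" using assms by (auto simp: H1_def)
  from someI_ex[OF this] show ?thesis
    using assms by (simp add: has_H1_derivative_def D_H1_def[symmetric] H1_def)
qed

lemma D_H2:
  assumes "y \<in> H2 L"
  shows "has_H1_derivative L y (D_H2 L y)" "has_H1_derivative L (D_H2 L y) (DD_H2 L y)"
proof -
  have "\<exists>v. v \<in> H1 L \<and> has_weak_derivative L y v" using assms by (auto simp: H2_def)
  from someI_ex[OF this] have v: "D_H2 L y \<in> H1 L" "has_weak_derivative L y (D_H2 L y)"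
    by (simp_all add: D_H2_def[symmetric])
  show "has_H1_derivative L (D_H2 L y) (DD_H2 L y)"
    unfolding DD_H2_def by (rule D_H1[OF v(1)])
  show "has_H1_derivative L y (D_H2 L y)"
    using v assms by (auto simp: has_H1_derivative_def H2_def H1_def)
qed

text \<open>Entry point for explicit functions such as splines. The chosen first derivative agrees
  everywhere on [0,L], both being continuous, while the second is identified only almost
  everywhere.\<close>

lemma H2_I:
  assumes y: "has_H1_derivative L y v" and v: "has_H1_derivative L v z" and L: "0 < L"
  shows "y \<in> H2 L" "\<And>x. x \<in> {0..L} \<Longrightarrow> D_H2 L y x = v x" "AE x in I0 L. DD_H2 L y x = z x"
proof -
  have "v \<in> H1 L" "y \<in> H1 L" using y v in_H1_iff by blast+
  then show y2: "y \<in> H2 L" using y by (auto simp: H2_def has_H1_derivative_def)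
  have "AE x in I0 L. D_H2 L y x = v x"
    by (rule H1_derivative_unique[OF D_H2(1)[OF y2] y L]) simp
  then have ae: "AE x in I0 L. D_H2 L y x - v x = 0" by simp
  have c: "continuous_on {0..L} (\<lambda>x. D_H2 L y x - v x)"
    using D_H2(2)[OF y2] v by (intro continuous_intros) (auto simp: has_H1_derivative_def)
  show eq: "\<And>x. x \<in> {0..L} \<Longrightarrow> D_H2 L y x = v x"
    using continuous_AE_eq_0[OF c L ae] by simp
  show "AE x in I0 L. DD_H2 L y x = z x"
    by (rule H1_derivative_unique[OF D_H2(2)[OF y2] v L eq])
qed

lemma D_H1_AE:
  assumes b: "has_H1_derivative L b g" and L: "0 < L"
  shows "b \<in> H1 L" "AE x in I0 L. D_H1 L b x = g x"
proof -
  show "b \<in> H1 L" using b in_H1_iff by blast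
  then show "AE x in I0 L. D_H1 L b x = g x"
    by (intro H1_derivative_unique[OF D_H1 b L]) auto
qed

section \<open>Continuity of functionals on $V$\<close>

text \<open>The fundamental theorem with finitely many exceptional points, applied to \<phi> u; the
  boundary terms vanish with the test function. Kinks at spline knots are the exceptional
  points.\<close>

lemma has_H1_derivative_piecewise:
  assumes u: "continuous_on {0..L} u" and g: "square_integrable L g" and S: "finite S" and L: "0 \<le> L"
    and d: "\<And>x. x \<in> {0<..<L} - S \<Longrightarrow> (u has_vector_derivative g x) (at x)"
  shows "has_H1_derivative L u g"
proof -
  have "(LINT x|I0 L. deriv \<phi> x *\<^sub>R u x) = - (LINT x|I0 L. \<phi> x *\<^sub>R g x)" if t: "test_function L \<phi>" for \<phi>
  proof -
    have c: "continuous_on {0..L} \<phi>" "continuous_on {0..L} (deriv \<phi>)"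
      using test_functionD[OF t] continuous_on_subset by blast+
    have i1: "integrable (I0 L) (\<lambda>x. deriv \<phi> x *\<^sub>R u x)"
      by (rule integrable_I0_continuous_scaleR[OF c(2) integrable_I0_continuous[OF u]])
    have i2: "integrable (I0 L) (\<lambda>x. \<phi> x *\<^sub>R g x)"
      by (rule integrable_I0_continuous_scaleR[OF c(1) square_integrable_integrable[OF g]])
    have "((\<lambda>x. deriv \<phi> x *\<^sub>R u x + \<phi> x *\<^sub>R g x) has_integral \<phi> L *\<^sub>R u L - \<phi> 0 *\<^sub>R u 0) {0..L}"
    proof (rule fundamental_theorem_of_calculus_interior_strong[OF S L])
      show "((\<lambda>x. \<phi> x *\<^sub>R u x) has_vector_derivative deriv \<phi> x *\<^sub>R u x + \<phi> x *\<^sub>R g x) (at x)"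
        if "x \<in> {0<..<L} - S" for x
        using has_vector_derivative_scaleR[OF test_functionD(3)[OF t, of x] d[OF that]] by (simp add: add.commute)
      show "continuous_on {0..L} (\<lambda>x. \<phi> x *\<^sub>R u x)" by (rule continuous_on_scaleR[OF c(1) u])
    qed
    then have "(LINT x|I0 L. deriv \<phi> x *\<^sub>R u x + \<phi> x *\<^sub>R g x) = \<phi> L *\<^sub>R u L - \<phi> 0 *\<^sub>R u 0"
      by (rule LINT_I0_eq[OF integrable_plus[OF i1 i2]])
    also have "\<dots> = 0" using test_functionD(4)[OF t, of 0] test_functionD(4)[OF t, of L] by simp
    finally have "(LINT x|I0 L. deriv \<phi> x *\<^sub>R u x) + (LINT x|I0 L. \<phi> x *\<^sub>R g x) = 0"
      unfolding LINT_plus[OF i1 i2] .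
    then show ?thesis by (rule eq_neg_iff_add_eq_0[THEN iffD2])
  qed
  then show ?thesis using u g by (simp add: has_H1_derivative_def has_weak_derivative_def)
qed

text \<open>Cauchy-Schwarz in the fundamental theorem. The integral on the right stays localized to
  (a,b), so that elementwise estimates can later be summed without losing the factor gained on each
  element.\<close>

lemma H1_holder:
  assumes u: "has_H1_derivative L u g" and ab: "0 \<le> a" "a \<le> b" "b \<le> L"
  shows "norm (u b - u a) \<le> sqrt (b - a) * sqrt (LINT x|I0 L. indicator {a<..<b} x * (norm (g x))\<^sup>2)"
proof (cases "a = b")
  case False
  then have ab': "a < b" using ab by simp
  have g: "square_integrable L g" using u by (simp add: has_H1_derivative_def)
  \<comment> \<open>The scalar indicator is embedded along a unit vector, so that the inequality for
    R^3-valued functions applies.\<close>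
  let ?f = "\<lambda>x. indicator {a<..<b} x *\<^sub>R (axis 1 1 :: real^3)" and ?h = "\<lambda>x. indicator {a<..<b} x *\<^sub>R g x"
  have f: "square_integrable L ?f"
    by (rule square_integrable_bounded_scaleR[where B = 1, OF square_integrable_continuous[OF continuous_on_const]])
       (simp_all add: borel_measurable_I0 indicator_def)
  have h: "square_integrable L ?h"
    by (rule square_integrable_bounded_scaleR[OF g, where B = 1]) (simp_all add: borel_measurable_I0 indicator_def)
  have "L2sq L ?f = (LINT x|I0 L. indicator {a<..<b} x)"
    unfolding L2sq_def by (rule LINT_cong) (auto simp: indicator_def)
  also have "\<dots> = b - a"
  proof -
    have "(LINT x|I0 L. indicator {a<..<b} x :: real) = measure (I0 L) ({a<..<b} \<inter> space (I0 L))"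
      by simp
    also have "{a<..<b} \<inter> space (I0 L) = {a<..<b}" using ab by auto
    also have "measure (I0 L) {a<..<b} = b - a"
      using ab by (subst measure_restrict_space) auto
    finally show ?thesis .
  qed
  finally have 1: "L2sq L ?f = b - a" .
  have 2: "L2sq L ?h = (LINT x|I0 L. indicator {a<..<b} x * (norm (g x))\<^sup>2)"
    unfolding L2sq_def by (rule LINT_cong) (auto simp: indicator_def)
  have "norm (u b - u a) = norm (LINT x|I0 L. ?h x)"
    using H1_fundamental_theorem[OF u ab(1) ab' ab(3)] by simp
  also have "\<dots> \<le> (LINT x|I0 L. norm (?h x))" by (rule integral_norm_bound)
  also have "\<dots> = (LINT x|I0 L. norm (?f x) * norm (?h x))"
    by (rule LINT_cong) (auto simp: indicator_def)
  also have "\<dots> \<le> sqrt (b - a) * sqrt (LINT x|I0 L. indicator {a<..<b} x * (norm (g x))\<^sup>2)"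
    using L2_Cauchy_Schwarz[OF f h] unfolding 1 2 .
  finally show ?thesis .
qed simp

lemma H1_holder_global:
  assumes u: "has_H1_derivative L u g" and ab: "a \<in> {0..L}" "b \<in> {0..L}"
  shows "norm (u b - u a) \<le> sqrt \<bar>b - a\<bar> * sqrt (L2sq L g)"
proof -
  have *: "norm (u b - u a) \<le> sqrt (b - a) * sqrt (L2sq L g)" if "0 \<le> a" "a \<le> b" "b \<le> L" for a b
  proof -
    have g: "square_integrable L g" using u by (simp add: has_H1_derivative_def)
    have "integrable (I0 L) (\<lambda>x. indicator {a<..<b} x *\<^sub>R (norm (g x))\<^sup>2)"
      by (rule integrable_I0_indicator[OF square_integrableD[OF g]]) simp
    then have "(LINT x|I0 L. indicator {a<..<b} x * (norm (g x))\<^sup>2) \<le> L2sq L g"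
      unfolding L2sq_def using square_integrableD[OF g]
      by (intro integral_mono) (auto simp: indicator_def)
    then have "sqrt (b - a) * sqrt (LINT x|I0 L. indicator {a<..<b} x * (norm (g x))\<^sup>2) \<le> sqrt (b - a) * sqrt (L2sq L g)"
      using that by (intro mult_left_mono) auto
    then show ?thesis using H1_holder[OF u that] by linarith
  qed
  show ?thesis
  proof (cases "a \<le> b")
    case True
    then show ?thesis using *[of a b] ab by simp
  next
    case False
    then show ?thesis using *[of b a] ab by (simp add: norm_minus_commute)
  qed
qed

text \<open>The oscillation bound gives |u(x)| <= |u(z)| + K for every z; averaging over z in (0,L)
  replaces the unknown point value by the L^1 norm, which is below sqrt L times the L^2
  norm.\<close>

lemma H1_sup_bound:
  assumes u: "has_H1_derivative L u g" and L: "0 < L" and x: "x \<in> {0..L}"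
  shows "norm (u x) \<le> sqrt (L2sq L u) / sqrt L + sqrt L * sqrt (L2sq L g)"
proof -
  have us: "square_integrable L u" using u by (simp add: has_H1_derivative_def square_integrable_continuous)
  define K where "K = sqrt L * sqrt (L2sq L g)"
  have le: "norm (u x) \<le> norm (u z) + K" if z: "z \<in> {0<..<L}" for z
  proof -
    have "norm (u x - u z) \<le> sqrt \<bar>x - z\<bar> * sqrt (L2sq L g)"
      by (rule H1_holder_global[OF u]) (use z x in auto)
    also have "\<dots> \<le> K"
      unfolding K_def using x z by (intro mult_right_mono) (auto simp: L2sq_nonneg)
    finally show ?thesis using norm_triangle_ineq2[of "u x" "u z"] by linarith
  qed
  have ui: "integrable (I0 L) (\<lambda>z. norm (u z))" by (rule integrable_norm[OF square_integrable_integrable[OF us]])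
  have ci: "integrable (I0 L) (\<lambda>z. c :: real)" for c by (rule integrable_I0_const)
  have "(LINT z|I0 L. norm (u x)) \<le> (LINT z|I0 L. norm (u z) + K)"
    by (rule integral_mono[OF ci integrable_plus[OF ui ci]]) (use le in simp)
  also have "\<dots> = (LINT z|I0 L. norm (u z)) + (LINT z|I0 L. K)"
    by (rule LINT_plus[OF ui ci])
  also have "\<dots> \<le> sqrt L * sqrt (L2sq L u) + L * K"
    using L1_le_L2[OF us] measure_I0[of L] L by simp
  finally have "L * norm (u x) \<le> sqrt L * sqrt (L2sq L u) + L * K"
    using measure_I0[of L] L by simp
  also have "\<dots> = L * (sqrt (L2sq L u) / sqrt L + K)"
    using L by (simp add: field_simps real_div_sqrt)
  finally show ?thesis unfolding K_def using L by (simp only: mult_le_cancel_left_pos)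
qed

lemma L2sq_le_bounded:
  assumes f: "square_integrable L f" and M: "\<And>x. x \<in> {0<..<L} \<Longrightarrow> norm (f x) \<le> M" and L: "0 \<le> L"
  shows "L2sq L f \<le> L * M\<^sup>2"
proof -
  have "L2sq L f \<le> (LINT x|I0 L. M\<^sup>2)"
    unfolding L2sq_def
    by (intro integral_mono square_integrableD[OF f] integrable_I0_const power_mono)
       (use M in auto)
  also have "\<dots> = L * M\<^sup>2" using measure_I0[OF L] by simp
  finally show ?thesis .
qed

section \<open>Configurations in V, bounded functionals and weak convergence\<close>

abbreviation dy :: "real \<Rightarrow> conf \<Rightarrow> real \<Rightarrow> real^3" where
  "dy L v \<equiv> D_H2 L (fst v)"

abbreviation ddy :: "real \<Rightarrow> conf \<Rightarrow> real \<Rightarrow> real^3" where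
  "ddy L v \<equiv> DD_H2 L (fst v)"

abbreviation db :: "real \<Rightarrow> conf \<Rightarrow> real \<Rightarrow> real^3" where
  "db L v \<equiv> D_H1 L (snd v)"

lemma V_D:
  assumes "v \<in> V L"
  shows "has_H1_derivative L (fst v) (dy L v)"
    "has_H1_derivative L (dy L v) (ddy L v)" "has_H1_derivative L (snd v) (db L v)"
  using assms D_H1 D_H2 unfolding V_def by auto

lemma H1_square_integrable:
  assumes "has_H1_derivative L u g"
  shows "square_integrable L u" "square_integrable L g" "continuous_on {0..L} u"
  using assms by (auto simp: has_H1_derivative_def square_integrable_continuous)

lemma V_norm_eq:
  assumes "v \<in> V L"
  shows "V_norm L v = sqrt (L2sq L (fst v) + L2sq L (dy L v) + L2sq L (ddy L v) +
    L2sq L (snd v) + L2sq L (db L v))"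
proof -
  note d = V_D[OF assms]
  note sq = square_integrableD[OF H1_square_integrable(1)[OF d(1)]] square_integrableD[OF H1_square_integrable(1)[OF d(2)]]
     square_integrableD[OF H1_square_integrable(2)[OF d(2)]]
     square_integrableD[OF H1_square_integrable(1)[OF d(3)]] square_integrableD[OF H1_square_integrable(2)[OF d(3)]]
  have "(LINT x|I0 L. (norm (fst v x))\<^sup>2 + (norm (dy L v x))\<^sup>2 + (norm (ddy L v x))\<^sup>2) =
      L2sq L (fst v) + L2sq L (dy L v) + L2sq L (ddy L v)"
    unfolding L2sq_def LINT_plus[OF integrable_plus[OF sq(1,2)] sq(3)]
      LINT_plus[OF sq(1,2)] ..
  moreover have "(LINT x|I0 L. (norm (snd v x))\<^sup>2 + (norm (db L v x))\<^sup>2) = L2sq L (snd v) + L2sq L (db L v)"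
    unfolding L2sq_def by (rule LINT_plus[OF sq(4,5)])
  ultimately show ?thesis
    unfolding V_norm_def by (simp add: case_prod_beta)
qed

lemma V_norm_bounds:
  assumes "v \<in> V L"
  shows "sqrt (L2sq L (fst v)) \<le> V_norm L v" "sqrt (L2sq L (dy L v)) \<le> V_norm L v"
    "sqrt (L2sq L (ddy L v)) \<le> V_norm L v" "sqrt (L2sq L (snd v)) \<le> V_norm L v"
    "sqrt (L2sq L (db L v)) \<le> V_norm L v" "0 \<le> V_norm L v"
  unfolding V_norm_eq[OF assms]
  using L2sq_nonneg[of L "fst v"] L2sq_nonneg[of L "snd v"] L2sq_nonneg[of L "dy L v"]
    L2sq_nonneg[of L "ddy L v"] L2sq_nonneg[of L "db L v"]
  by (auto intro!: real_sqrt_le_mono)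

lemma V_lincomb:
  assumes v: "v \<in> V L" and w: "w \<in> V L" and L: "0 < L"
  shows "lincomb r v s w \<in> V L"
    "\<And>x. x \<in> {0..L} \<Longrightarrow> dy L (lincomb r v s w) x = r *\<^sub>R dy L v x + s *\<^sub>R dy L w x"
    "AE x in I0 L. ddy L (lincomb r v s w) x = r *\<^sub>R ddy L v x + s *\<^sub>R ddy L w x"
    "AE x in I0 L. db L (lincomb r v s w) x = r *\<^sub>R db L v x + s *\<^sub>R db L w x"
proof -
  note dv = V_D[OF v] and dw = V_D[OF w]
  note y = has_H1_derivative_lincomb[OF dv(1) dw(1), of r s] has_H1_derivative_lincomb[OF dv(2) dw(2), of r s]
  note b = has_H1_derivative_lincomb[OF dv(3) dw(3), of r s]
  note Y = H2_I[OF y L] and B = D_H1_AE[OF b L]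
  show "lincomb r v s w \<in> V L" using Y(1) B(1) by (simp add: V_def lincomb_def)
  show "\<And>x. x \<in> {0..L} \<Longrightarrow> dy L (lincomb r v s w) x = r *\<^sub>R dy L v x + s *\<^sub>R dy L w x"
    using Y(2) by (simp add: lincomb_def)
  show "AE x in I0 L. ddy L (lincomb r v s w) x = r *\<^sub>R ddy L v x + s *\<^sub>R ddy L w x"
    using Y(3) by (simp add: lincomb_def)
  show "AE x in I0 L. db L (lincomb r v s w) x = r *\<^sub>R db L v x + s *\<^sub>R db L w x"
    using B(2) by (simp add: lincomb_def)
qed

lemma LINT_inner_lincomb:
  assumes f: "square_integrable L f" and h: "square_integrable L h" and g: "square_integrable L g"
    and k: "square_integrable L k" and ae: "AE x in I0 L. k x = r *\<^sub>R f x + s *\<^sub>R h x"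
  shows "(LINT x|I0 L. k x \<bullet> g x) = r * (LINT x|I0 L. f x \<bullet> g x) + s * (LINT x|I0 L. h x \<bullet> g x)"
proof -
  note fg = square_integrable_inner[OF f g] and hg = square_integrable_inner[OF h g]
  have "(LINT x|I0 L. k x \<bullet> g x) = (LINT x|I0 L. r * (f x \<bullet> g x) + s * (h x \<bullet> g x))"
  proof (rule integral_cong_AE)
    show "(\<lambda>x. k x \<bullet> g x) \<in> borel_measurable (I0 L)"
      by (rule borel_measurable_integrable[OF square_integrable_inner[OF k g]])
    show "(\<lambda>x. r * (f x \<bullet> g x) + s * (h x \<bullet> g x)) \<in> borel_measurable (I0 L)"
      by (rule borel_measurable_integrable[OF integrable_plus[OF
            integrable_mult_right[OF fg] integrable_mult_right[OF hg]]])
    show "AE x in I0 L. k x \<bullet> g x = r * (f x \<bullet> g x) + s * (h x \<bullet> g x)"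
      using ae by (rule eventually_mono) (simp add: inner_add_left)
  qed
  also have "\<dots> = (LINT x|I0 L. r * (f x \<bullet> g x)) + (LINT x|I0 L. s * (h x \<bullet> g x))"
    by (rule LINT_plus[OF integrable_mult_right[OF fg] integrable_mult_right[OF hg]])
  finally show ?thesis by (simp only: integral_mult_right_zero)
qed

text \<open>Weak convergence in \<open>V\<close> says nothing except about bounded functionals, so
  those that will be tested have to be shown bounded: pairings with the highest derivatives, and
  point evaluations.\<close>

lemma bounded_linear_V_DD:
  assumes g: "square_integrable L g" and L: "0 < L"
  shows "bounded_linear_V L (\<lambda>v. LINT x|I0 L. ddy L v x \<bullet> g x)"
  unfolding bounded_linear_V_def
proof (intro conjI ballI allI exI[of _ "sqrt (L2sq L g)"])
  fix v w :: conf and r s assume v: "v \<in> V L" and w: "w \<in> V L"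
  show "(LINT x|I0 L. ddy L (lincomb r v s w) x \<bullet> g x) =
     r *\<^sub>R (LINT x|I0 L. ddy L v x \<bullet> g x) + s *\<^sub>R (LINT x|I0 L. ddy L w x \<bullet> g x)"
    using LINT_inner_lincomb[OF H1_square_integrable(2)[OF V_D(2)[OF v]] H1_square_integrable(2)[OF V_D(2)[OF w]] g
      H1_square_integrable(2)[OF V_D(2)[OF V_lincomb(1)[OF v w L]]] V_lincomb(3)[OF v w L]] by simp
next
  fix v assume v: "v \<in> V L"
  have "\<bar>LINT x|I0 L. ddy L v x \<bullet> g x\<bar> \<le> sqrt (L2sq L (ddy L v)) * sqrt (L2sq L g)"
    by (rule L2_inner_le[OF H1_square_integrable(2)[OF V_D(2)[OF v]] g])
  also have "\<dots> \<le> V_norm L v * sqrt (L2sq L g)"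
    by (intro mult_right_mono V_norm_bounds(3)[OF v]) (simp add: L2sq_nonneg)
  finally show "norm (LINT x|I0 L. ddy L v x \<bullet> g x) \<le> sqrt (L2sq L g) * V_norm L v"
    by (simp add: mult.commute)
qed

lemma bounded_linear_V_D_snd:
  assumes g: "square_integrable L g" and L: "0 < L"
  shows "bounded_linear_V L (\<lambda>v. LINT x|I0 L. db L v x \<bullet> g x)"
  unfolding bounded_linear_V_def
proof (intro conjI ballI allI exI[of _ "sqrt (L2sq L g)"])
  fix v w :: conf and r s assume v: "v \<in> V L" and w: "w \<in> V L"
  show "(LINT x|I0 L. db L (lincomb r v s w) x \<bullet> g x) =
     r *\<^sub>R (LINT x|I0 L. db L v x \<bullet> g x) + s *\<^sub>R (LINT x|I0 L. db L w x \<bullet> g x)"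
    using LINT_inner_lincomb[OF H1_square_integrable(2)[OF V_D(3)[OF v]] H1_square_integrable(2)[OF V_D(3)[OF w]] g
      H1_square_integrable(2)[OF V_D(3)[OF V_lincomb(1)[OF v w L]]] V_lincomb(4)[OF v w L]] by simp
next
  fix v assume v: "v \<in> V L"
  have "\<bar>LINT x|I0 L. db L v x \<bullet> g x\<bar> \<le> sqrt (L2sq L (db L v)) * sqrt (L2sq L g)"
    by (rule L2_inner_le[OF H1_square_integrable(2)[OF V_D(3)[OF v]] g])
  also have "\<dots> \<le> V_norm L v * sqrt (L2sq L g)"
    by (intro mult_right_mono V_norm_bounds(5)[OF v]) (simp add: L2sq_nonneg)
  finally show "norm (LINT x|I0 L. db L v x \<bullet> g x) \<le> sqrt (L2sq L g) * V_norm L v"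
    by (simp add: mult.commute)
qed

lemma V_point_bounds:
  assumes v: "v \<in> V L" and L: "0 < L" and x: "x \<in> {0..L}"
  shows "norm (fst v x) \<le> (1 / sqrt L + sqrt L) * V_norm L v"
    "norm (dy L v x) \<le> (1 / sqrt L + sqrt L) * V_norm L v"
    "norm (snd v x) \<le> (1 / sqrt L + sqrt L) * V_norm L v"
proof -
  have *: "p / sqrt L + sqrt L * q \<le> (1 / sqrt L + sqrt L) * V_norm L v"
    if "p \<le> V_norm L v" "q \<le> V_norm L v" for p q
  proof -
    have "p / sqrt L \<le> V_norm L v / sqrt L" "sqrt L * q \<le> sqrt L * V_norm L v"
      using that L by (auto intro!: divide_right_mono mult_left_mono)
    then show ?thesis by (simp add: distrib_right)
  qed
  note b = V_norm_bounds[OF v] and d = V_D[OF v]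
  show "norm (fst v x) \<le> (1 / sqrt L + sqrt L) * V_norm L v"
    by (rule order_trans[OF H1_sup_bound[OF d(1) L x] *[OF b(1,2)]])
  show "norm (dy L v x) \<le> (1 / sqrt L + sqrt L) * V_norm L v"
    by (rule order_trans[OF H1_sup_bound[OF d(2) L x] *[OF b(2,3)]])
  show "norm (snd v x) \<le> (1 / sqrt L + sqrt L) * V_norm L v"
    by (rule order_trans[OF H1_sup_bound[OF d(3) L x] *[OF b(4,5)]])
qed

text \<open>Evaluation is bounded by the embedding of H^1 into continuous functions; components are
  used because weak convergence tests real-valued functionals.\<close>

lemma bounded_linear_V_point:
  assumes L: "0 < L" and x: "x \<in> {0..L}"
  shows "bounded_linear_V L (\<lambda>v. fst v x $ i)" "bounded_linear_V L (\<lambda>v. dy L v x $ i)"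
    "bounded_linear_V L (\<lambda>v. snd v x $ i)"
proof -
  have c: "norm (a $ i) \<le> K" if "norm a \<le> K" for a :: "real^3" and K
    using order_trans[OF component_le_norm_cart that] by simp
  show "bounded_linear_V L (\<lambda>v. fst v x $ i)"
    unfolding bounded_linear_V_def
    by (intro conjI exI[of _ "1 / sqrt L + sqrt L"] ballI c V_point_bounds(1) L x) (auto simp: lincomb_def)
  show "bounded_linear_V L (\<lambda>v. dy L v x $ i)"
    unfolding bounded_linear_V_def
    by (intro conjI exI[of _ "1 / sqrt L + sqrt L"] ballI c V_point_bounds(2) L x) (simp add: V_lincomb(2)[OF _ _ L x])
  show "bounded_linear_V L (\<lambda>v. snd v x $ i)"
    unfolding bounded_linear_V_def
    by (intro conjI exI[of _ "1 / sqrt L + sqrt L"] ballI c V_point_bounds(3) L x) (auto simp: lincomb_def)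
qed

text \<open>All consequences of weak convergence used below. Pointwise convergence of y, y' and b
  comes directly from evaluation functionals and replaces a compact embedding.\<close>

lemma weakly_convergent_V_D:
  assumes w: "weakly_convergent_V L w v F" and L: "0 < L"
  shows "\<And>g. square_integrable L g \<Longrightarrow> ((\<lambda>i. LINT x|I0 L. ddy L (w i) x \<bullet> g x) \<longlongrightarrow> (LINT x|I0 L. ddy L v x \<bullet> g x)) F"
    "\<And>g. square_integrable L g \<Longrightarrow> ((\<lambda>i. LINT x|I0 L. db L (w i) x \<bullet> g x) \<longlongrightarrow> (LINT x|I0 L. db L v x \<bullet> g x)) F"
    "\<And>x. x \<in> {0..L} \<Longrightarrow> ((\<lambda>i. fst (w i) x) \<longlongrightarrow> fst v x) F"
    "\<And>x. x \<in> {0..L} \<Longrightarrow> ((\<lambda>i. dy L (w i) x) \<longlongrightarrow> dy L v x) F"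
    "\<And>x. x \<in> {0..L} \<Longrightarrow> ((\<lambda>i. snd (w i) x) \<longlongrightarrow> snd v x) F"
proof -
  have W: "bounded_linear_V L f \<Longrightarrow> ((\<lambda>i. f (w i)) \<longlongrightarrow> f v) F" for f :: "conf \<Rightarrow> real"
    using w by (simp add: weakly_convergent_V_def)
  show "\<And>g. square_integrable L g \<Longrightarrow> ((\<lambda>i. LINT x|I0 L. ddy L (w i) x \<bullet> g x) \<longlongrightarrow> (LINT x|I0 L. ddy L v x \<bullet> g x)) F"
    by (rule W[OF bounded_linear_V_DD[OF _ L]])
  show "\<And>g. square_integrable L g \<Longrightarrow> ((\<lambda>i. LINT x|I0 L. db L (w i) x \<bullet> g x) \<longlongrightarrow> (LINT x|I0 L. db L v x \<bullet> g x)) F"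
    by (rule W[OF bounded_linear_V_D_snd[OF _ L]])
  show "\<And>x. x \<in> {0..L} \<Longrightarrow> ((\<lambda>i. fst (w i) x) \<longlongrightarrow> fst v x) F"
    by (intro vec_tendstoI W[OF bounded_linear_V_point(1)[OF L]])
  show "\<And>x. x \<in> {0..L} \<Longrightarrow> ((\<lambda>i. dy L (w i) x) \<longlongrightarrow> dy L v x) F"
    by (intro vec_tendstoI W[OF bounded_linear_V_point(2)[OF L]])
  show "\<And>x. x \<in> {0..L} \<Longrightarrow> ((\<lambda>i. snd (w i) x) \<longlongrightarrow> snd v x) F"
    by (intro vec_tendstoI W[OF bounded_linear_V_point(3)[OF L]])
qed

lemma bounded_linear_V_tendsto:
  assumes f: "bounded_linear_V L f" and L: "0 < L"
    and w: "\<And>i. w i \<in> V L" and v: "v \<in> V L"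
    and lim: "((\<lambda>i. V_norm L (lincomb 1 (w i) (-1) v)) \<longlongrightarrow> 0) F"
  shows "((\<lambda>i. f (w i)) \<longlongrightarrow> f v) F"
proof -
  obtain C where C: "\<And>v. v \<in> V L \<Longrightarrow> norm (f v) \<le> C * V_norm L v"
    using f unfolding bounded_linear_V_def by blast
  have "norm (f (w i) - f v) \<le> C * V_norm L (lincomb 1 (w i) (-1) v)" for i
  proof -
    have "f (lincomb 1 (w i) (-1) v) = 1 *\<^sub>R f (w i) + (-1) *\<^sub>R f v"
      using f w v unfolding bounded_linear_V_def by blast
    then show ?thesis using C[OF V_lincomb(1)[OF w v L, of 1 i "-1"]] by simp
  qed
  then have "((\<lambda>i. f (w i) - f v) \<longlongrightarrow> 0) F"
    using lim by (intro Lim_null_comparison[OF _ tendsto_mult_right_zero[OF lim, of C]]) (auto intro!: always_eventually)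
  then show ?thesis by (rule LIM_zero_cancel)
qed

section \<open>Spline interpolation\<close>

text \<open>The truncated power basis. Powers two and three at each knot are those compatible with
  C^1 regularity, and they leave everything to the left of the knot unchanged, which makes
  interpolation a recursion over the knots.\<close>

definition cubic_spline :: "(nat \<Rightarrow> real) \<Rightarrow> real^3 \<Rightarrow> real^3 \<Rightarrow> (nat \<Rightarrow> real^3) \<Rightarrow> (nat \<Rightarrow> real^3) \<Rightarrow> nat \<Rightarrow> real \<Rightarrow> real^3" where
  "cubic_spline X a b c d n x = a + (x - X 0) *\<^sub>R b +
     (\<Sum>j<n. (max 0 (x - X j))\<^sup>2 *\<^sub>R c j + (max 0 (x - X j)) ^ 3 *\<^sub>R d j)"

definition cubic_spline' :: "(nat \<Rightarrow> real) \<Rightarrow> real^3 \<Rightarrow> (nat \<Rightarrow> real^3) \<Rightarrow> (nat \<Rightarrow> real^3) \<Rightarrow> nat \<Rightarrow> real \<Rightarrow> real^3" where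
  "cubic_spline' X b c d n x = b +
     (\<Sum>j<n. (2 * max 0 (x - X j)) *\<^sub>R c j + (3 * (max 0 (x - X j))\<^sup>2) *\<^sub>R d j)"

definition cubic_spline'' :: "(nat \<Rightarrow> real) \<Rightarrow> (nat \<Rightarrow> real^3) \<Rightarrow> (nat \<Rightarrow> real^3) \<Rightarrow> nat \<Rightarrow> real \<Rightarrow> real^3" where
  "cubic_spline'' X c d n x =
     (\<Sum>j<n. (2 * indicator {X j<..} x) *\<^sub>R c j + (6 * max 0 (x - X j)) *\<^sub>R d j)"

definition linear_spline :: "(nat \<Rightarrow> real) \<Rightarrow> real^3 \<Rightarrow> (nat \<Rightarrow> real^3) \<Rightarrow> nat \<Rightarrow> real \<Rightarrow> real^3" where
  "linear_spline X a s n x = a + (\<Sum>j<n. max 0 (x - X j) *\<^sub>R s j)"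

definition linear_spline' :: "(nat \<Rightarrow> real) \<Rightarrow> (nat \<Rightarrow> real^3) \<Rightarrow> nat \<Rightarrow> real \<Rightarrow> real^3" where
  "linear_spline' X s n x = (\<Sum>j<n. indicator {X j<..} x *\<^sub>R s j)"

lemma DERIV_pos_part_cube:
  "((\<lambda>x::real. max 0 (x - p) ^ 3) has_real_derivative 3 * (max 0 (x - p))\<^sup>2) (at x)"
  using DERIV_pos_part_power[of p 1 x] by (simp add: numeral_3_eq_3 numeral_2_eq_2)

lemma DERIV_pos_part:
  assumes "x \<noteq> p"
  shows "((\<lambda>x::real. max 0 (x - p)) has_real_derivative indicator {p<..} x) (at x)"
proof (cases "x < p")
  case True
  show ?thesis
    by (rule has_field_derivative_transform_within_open[of "\<lambda>_. 0" _ _ "{..<p}"]) (use True in auto)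
next
  case False
  then have p: "p < x" using assms by simp
  have "((\<lambda>x. x - p) has_real_derivative 1) (at x)"
    by (rule DERIV_cong[OF DERIV_diff[OF DERIV_ident DERIV_const]]) simp
  from has_field_derivative_transform_within_open[OF this open_greaterThan, of p "\<lambda>x. max 0 (x - p)"] p
  show ?thesis by simp
qed

lemma scaleR_const_vderiv:
  assumes "(f has_real_derivative f') (at x)"
  shows "((\<lambda>x. f x *\<^sub>R (c :: real^3)) has_vector_derivative f' *\<^sub>R c) (at x)"
  using has_vector_derivative_scaleR[OF assms has_vector_derivative_const[of c]] by simp

lemma cubic_spline_deriv:
  "(cubic_spline X a b c d n has_vector_derivative cubic_spline' X b c d n x) (at x)"
proof -
  have "((\<lambda>x. a + (x - X 0) *\<^sub>R b) has_vector_derivative 0 + 1 *\<^sub>R b) (at x)"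
    by (intro has_vector_derivative_add has_vector_derivative_const scaleR_const_vderiv) (auto intro!: derivative_eq_intros)
  moreover have "((\<lambda>x. \<Sum>j<n. (max 0 (x - X j))\<^sup>2 *\<^sub>R c j + (max 0 (x - X j)) ^ 3 *\<^sub>R d j) has_vector_derivative
     (\<Sum>j<n. (2 * max 0 (x - X j)) *\<^sub>R c j + (3 * (max 0 (x - X j))\<^sup>2) *\<^sub>R d j)) (at x)"
    by (intro has_vector_derivative_sum has_vector_derivative_add scaleR_const_vderiv
        DERIV_pos_part_square DERIV_pos_part_cube)
  ultimately show ?thesis
    unfolding cubic_spline_def[abs_def] cubic_spline'_def
    using has_vector_derivative_add by fastforce
qed

lemma cubic_spline'_deriv:
  assumes "x \<notin> X ` {..<n}"
  shows "(cubic_spline' X b c d n has_vector_derivative cubic_spline'' X c d n x) (at x)"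
proof -
  have m: "((\<lambda>x. k * max 0 (x - X j)) has_real_derivative k * indicator {X j<..} x) (at x)" if "j < n" for j k
    by (rule DERIV_cmult[OF DERIV_pos_part]) (use assms that in auto)
  have q: "((\<lambda>x. 3 * (max 0 (x - X j))\<^sup>2) has_real_derivative 6 * max 0 (x - X j)) (at x)" for j
    by (rule DERIV_cong[OF DERIV_cmult[OF DERIV_pos_part_square]]) simp
  have "((\<lambda>x. \<Sum>j<n. (2 * max 0 (x - X j)) *\<^sub>R c j + (3 * (max 0 (x - X j))\<^sup>2) *\<^sub>R d j) has_vector_derivative
     cubic_spline'' X c d n x) (at x)"
    unfolding cubic_spline''_def
    by (intro has_vector_derivative_sum has_vector_derivative_add scaleR_const_vderiv m q) simp
  from has_vector_derivative_add[OF has_vector_derivative_const[of b] this]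
  show ?thesis unfolding cubic_spline'_def[abs_def] by simp
qed

lemma linear_spline_deriv:
  assumes "x \<notin> X ` {..<n}"
  shows "(linear_spline X a s n has_vector_derivative linear_spline' X s n x) (at x)"
proof -
  have "((\<lambda>x. \<Sum>j<n. max 0 (x - X j) *\<^sub>R s j) has_vector_derivative linear_spline' X s n x) (at x)"
    unfolding linear_spline'_def
    by (intro has_vector_derivative_sum scaleR_const_vderiv DERIV_pos_part) (use assms in auto)
  from has_vector_derivative_add[OF has_vector_derivative_const[of a] this]
  show ?thesis unfolding linear_spline_def[abs_def] by simp
qed

lemma spline_continuous:
  "continuous_on S (cubic_spline X a b c d n)" "continuous_on S (cubic_spline' X b c d n)"
  "continuous_on S (linear_spline X a s n)"
  unfolding cubic_spline_def[abs_def] cubic_spline'_def[abs_def] linear_spline_def[abs_def]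
  by (intro continuous_intros)+

lemma spline_derivative_square_integrable:
  "square_integrable L (cubic_spline'' X c d n)" "square_integrable L (linear_spline' X s n)"
proof -
  have i: "square_integrable L (\<lambda>x. indicator {p<..} x *\<^sub>R q)" for p q
    by (rule square_integrable_bounded[where B = "norm q"]) (auto simp: indicator_def intro!: borel_measurable_I0)
  have m: "square_integrable L (\<lambda>x. (6 * max 0 (x - p)) *\<^sub>R q)" for p q
    by (intro square_integrable_continuous continuous_intros)
  have add: "square_integrable L (\<lambda>x. f x + g x)" if "square_integrable L f" "square_integrable L g" for f g
    using square_integrable_lincomb[OF that, of 1 1] by simp
  have 0: "square_integrable L (\<lambda>x. 0)" by (intro square_integrable_continuous continuous_intros)
  have i2: "square_integrable L (\<lambda>x. (2 * indicator {p<..} x) *\<^sub>R q)" for p q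
    using i[of p "2 *\<^sub>R q"] by (simp add: mult.commute)
  show "square_integrable L (cubic_spline'' X c d n)"
    unfolding cubic_spline''_def[abs_def]
    by (induction n) (simp_all add: 0 add i2 m)
  show "square_integrable L (linear_spline' X s n)"
    unfolding linear_spline'_def[abs_def]
    by (induction n) (simp_all add: 0 add i)
qed

lemma spline_H1_derivative:
  assumes "0 \<le> L"
  shows "has_H1_derivative L (cubic_spline X a b c d n) (cubic_spline' X b c d n)"
    "has_H1_derivative L (cubic_spline' X b c d n) (cubic_spline'' X c d n)"
    "has_H1_derivative L (linear_spline X a s n) (linear_spline' X s n)"
proof -
  show "has_H1_derivative L (cubic_spline X a b c d n) (cubic_spline' X b c d n)"
    by (rule has_H1_derivative_piecewise[where S = "{}", OF spline_continuous(1)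
          square_integrable_continuous[OF spline_continuous(2)] _ assms cubic_spline_deriv]) simp
  show "has_H1_derivative L (cubic_spline' X b c d n) (cubic_spline'' X c d n)"
    by (rule has_H1_derivative_piecewise[where S = "X ` {..<n}", OF spline_continuous(2)
          spline_derivative_square_integrable(1) _ assms cubic_spline'_deriv]) auto
  show "has_H1_derivative L (linear_spline X a s n) (linear_spline' X s n)"
    by (rule has_H1_derivative_piecewise[where S = "X ` {..<n}", OF spline_continuous(3)
          spline_derivative_square_integrable(2) _ assms linear_spline_deriv]) auto
qed

text \<open>The 2 by 2 system for the two new coefficients on an element of length l, with
  determinant l^4. R and S are the value and the slope still missing at the right end.\<close>

lemma cubic_hermite_solve:
  fixes R S :: "real^3"
  assumes "l \<noteq> 0"
  defines "c \<equiv> (1 / l\<^sup>2) *\<^sub>R (3 *\<^sub>R R - l *\<^sub>R S)" and "d \<equiv> (1 / l ^ 3) *\<^sub>R (l *\<^sub>R S - 2 *\<^sub>R R)"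
  shows "l\<^sup>2 *\<^sub>R c + l ^ 3 *\<^sub>R d = R" "(2 * l) *\<^sub>R c + (3 * l\<^sup>2) *\<^sub>R d = S"
proof -
  have "l\<^sup>2 *\<^sub>R c = 3 *\<^sub>R R - l *\<^sub>R S" "l ^ 3 *\<^sub>R d = l *\<^sub>R S - 2 *\<^sub>R R"
    using assms(1) by (simp_all add: c_def d_def)
  then show "l\<^sup>2 *\<^sub>R c + l ^ 3 *\<^sub>R d = R" by (simp add: vec_eq_iff)
  have "(2 * l) *\<^sub>R c = (2 / l) *\<^sub>R (3 *\<^sub>R R - l *\<^sub>R S)" "(3 * l\<^sup>2) *\<^sub>R d = (3 / l) *\<^sub>R (l *\<^sub>R S - 2 *\<^sub>R R)"
    using assms(1) by (simp_all add: c_def d_def power2_eq_square power3_eq_cube)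
  then show "(2 * l) *\<^sub>R c + (3 * l\<^sup>2) *\<^sub>R d = S"
    using assms(1) by (simp only:) (simp add: vec_eq_iff field_simps)
qed

text \<open>Induction on the number of knots. The two new truncated powers vanish together with
  their derivatives at all earlier nodes, so the conditions there survive, and their coefficients
  are fitted to value and slope at the next node.\<close>

lemma hermite_interpolation:
  assumes X: "partition L N X" and n: "n \<le> N"
  shows "\<exists>c d. \<forall>j\<le>n. cubic_spline X (A 0) (B 0) c d n (X j) = A j \<and> cubic_spline' X (B 0) c d n (X j) = B j"
  using n
proof (induction n)
  case 0
  show ?case by (simp add: cubic_spline_def cubic_spline'_def)
next
  case (Suc n)
  then obtain c d where cd: "\<And>j. j \<le> n \<Longrightarrow> cubic_spline X (A 0) (B 0) c d n (X j) = A j"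
      "\<And>j. j \<le> n \<Longrightarrow> cubic_spline' X (B 0) c d n (X j) = B j"
    by auto
  define l where "l = X (Suc n) - X n"
  have l: "0 < l" using partition_less[OF X, of n "Suc n"] Suc.prems by (simp add: l_def)
  obtain p q where pq: "l\<^sup>2 *\<^sub>R p + l ^ 3 *\<^sub>R q = A (Suc n) - cubic_spline X (A 0) (B 0) c d n (X (Suc n))"
      "(2 * l) *\<^sub>R p + (3 * l\<^sup>2) *\<^sub>R q = B (Suc n) - cubic_spline' X (B 0) c d n (X (Suc n))"
    using cubic_hermite_solve l by (metis less_irrefl)
  have s: "cubic_spline X (A 0) (B 0) (c(n := p)) (d(n := q)) (Suc n) x =
      cubic_spline X (A 0) (B 0) c d n x + ((max 0 (x - X n))\<^sup>2 *\<^sub>R p + (max 0 (x - X n)) ^ 3 *\<^sub>R q)" for x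
    by (simp add: cubic_spline_def add.assoc)
  have s': "cubic_spline' X (B 0) (c(n := p)) (d(n := q)) (Suc n) x =
      cubic_spline' X (B 0) c d n x + ((2 * max 0 (x - X n)) *\<^sub>R p + (3 * (max 0 (x - X n))\<^sup>2) *\<^sub>R q)" for x
    by (simp add: cubic_spline'_def add.assoc)
  have "cubic_spline X (A 0) (B 0) (c(n := p)) (d(n := q)) (Suc n) (X j) = A j \<and>
     cubic_spline' X (B 0) (c(n := p)) (d(n := q)) (Suc n) (X j) = B j" if "j \<le> Suc n" for j
  proof (cases "j = Suc n")
    case True
    have "max 0 (X (Suc n) - X n) = l" using l by (simp add: l_def)
    then show ?thesis unfolding True s s' using pq by simp
  next
    case False
    then have j: "j \<le> n" using that by simp
    have "max 0 (X j - X n) = 0"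
      using partition_less[OF X, of j n] j Suc.prems by (cases "j = n") auto
    then show ?thesis unfolding s s' using cd[OF j] by simp
  qed
  then show ?case by blast
qed

lemma linear_interpolation:
  assumes X: "partition L N X" and n: "n \<le> N"
  shows "\<exists>s. \<forall>j\<le>n. linear_spline X (A 0) s n (X j) = A j"
  using n
proof (induction n)
  case 0
  show ?case by (simp add: linear_spline_def)
next
  case (Suc n)
  then obtain s where s: "\<And>j. j \<le> n \<Longrightarrow> linear_spline X (A 0) s n (X j) = A j" by auto
  define l where "l = X (Suc n) - X n"
  have l: "0 < l" using partition_less[OF X, of n "Suc n"] Suc.prems by (simp add: l_def)
  define p where "p = (1 / l) *\<^sub>R (A (Suc n) - linear_spline X (A 0) s n (X (Suc n)))"
  have e: "linear_spline X (A 0) (s(n := p)) (Suc n) x = linear_spline X (A 0) s n x + max 0 (x - X n) *\<^sub>R p" for x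
    by (simp add: linear_spline_def add.assoc)
  have "linear_spline X (A 0) (s(n := p)) (Suc n) (X j) = A j" if "j \<le> Suc n" for j
  proof (cases "j = Suc n")
    case True
    have "max 0 (X (Suc n) - X n) = l" using l by (simp add: l_def)
    then show ?thesis unfolding True e using l by (simp add: p_def)
  next
    case False
    then have j: "j \<le> n" using that by simp
    have "max 0 (X j - X n) = 0"
      using partition_less[OF X, of j n] j Suc.prems by (cases "j = n") auto
    then show ?thesis unfolding e using s[OF j] by simp
  qed
  then show ?case by blast
qed

section \<open>Splines as piecewise polynomials and the nodal interpolant\<close>

lemma partition_pos_part:
  assumes X: "partition L N X" and k: "k < N" and x: "x \<in> {X k..X (Suc k)}" and j: "j < N"
  shows "max 0 (x - X j) = (if j \<le> k then x - X j else 0)"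
proof (cases "j \<le> k")
  case True
  then have "X j \<le> X k" using partition_less[OF X, of j k] k by (cases "j = k") auto
  then show ?thesis using True x by auto
next
  case False
  then have "X (Suc k) \<le> X j" using partition_less[OF X, of "Suc k" j] j by (cases "j = Suc k") auto
  then show ?thesis using False x by auto
qed

text \<open>On element k the truncated powers up to index k are ordinary powers and the later ones
  are zero. The function f is kept general so that one lemma serves values and derivatives of both
  kinds of spline.\<close>

lemma partition_sum_pos_part:
  fixes f :: "nat \<Rightarrow> real \<Rightarrow> 'a::comm_monoid_add"
  assumes X: "partition L N X" and k: "k < N" and x: "x \<in> {X k..X (Suc k)}" and f: "\<And>j. f j 0 = 0"
  shows "(\<Sum>j<N. f j (max 0 (x - X j))) = (\<Sum>j\<le>k. f j (x - X j))"
proof -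
  have "(\<Sum>j<N. f j (max 0 (x - X j))) = (\<Sum>j<N. if j \<le> k then f j (x - X j) else 0)"
    by (rule sum.cong) (auto simp: partition_pos_part[OF X k x] f)
  also have "\<dots> = (\<Sum>j\<in>{..<N} \<inter> {j. j \<le> k}. f j (x - X j))"
    by (simp add: sum.If_cases)
  also have "{..<N} \<inter> {j. j \<le> k} = {..k}" using k by auto
  finally show ?thesis .
qed

lemma cubic_spline_in_spline_space:
  assumes X: "partition L N X"
  shows "(\<lambda>x. cubic_spline X a b c d N x $ i) \<in> spline_space L 3 1 N X"
  unfolding spline_space_def mem_Collect_eq
proof (intro conjI allI impI)
  have comp: "((\<lambda>x. f x $ i) has_real_derivative f' $ i) F" if "(f has_vector_derivative f') F" for f :: "real \<Rightarrow> real^3" and f' F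
    using bounded_linear.has_vector_derivative[OF bounded_linear_vec_nth that]
    by (simp add: has_real_derivative_iff_has_vector_derivative)
  show "Ck_on 1 {0..L} (\<lambda>x. cubic_spline X a b c d N x $ i)"
    unfolding Ck_on_def
    by (rule exI[of _ "\<lambda>k. if k = 0 then (\<lambda>x. cubic_spline X a b c d N x $ i) else (\<lambda>x. cubic_spline' X b c d N x $ i)"])
       (auto simp: le_Suc_eq intro!: continuous_intros spline_continuous comp has_vector_derivative_at_within[OF cubic_spline_deriv])
next
  fix k assume k: "k < N"
  define q where "q = [:a $ i:] + smult (b $ i) [:- X 0, 1:] +
     (\<Sum>j\<le>k. smult (c j $ i) ([:- X j, 1:] ^ 2) + smult (d j $ i) ([:- X j, 1:] ^ 3))"
  have dp: "degree ([:- p, 1::real:] ^ m) \<le> m" for p m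
    by (rule order_trans[OF degree_power_le]) simp
  have "degree q \<le> 3"
    unfolding q_def
    by (intro degree_add_le degree_sum_le)
       (auto intro!: order_trans[OF degree_smult_le] order_trans[OF dp] degree_add_le)
  moreover have "cubic_spline X a b c d N x $ i = poly q x" if x: "x \<in> {X k..X (Suc k)}" for x
    unfolding cubic_spline_def
    by (subst partition_sum_pos_part[OF X k x, where f = "\<lambda>j t. t\<^sup>2 *\<^sub>R c j + t ^ 3 *\<^sub>R d j"])
       (simp_all add: q_def poly_sum algebra_simps)
  ultimately show "\<exists>q. degree q \<le> 3 \<and> (\<forall>x\<in>{X k..X (Suc k)}. cubic_spline X a b c d N x $ i = poly q x)"
    by blast
qed

lemma linear_spline_in_spline_space:
  assumes X: "partition L N X"
  shows "(\<lambda>x. linear_spline X a s N x $ i) \<in> spline_space L 1 0 N X"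
  unfolding spline_space_def mem_Collect_eq
proof (intro conjI allI impI)
  show "Ck_on 0 {0..L} (\<lambda>x. linear_spline X a s N x $ i)"
    unfolding Ck_on_def
    by (rule exI[of _ "\<lambda>k x. linear_spline X a s N x $ i"]) (auto intro!: continuous_intros spline_continuous)
next
  fix k assume k: "k < N"
  define q where "q = [:a $ i:] + (\<Sum>j\<le>k. smult (s j $ i) [:- X j, 1:])"
  have "degree q \<le> 1"
    unfolding q_def by (intro degree_add_le degree_sum_le) auto
  moreover have "linear_spline X a s N x $ i = poly q x" if x: "x \<in> {X k..X (Suc k)}" for x
    unfolding linear_spline_def
    by (subst partition_sum_pos_part[OF X k x, where f = "\<lambda>j t. t *\<^sub>R s j"])
       (simp_all add: q_def poly_sum algebra_simps)
  ultimately show "\<exists>q. degree q \<le> 1 \<and> (\<forall>x\<in>{X k..X (Suc k)}. linear_spline X a s N x $ i = poly q x)"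
    by blast
qed

lemma spline_derivative_elem:
  assumes X: "partition L N X" and k: "k < N" and x: "x \<in> {X k<..<X (Suc k)}"
  shows "cubic_spline'' X c d N x = (\<Sum>j\<le>k. 2 *\<^sub>R c j - (6 * X j) *\<^sub>R d j) + x *\<^sub>R (\<Sum>j\<le>k. 6 *\<^sub>R d j)"
    "linear_spline' X s N x = (\<Sum>j\<le>k. s j)"
proof -
  have x': "x \<in> {X k..X (Suc k)}" using x by simp
  have "x \<noteq> X j" if "j < N" for j
  proof (cases "j \<le> k")
    case True
    then show ?thesis using partition_less[OF X, of j k] k x by (cases "j = k") auto
  next
    case False
    then show ?thesis using partition_less[OF X, of "Suc k" j] that x by (cases "j = Suc k") auto
  qed
  \<comment> \<open>Away from the nodes the indicator is a function of the truncated argument that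
    vanishes at 0, the form in which the sum over the later knots drops out.\<close>
  then have ind: "indicator {X j<..} x = (if max 0 (x - X j) = 0 then 0 else 1 :: real)" if "j < N" for j
    using \<open>\<And>j. j < N \<Longrightarrow> x \<noteq> X j\<close>[OF that] by (auto simp: indicator_def max_def)
  have "cubic_spline'' X c d N x = (\<Sum>j<N. (\<lambda>j t. (2 * (if t = 0 then 0 else 1)) *\<^sub>R c j + (6 * t) *\<^sub>R d j) j (max 0 (x - X j)))"
    unfolding cubic_spline''_def by (rule sum.cong) (simp_all add: ind)
  also have "\<dots> = (\<Sum>j\<le>k. (\<lambda>j t. (2 * (if t = 0 then 0 else 1)) *\<^sub>R c j + (6 * t) *\<^sub>R d j) j (x - X j))"
    by (rule partition_sum_pos_part[OF X k x']) simp
  also have "\<dots> = (\<Sum>j\<le>k. 2 *\<^sub>R c j - (6 * X j) *\<^sub>R d j + x *\<^sub>R (6 *\<^sub>R d j))"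
    by (rule sum.cong) (use \<open>\<And>j. j < N \<Longrightarrow> x \<noteq> X j\<close> k in \<open>auto simp: algebra_simps\<close>)
  finally show "cubic_spline'' X c d N x = (\<Sum>j\<le>k. 2 *\<^sub>R c j - (6 * X j) *\<^sub>R d j) + x *\<^sub>R (\<Sum>j\<le>k. 6 *\<^sub>R d j)"
    by (simp add: sum.distrib scaleR_sum_right)
  have "linear_spline' X s N x = (\<Sum>j<N. (\<lambda>j t. (if t = 0 then 0 else 1) *\<^sub>R s j) j (max 0 (x - X j)))"
    unfolding linear_spline'_def by (rule sum.cong) (simp_all add: ind)
  also have "\<dots> = (\<Sum>j\<le>k. (\<lambda>j t. (if t = 0 then 0 else 1) *\<^sub>R s j) j (x - X j))"
    by (rule partition_sum_pos_part[OF X k x']) simp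
  also have "\<dots> = (\<Sum>j\<le>k. s j)"
    by (rule sum.cong) (use \<open>\<And>j. j < N \<Longrightarrow> x \<noteq> X j\<close> k in auto)
  finally show "linear_spline' X s N x = (\<Sum>j\<le>k. s j)" .
qed

text \<open>Specified by properties instead of the spline formula: nodal agreement, and y'' affine
  and b' constant on each element. The error analysis uses nothing else. The elementwise shape is
  stated almost everywhere because \<open>ddy\<close> and \<open>db\<close> are chosen
  derivatives.\<close>

definition nodal_interpolant :: "real \<Rightarrow> nat \<Rightarrow> (nat \<Rightarrow> real) \<Rightarrow> conf \<Rightarrow> conf \<Rightarrow> bool" where
  "nodal_interpolant L N X v w \<longleftrightarrow> w \<in> Vh L N X \<and>
     (\<forall>j\<le>N. fst w (X j) = fst v (X j) \<and> dy L w (X j) = dy L v (X j) \<and> snd w (X j) = snd v (X j)) \<and>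
     (\<forall>j<N. \<exists>P Q. AE x in I0 L. x \<in> {X j<..<X (Suc j)} \<longrightarrow> ddy L w x = P + x *\<^sub>R Q) \<and>
     (\<forall>j<N. \<exists>P. AE x in I0 L. x \<in> {X j<..<X (Suc j)} \<longrightarrow> db L w x = P)"

lemma nodal_interpolant_exists:
  assumes X: "partition L N X" and L: "0 < L"
  shows "\<exists>w. nodal_interpolant L N X v w"
proof -
  obtain c d where cd: "\<And>j. j \<le> N \<Longrightarrow> cubic_spline X (fst v (X 0)) (dy L v (X 0)) c d N (X j) = fst v (X j)"
     "\<And>j. j \<le> N \<Longrightarrow> cubic_spline' X (dy L v (X 0)) c d N (X j) = dy L v (X j)"
    using hermite_interpolation[OF X order_refl, of "\<lambda>j. fst v (X j)" "\<lambda>j. dy L v (X j)"] by blast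
  obtain s where s: "\<And>j. j \<le> N \<Longrightarrow> linear_spline X (snd v (X 0)) s N (X j) = snd v (X j)"
    using linear_interpolation[OF X order_refl, of "\<lambda>j. snd v (X j)"] by blast
  let ?y = "cubic_spline X (fst v (X 0)) (dy L v (X 0)) c d N" and ?b = "linear_spline X (snd v (X 0)) s N"
  have L0: "0 \<le> L" using L by simp
  note Y = H2_I[OF spline_H1_derivative(1)[OF L0, where X = X and a = "fst v (X 0)" and
        b = "dy L v (X 0)" and c = c and d = d and n = N] spline_H1_derivative(2)[OF L0] L]
  note B = D_H1_AE[OF spline_H1_derivative(3)[OF L0, where X = X and a = "snd v (X 0)" and s = s and n = N] L]
  have "nodal_interpolant L N X v (?y, ?b)"
    unfolding nodal_interpolant_def
  proof (intro conjI allI impI)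
    show "(?y, ?b) \<in> Vh L N X"
      using Y(1) B(1) cubic_spline_in_spline_space[OF X] linear_spline_in_spline_space[OF X]
      by (simp add: Vh_def V_def)
    fix j assume j: "j \<le> N"
    show "fst (?y, ?b) (X j) = fst v (X j)" "snd (?y, ?b) (X j) = snd v (X j)"
      using cd s j by simp_all
    show "dy L (?y, ?b) (X j) = dy L v (X j)"
      using Y(2)[of "X j"] cd(2)[OF j] partition_range[OF X j] by simp
  next
    fix j assume j: "j < N"
    show "\<exists>P Q. AE x in I0 L. x \<in> {X j<..<X (Suc j)} \<longrightarrow> ddy L (?y, ?b) x = P + x *\<^sub>R Q"
      by (rule exI[of _ "\<Sum>i\<le>j. 2 *\<^sub>R c i - (6 * X i) *\<^sub>R d i"], rule exI[of _ "\<Sum>i\<le>j. 6 *\<^sub>R d i"],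
          rule eventually_mono[OF Y(3)]) (simp add: spline_derivative_elem(1)[OF X j])
    show "\<exists>P. AE x in I0 L. x \<in> {X j<..<X (Suc j)} \<longrightarrow> db L (?y, ?b) x = P"
      by (rule exI[of _ "\<Sum>i\<le>j. s i"], rule eventually_mono[OF B(2)])
         (simp add: spline_derivative_elem(2)[OF X j])
  qed
  then show ?thesis by blast
qed

section \<open>Interpolation errors and the boundary operator\<close>

lemma has_H1_derivative_diff:
  assumes "has_H1_derivative L u g" "has_H1_derivative L v k"
  shows "has_H1_derivative L (\<lambda>x. u x - v x) (\<lambda>x. g x - k x)"
  using has_H1_derivative_lincomb[OF assms, of 1 "-1"] by simp

lemma Vh_subset: "w \<in> Vh L N X \<Longrightarrow> w \<in> V L"
  by (auto simp: Vh_def)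

lemma nodal_interpolantD:
  assumes "nodal_interpolant L N X v w"
  shows "w \<in> Vh L N X" "w \<in> V L"
    "\<And>j. j \<le> N \<Longrightarrow> fst w (X j) = fst v (X j)" "\<And>j. j \<le> N \<Longrightarrow> dy L w (X j) = dy L v (X j)"
    "\<And>j. j \<le> N \<Longrightarrow> snd w (X j) = snd v (X j)"
  using assms Vh_subset[of w L N X] unfolding nodal_interpolant_def by simp_all

lemma LINT_inner_const:
  assumes "integrable (I0 L) f"
  shows "(LINT x|I0 L. f x \<bullet> c) = (LINT x|I0 L. f x) \<bullet> (c :: real^3)"
  using integral_inner_left assms by blast

text \<open>On an element the error of y'' has vanishing moments against 1 and x: the slopes agree
  at both ends, and one further integration by parts uses agreement of the values. Since y_h'' - c
  is affine there, it is orthogonal to the error. For b' one moment suffices.\<close>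

lemma nodal_interpolant_orthogonal:
  assumes X: "partition L N X" and v: "v \<in> V L" and w: "nodal_interpolant L N X v w" and j: "j < N"
  shows "(LINT x|I0 L. indicator {X j<..<X (Suc j)} x *\<^sub>R ((ddy L v x - ddy L w x) \<bullet> (ddy L w x - c))) = 0"
    and "(LINT x|I0 L. indicator {X j<..<X (Suc j)} x *\<^sub>R ((db L v x - db L w x) \<bullet> (db L w x - c))) = 0"
proof -
  let ?i = "indicator {X j<..<X (Suc j)} :: real \<Rightarrow> real"
  note W = nodal_interpolantD[OF w]
  note dv = V_D[OF v] and dw = V_D[OF W(2)]
  note y1 = has_H1_derivative_diff[OF dv(1) dw(1)] and y2 = has_H1_derivative_diff[OF dv(2) dw(2)]
    and b1 = has_H1_derivative_diff[OF dv(3) dw(3)]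
  have XX: "0 \<le> X j" "X j < X (Suc j)" "X (Suc j) \<le> L" "j \<le> N" "Suc j \<le> N"
    using partition_range[OF X, of j] partition_range[OF X, of "Suc j"] partition_less[OF X, of j "Suc j"] j by auto
  define e where "e x = ddy L v x - ddy L w x" for x
  define e1 where "e1 x = dy L v x - dy L w x" for x
  have es: "square_integrable L e" "square_integrable L e1"
    using H1_square_integrable[OF y2] unfolding e_def[abs_def] e1_def[abs_def] by auto
  note ei = square_integrable_integrable[OF es(1)] square_integrable_integrable[OF es(2)]
  have ie: "integrable (I0 L) (\<lambda>x. ?i x *\<^sub>R e x)" "integrable (I0 L) (\<lambda>x. ?i x *\<^sub>R e1 x)"
    by (rule integrable_I0_indicator[OF ei(1)], simp) (rule integrable_I0_indicator[OF ei(2)], simp)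
  have xe: "integrable (I0 L) (\<lambda>x. x *\<^sub>R e x)"
    by (rule integrable_I0_continuous_scaleR[OF continuous_on_id ei(1)])
  have ixe: "integrable (I0 L) (\<lambda>x. ?i x *\<^sub>R (x *\<^sub>R e x))"
    by (rule integrable_I0_indicator[OF xe]) simp
  have F0: "(LINT x|I0 L. ?i x *\<^sub>R e x) = 0"
    using H1_fundamental_theorem[OF y2 XX(1-3)] W(4)[OF XX(4)] W(4)[OF XX(5)] by (simp add: e_def)
  have W0: "(LINT x|I0 L. ?i x *\<^sub>R e1 x) = 0"
    using H1_fundamental_theorem[OF y1 XX(1-3)] W(3)[OF XX(4)] W(3)[OF XX(5)] by (simp add: e1_def)
  \<comment> \<open>Integration by parts with the weight x: boundary terms vanish by nodal slopes,
    and the integral of the slope error by nodal values (\<open>W0\<close>).\<close>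
  have "(LINT x|I0 L. ?i x *\<^sub>R (1 *\<^sub>R e1 x + x *\<^sub>R e x)) = 0"
    using H1_integration_by_parts[OF y2 DERIV_ident continuous_on_const XX(1-3)] W(4)[OF XX(4)] W(4)[OF XX(5)]
    by (simp add: e_def e1_def)
  moreover have "(LINT x|I0 L. ?i x *\<^sub>R (1 *\<^sub>R e1 x + x *\<^sub>R e x)) =
      (LINT x|I0 L. ?i x *\<^sub>R e1 x) + (LINT x|I0 L. ?i x *\<^sub>R (x *\<^sub>R e x))"
    unfolding scaleR_add_right scaleR_one by (rule LINT_plus[OF ie(2) ixe])
  ultimately have F1: "(LINT x|I0 L. ?i x *\<^sub>R (x *\<^sub>R e x)) = 0" using W0 by simp
  obtain P Q where PQ: "AE x in I0 L. x \<in> {X j<..<X (Suc j)} \<longrightarrow> ddy L w x = P + x *\<^sub>R Q"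
    using w j unfolding nodal_interpolant_def by blast
  have ic: "integrable (I0 L) (\<lambda>x. (?i x *\<^sub>R e x) \<bullet> (P - c))" "integrable (I0 L) (\<lambda>x. (?i x *\<^sub>R (x *\<^sub>R e x)) \<bullet> Q)"
    using integrable_inner_left ie(1) ixe by blast+
  have cs: "square_integrable L (\<lambda>x. c)" by (rule square_integrable_continuous[OF continuous_on_const])
  have "(LINT x|I0 L. ?i x *\<^sub>R (e x \<bullet> (ddy L w x - c))) =
      (LINT x|I0 L. (?i x *\<^sub>R e x) \<bullet> (P - c) + (?i x *\<^sub>R (x *\<^sub>R e x)) \<bullet> Q)"
  proof (rule integral_cong_AE)
    show "(\<lambda>x. ?i x *\<^sub>R (e x \<bullet> (ddy L w x - c))) \<in> borel_measurable (I0 L)"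
      by (rule borel_measurable_integrable[OF integrable_I0_indicator[OF square_integrable_inner[OF es(1)
            square_integrable_diff[OF H1_square_integrable(2)[OF dw(2)] cs]]]]) simp
    show "(\<lambda>x. (?i x *\<^sub>R e x) \<bullet> (P - c) + (?i x *\<^sub>R (x *\<^sub>R e x)) \<bullet> Q) \<in> borel_measurable (I0 L)"
      by (rule borel_measurable_integrable[OF integrable_plus[OF ic]])
    show "AE x in I0 L. ?i x *\<^sub>R (e x \<bullet> (ddy L w x - c)) = (?i x *\<^sub>R e x) \<bullet> (P - c) + (?i x *\<^sub>R (x *\<^sub>R e x)) \<bullet> Q"
      using PQ by (rule eventually_mono) (auto simp: indicator_def inner_add_right inner_diff_right)
  qed
  also have "\<dots> = (LINT x|I0 L. (?i x *\<^sub>R e x) \<bullet> (P - c)) + (LINT x|I0 L. (?i x *\<^sub>R (x *\<^sub>R e x)) \<bullet> Q)"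
    by (rule LINT_plus[OF ic])
  also have "\<dots> = 0" unfolding LINT_inner_const[OF ie(1)] LINT_inner_const[OF ixe] F0 F1 by simp
  finally show "(LINT x|I0 L. ?i x *\<^sub>R ((ddy L v x - ddy L w x) \<bullet> (ddy L w x - c))) = 0"
    unfolding e_def .
  define k where "k x = db L v x - db L w x" for x
  have ks: "square_integrable L k" using H1_square_integrable[OF b1] unfolding k_def[abs_def] by auto
  have ik: "integrable (I0 L) (\<lambda>x. ?i x *\<^sub>R k x)"
    by (rule integrable_I0_indicator[OF square_integrable_integrable[OF ks]]) simp
  have K0: "(LINT x|I0 L. ?i x *\<^sub>R k x) = 0"
    using H1_fundamental_theorem[OF b1 XX(1-3)] W(5)[OF XX(4)] W(5)[OF XX(5)] by (simp add: k_def)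
  obtain P where P: "AE x in I0 L. x \<in> {X j<..<X (Suc j)} \<longrightarrow> db L w x = P"
    using w j unfolding nodal_interpolant_def by blast
  have "(LINT x|I0 L. ?i x *\<^sub>R (k x \<bullet> (db L w x - c))) = (LINT x|I0 L. (?i x *\<^sub>R k x) \<bullet> (P - c))"
  proof (rule integral_cong_AE)
    show "(\<lambda>x. ?i x *\<^sub>R (k x \<bullet> (db L w x - c))) \<in> borel_measurable (I0 L)"
      by (rule borel_measurable_integrable[OF integrable_I0_indicator[OF square_integrable_inner[OF ks
            square_integrable_diff[OF H1_square_integrable(2)[OF dw(3)] cs]]]]) simp
    show "(\<lambda>x. (?i x *\<^sub>R k x) \<bullet> (P - c)) \<in> borel_measurable (I0 L)"
      using integrable_inner_left ik by blast
    show "AE x in I0 L. ?i x *\<^sub>R (k x \<bullet> (db L w x - c)) = (?i x *\<^sub>R k x) \<bullet> (P - c)"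
      using P by (rule eventually_mono) (auto simp: indicator_def)
  qed
  also have "\<dots> = 0" unfolding LINT_inner_const[OF ik] K0 by simp
  finally show "(LINT x|I0 L. ?i x *\<^sub>R ((db L v x - db L w x) \<bullet> (db L w x - c))) = 0"
    unfolding k_def .
qed

lemma nodal_interpolant_converges:
  assumes v: "v \<in> V L" and L: "0 < L" and e: "0 < e"
  shows "\<exists>d>0. \<forall>N X w. partition L N X \<and> mesh_size N X < d \<and> nodal_interpolant L N X v w \<longrightarrow>
    L2sq L (\<lambda>x. ddy L v x - ddy L w x) < e \<and> L2sq L (\<lambda>x. db L v x - db L w x) < e"
proof -
  obtain d1 where d1: "d1 > 0" "\<And>N X p. partition L N X \<Longrightarrow> mesh_size N X < d1 \<Longrightarrow> square_integrable L p \<Longrightarrow>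
     (\<forall>j<N. \<forall>c. (LINT x|I0 L. indicator {X j<..<X (Suc j)} x *\<^sub>R ((ddy L v x - p x) \<bullet> (p x - c))) = 0)
     \<Longrightarrow> L2sq L (\<lambda>x. ddy L v x - p x) < e"
    using L2_projection_converges[OF H1_square_integrable(2)[OF V_D(2)[OF v]] e L] by meson
  obtain d2 where d2: "d2 > 0" "\<And>N X p. partition L N X \<Longrightarrow> mesh_size N X < d2 \<Longrightarrow> square_integrable L p \<Longrightarrow>
     (\<forall>j<N. \<forall>c. (LINT x|I0 L. indicator {X j<..<X (Suc j)} x *\<^sub>R ((db L v x - p x) \<bullet> (p x - c))) = 0)
     \<Longrightarrow> L2sq L (\<lambda>x. db L v x - p x) < e"
    using L2_projection_converges[OF H1_square_integrable(2)[OF V_D(3)[OF v]] e L] by meson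
  show ?thesis
  proof (intro exI[of _ "min d1 d2"] conjI allI impI)
    show "0 < min d1 d2" using d1(1) d2(1) by simp
    fix N X w assume A: "partition L N X \<and> mesh_size N X < min d1 d2 \<and> nodal_interpolant L N X v w"
    then have X: "partition L N X" and m: "mesh_size N X < d1" "mesh_size N X < d2" and w: "nodal_interpolant L N X v w"
      by auto
    note dw = V_D[OF nodal_interpolantD(2)[OF w]]
    show "L2sq L (\<lambda>x. ddy L v x - ddy L w x) < e"
      by (rule d1(2)[OF X m(1) H1_square_integrable(2)[OF dw(2)]]) (use nodal_interpolant_orthogonal(1)[OF X v w] in blast)
    show "L2sq L (\<lambda>x. db L v x - db L w x) < e"
      by (rule d2(2)[OF X m(2) H1_square_integrable(2)[OF dw(3)]]) (use nodal_interpolant_orthogonal(2)[OF X v w] in blast)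
  qed
qed

text \<open>Poincare's inequality on each element, summed. Starting from the left node,
  Cauchy-Schwarz gains one factor h pointwise, and integration over the element gains the
  second.\<close>

lemma L2sq_nodal_zero_le:
  assumes X: "partition L N X" and u: "has_H1_derivative L u g" and 0: "\<And>j. j \<le> N \<Longrightarrow> u (X j) = 0"
  shows "L2sq L u \<le> (mesh_size N X)\<^sup>2 * L2sq L g"
proof -
  let ?h = "mesh_size N X"
  note us = H1_square_integrable[OF u]
  define G where "G j = (LINT x|I0 L. indicator {X j<..<X (Suc j)} x *\<^sub>R (norm (g x))\<^sup>2)" for j
  have el: "(LINT x|I0 L. indicator {X j<..<X (Suc j)} x *\<^sub>R (norm (u x))\<^sup>2) \<le> ?h\<^sup>2 * G j" if j: "j < N" for j
  proof -
    let ?i = "indicator {X j<..<X (Suc j)} :: real \<Rightarrow> real"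
    have XX: "0 \<le> X j" "X j < X (Suc j)" "X (Suc j) \<le> L" "j \<le> N" "X (Suc j) - X j \<le> ?h"
      using partition_range[OF X, of j] partition_range[OF X, of "Suc j"] partition_less[OF X, of j "Suc j"]
        partition_mesh[OF X j] j by auto
    have h0: "0 \<le> ?h" using XX by linarith
    have ig: "integrable (I0 L) (\<lambda>x. indicator A x *\<^sub>R (norm (g x))\<^sup>2)" if "A \<in> sets borel" for A
      by (rule integrable_I0_indicator[OF square_integrableD[OF us(2)] that])
    have ci: "integrable (I0 L) (\<lambda>x. c :: real)" for c by (rule integrable_I0_const)
    have G0: "0 \<le> G j" unfolding G_def by (rule integral_nonneg_AE) simp
    \<comment> \<open>\<open>G j\<close> is the energy of g on this element only, so that the sum
      over the elements is the energy on (0,L) once.\<close>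
    have "(norm (u x))\<^sup>2 \<le> ?h * G j" if x: "x \<in> {X j<..<X (Suc j)}" for x
    proof -
      have "norm (u x - u (X j)) \<le> sqrt (x - X j) * sqrt (LINT t|I0 L. indicator {X j<..<x} t * (norm (g t))\<^sup>2)"
        by (rule H1_holder[OF u]) (use XX x in auto)
      then have "(norm (u x))\<^sup>2 \<le> (sqrt (x - X j) * sqrt (LINT t|I0 L. indicator {X j<..<x} t * (norm (g t))\<^sup>2))\<^sup>2"
        using 0[OF XX(4)] by (intro power_mono) auto
      also have "\<dots> = (x - X j) * (LINT t|I0 L. indicator {X j<..<x} t * (norm (g t))\<^sup>2)"
        using x by (simp add: power_mult_distrib)
      also have "\<dots> \<le> ?h * G j"
      proof (rule mult_mono)
        show "(LINT t|I0 L. indicator {X j<..<x} t * (norm (g t))\<^sup>2) \<le> G j"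
          unfolding G_def real_scaleR_def
          by (rule integral_mono) (use x ig[of "{X j<..<x}"] ig[of "{X j<..<X (Suc j)}"] in \<open>auto simp: indicator_def\<close>)
      qed (use x XX h0 in auto)
      finally show ?thesis .
    qed
    then have "(LINT x|I0 L. ?i x *\<^sub>R (norm (u x))\<^sup>2) \<le> (LINT x|I0 L. ?i x *\<^sub>R (?h * G j))"
      by (intro integral_mono integrable_I0_indicator[OF square_integrableD[OF us(1)]] integrable_I0_indicator[OF ci])
         (auto simp: indicator_def)
    also have "\<dots> = measure (I0 L) {X j<..<X (Suc j)} * (?h * G j)"
      using XX by (simp add: Int_absorb2 subset_eq)
    also have "measure (I0 L) {X j<..<X (Suc j)} = X (Suc j) - X j"
      using XX by (subst measure_restrict_space) (auto simp: subset_eq)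
    also have "(X (Suc j) - X j) * (?h * G j) \<le> ?h * (?h * G j)"
      using XX h0 G0 by (intro mult_right_mono) auto
    finally show ?thesis by (simp add: power2_eq_square mult.assoc)
  qed
  have "L2sq L u = (\<Sum>j<N. LINT x|I0 L. indicator {X j<..<X (Suc j)} x *\<^sub>R (norm (u x))\<^sup>2)"
    unfolding L2sq_def by (rule partition_LINT_sum[OF X square_integrableD[OF us(1)]])
  also have "\<dots> \<le> (\<Sum>j<N. ?h\<^sup>2 * G j)" by (rule sum_mono) (use el in simp)
  also have "\<dots> = ?h\<^sup>2 * L2sq L g"
    unfolding L2sq_def partition_LINT_sum[OF X square_integrableD[OF us(2)]] G_def by (rule sum_distrib_left[symmetric])
  finally show ?thesis .
qed

lemma V_norm_tendsto_0:
  assumes w: "\<And>i. w i \<in> V L"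
    and "((\<lambda>i. L2sq L (fst (w i))) \<longlongrightarrow> 0) F" "((\<lambda>i. L2sq L (dy L (w i))) \<longlongrightarrow> 0) F"
      "((\<lambda>i. L2sq L (ddy L (w i))) \<longlongrightarrow> 0) F" "((\<lambda>i. L2sq L (snd (w i))) \<longlongrightarrow> 0) F"
      "((\<lambda>i. L2sq L (db L (w i))) \<longlongrightarrow> 0) F"
  shows "((\<lambda>i. V_norm L (w i)) \<longlongrightarrow> 0) F"
proof -
  have "((\<lambda>i. sqrt (L2sq L (fst (w i)) + L2sq L (dy L (w i)) + L2sq L (ddy L (w i)) +
    L2sq L (snd (w i)) + L2sq L (db L (w i)))) \<longlongrightarrow> sqrt (0 + 0 + 0 + 0 + 0)) F"
    by (intro tendsto_intros assms)
  then show ?thesis by (simp add: V_norm_eq[OF w])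
qed

lemma L2sq_tendsto_0:
  assumes f: "\<And>i. square_integrable L (f i)" and L: "0 \<le> L"
    and M: "\<And>i x. x \<in> {0<..<L} \<Longrightarrow> norm (f i x) \<le> M i" and lim: "(M \<longlongrightarrow> 0) F"
  shows "((\<lambda>i. L2sq L (f i)) \<longlongrightarrow> 0) F"
proof (rule tendsto_sandwich[OF always_eventually always_eventually tendsto_const])
  show "\<forall>i. 0 \<le> L2sq L (f i)" by (simp add: L2sq_nonneg)
  show "\<forall>i. L2sq L (f i) \<le> L * (M i)\<^sup>2" by (intro allI L2sq_le_bounded f M L)
  have "((\<lambda>i. L * (M i)\<^sup>2) \<longlongrightarrow> L * 0\<^sup>2) F" by (intro tendsto_intros lim)
  then show "((\<lambda>i. L * (M i)\<^sup>2) \<longlongrightarrow> 0) F" by simp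
qed

text \<open>Since the operator only sees boundary values, it may be evaluated at the cubic and affine
  Hermite interpolants of the boundary data, whose norms are controlled by these data.\<close>

lemma boundary_operator_weakly_continuous:
  fixes Lbc :: "conf \<Rightarrow> 'w::real_normed_vector"
  assumes B: "boundary_operator L Lbc" and L: "0 < L" and w: "\<And>i. w i \<in> V L" and v: "v \<in> V L"
    and conv: "weakly_convergent_V L w v F"
  shows "((\<lambda>i. Lbc (w i)) \<longlongrightarrow> Lbc v) F"
proof -
  \<comment> \<open>Weak convergence tests real functionals, while \<open>Lbc\<close> takes values
    in an arbitrary normed space. The difference is therefore replaced by a function with the same
    boundary values that tends to 0 in norm, where boundedness of \<open>Lbc\<close>
    suffices.\<close>
  define u where "u i = lincomb 1 (w i) (-1) v" for i
  have uV: "u i \<in> V L" for i unfolding u_def by (rule V_lincomb(1)[OF w v L])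
  define Y0 YL T0 TL B0 BL where
    "Y0 i = fst (u i) 0" and "YL i = fst (u i) L" and "T0 i = dy L (u i) 0" and "TL i = dy L (u i) L"
    and "B0 i = snd (u i) 0" and "BL i = snd (u i) L" for i
  have u1: "fst (u i) x = fst (w i) x - fst v x" "snd (u i) x = snd (w i) x - snd v x" for i x
    by (simp_all add: u_def lincomb_def)
  have u2: "dy L (u i) x = dy L (w i) x - dy L v x" if "x \<in> {0..L}" for i x
    unfolding u_def using V_lincomb(2)[OF w[of i] v L that, of 1 "-1"] by simp
  note wl = weakly_convergent_V_D[OF conv L]
  have in0: "0 \<in> {0..L}" "L \<in> {0..L}" using L by auto
  have eqs: "Y0 = (\<lambda>i. fst (w i) 0 - fst v 0)" "YL = (\<lambda>i. fst (w i) L - fst v L)"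
      "T0 = (\<lambda>i. dy L (w i) 0 - dy L v 0)" "TL = (\<lambda>i. dy L (w i) L - dy L v L)"
      "B0 = (\<lambda>i. snd (w i) 0 - snd v 0)" "BL = (\<lambda>i. snd (w i) L - snd v L)"
    by (simp_all add: fun_eq_iff T0_def TL_def u2[OF in0(1)] u2[OF in0(2)])
      (simp_all add: Y0_def YL_def B0_def BL_def u1)
  have Y: "(Y0 \<longlongrightarrow> 0) F" "(YL \<longlongrightarrow> 0) F" "(T0 \<longlongrightarrow> 0) F" "(TL \<longlongrightarrow> 0) F" "(B0 \<longlongrightarrow> 0) F" "(BL \<longlongrightarrow> 0) F"
    using LIM_zero[OF wl(3)[OF in0(1)]] LIM_zero[OF wl(3)[OF in0(2)]] LIM_zero[OF wl(4)[OF in0(1)]]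
      LIM_zero[OF wl(4)[OF in0(2)]] LIM_zero[OF wl(5)[OF in0(1)]] LIM_zero[OF wl(5)[OF in0(2)]]
    unfolding eqs by simp_all
  \<comment> \<open>The value and slope at L that remain after subtracting the affine function
    through the data at 0.\<close>
  define R S where "R i = YL i - Y0 i - L *\<^sub>R T0 i" and "S i = TL i - T0 i" for i
  define c d s where "c i = (1 / L\<^sup>2) *\<^sub>R (3 *\<^sub>R R i - L *\<^sub>R S i)" and "d i = (1 / L ^ 3) *\<^sub>R (L *\<^sub>R S i - 2 *\<^sub>R R i)"
    and "s i = (1 / L) *\<^sub>R (BL i - B0 i)" for i
  have RS: "(R \<longlongrightarrow> 0) F" "(S \<longlongrightarrow> 0) F"
    unfolding R_def S_def
    using tendsto_diff[OF tendsto_diff[OF Y(2,1)] tendsto_scaleR[OF tendsto_const[of L] Y(3)]] tendsto_diff[OF Y(4,3)]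
    by simp_all
  have cds: "(c \<longlongrightarrow> 0) F" "(d \<longlongrightarrow> 0) F" "(s \<longlongrightarrow> 0) F"
    unfolding c_def d_def s_def
    using tendsto_scaleR[OF tendsto_const[of "1 / L\<^sup>2"] tendsto_diff[OF tendsto_scaleR[OF tendsto_const[of 3] RS(1)] tendsto_scaleR[OF tendsto_const[of L] RS(2)]]]
      tendsto_scaleR[OF tendsto_const[of "1 / L^3"] tendsto_diff[OF tendsto_scaleR[OF tendsto_const[of L] RS(2)] tendsto_scaleR[OF tendsto_const[of 2] RS(1)]]]
      tendsto_scaleR[OF tendsto_const[of "1 / L"] tendsto_diff[OF Y(6,5)]]
    by simp_all
  note solve = cubic_hermite_solve[of L "R i" "S i" for i, folded c_def d_def]
  \<comment> \<open>One knot at 0: on [0,L] the splines with n = 1 are an ordinary cubic and an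
    affine function, so the facts about spline derivatives can be reused.\<close>
  let ?X = "\<lambda>j::nat. 0::real"
  define y y' y'' b b' where "y i = cubic_spline ?X (Y0 i) (T0 i) (\<lambda>_. c i) (\<lambda>_. d i) 1"
    and "y' i = cubic_spline' ?X (T0 i) (\<lambda>_. c i) (\<lambda>_. d i) 1" and "y'' i = cubic_spline'' ?X (\<lambda>_. c i) (\<lambda>_. d i) 1"
    and "b i = linear_spline ?X (B0 i) (\<lambda>_. s i) 1" and "b' i = linear_spline' ?X (\<lambda>_. s i) 1" for i
  have L0: "0 \<le> L" using L by simp
  have H: "has_H1_derivative L (y i) (y' i)" "has_H1_derivative L (y' i) (y'' i)" "has_H1_derivative L (b i) (b' i)" for i
    unfolding y_def y'_def y''_def b_def b'_def by (rule spline_H1_derivative[OF L0])+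
  note HY = H2_I[OF H(1,2) L] and HB = D_H1_AE[OF H(3) L]
  define p where "p i = (y i, b i)" for i
  have pV: "p i \<in> V L" for i using HY(1) HB(1) by (simp add: p_def V_def)
  have yx: "y i x = Y0 i + x *\<^sub>R T0 i + (x\<^sup>2 *\<^sub>R c i + x ^ 3 *\<^sub>R d i)"
      "y' i x = T0 i + ((2 * x) *\<^sub>R c i + (3 * x\<^sup>2) *\<^sub>R d i)"
      "b i x = B0 i + x *\<^sub>R s i" if "0 \<le> x" for i x
    using that by (simp_all add: y_def y'_def b_def cubic_spline_def cubic_spline'_def linear_spline_def)
  have yx2: "y'' i x = 2 *\<^sub>R c i + (6 * x) *\<^sub>R d i" "b' i x = s i" if "0 < x" for i x
    using that by (simp_all add: y''_def b'_def cubic_spline''_def linear_spline'_def)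
  have "boundary_values L (p i) = boundary_values L (u i)" for i
  proof -
    have "y i L = YL i" "y' i L = TL i" "b i L = BL i"
      unfolding yx[OF L0] using solve[of i] L by (simp_all add: R_def S_def s_def)
    then show ?thesis
      using HY(2)[OF in0(1), of i] HY(2)[OF in0(2), of i] yx[of 0 i]
      by (simp add: boundary_values_def p_def case_prod_beta Y0_def YL_def T0_def TL_def B0_def BL_def)
  qed
  then have Lu: "Lbc (u i) = Lbc (p i)" for i
    using B pV uV unfolding boundary_operator_def by metis
  define M where "M i = norm (Y0 i) + L * norm (T0 i) + (L\<^sup>2 * norm (c i) + L ^ 3 * norm (d i))" for i
  define M' where "M' i = norm (T0 i) + ((2 * L) * norm (c i) + (3 * L\<^sup>2) * norm (d i))" for i
  define M'' where "M'' i = 2 * norm (c i) + (6 * L) * norm (d i)" for i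
  define K where "K i = norm (B0 i) + L * norm (s i)" for i
  have lims: "(M \<longlongrightarrow> 0) F" "(M' \<longlongrightarrow> 0) F" "(M'' \<longlongrightarrow> 0) F" "(K \<longlongrightarrow> 0) F"
  proof -
    note n = tendsto_norm_zero[OF Y(1)] tendsto_norm_zero[OF Y(3)] tendsto_norm_zero[OF Y(5)]
      tendsto_norm_zero[OF cds(1)] tendsto_norm_zero[OF cds(2)] tendsto_norm_zero[OF cds(3)]
    show "(M \<longlongrightarrow> 0) F" "(M' \<longlongrightarrow> 0) F" "(M'' \<longlongrightarrow> 0) F" "(K \<longlongrightarrow> 0) F"
      unfolding M_def M'_def M''_def K_def
      by (intro tendsto_add_zero tendsto_mult_right_zero n)+
  qed
  have bd: "norm (y i x) \<le> M i" "norm (y' i x) \<le> M' i" "norm (y'' i x) \<le> M'' i" "norm (b i x) \<le> K i"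
      "norm (b' i x) \<le> norm (s i)" if x: "x \<in> {0<..<L}" for i x
  proof -
    have x0: "0 \<le> x" "x \<le> L" "0 < x" using x by auto
    have sc: "norm (r *\<^sub>R q) \<le> r' * norm q" if "0 \<le> r" "r \<le> r'" for r r' and q :: "real^3"
      using that by (simp add: mult_right_mono)
    have pw: "x\<^sup>2 \<le> L\<^sup>2" "x ^ 3 \<le> L ^ 3" using x0 by (auto intro: power_mono)
    show "norm (y i x) \<le> M i" unfolding yx(1)[OF x0(1)] M_def
      by (intro norm_triangle_mono sc pw x0 order_refl zero_le_power)
    show "norm (y' i x) \<le> M' i" unfolding yx(2)[OF x0(1)] M'_def
      by (intro norm_triangle_mono sc order_refl) (use pw x0 in auto)
    show "norm (y'' i x) \<le> M'' i" unfolding yx2(1)[OF x0(3)] M''_def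
      by (intro norm_triangle_mono sc order_refl) (use x0 in auto)
    show "norm (b i x) \<le> K i" unfolding yx(3)[OF x0(1)] K_def
      by (intro norm_triangle_mono sc x0 order_refl)
    show "norm (b' i x) \<le> norm (s i)" unfolding yx2(2)[OF x0(3)] ..
  qed
  have Vp: "((\<lambda>i. V_norm L (p i)) \<longlongrightarrow> 0) F"
  proof (rule V_norm_tendsto_0[OF pV])
    note dp = V_D[OF pV]
    show "((\<lambda>i. L2sq L (fst (p i))) \<longlongrightarrow> 0) F"
      unfolding p_def fst_conv by (rule L2sq_tendsto_0[OF H1_square_integrable(1)[OF H(1)] L0 bd(1) lims(1)])
    show "((\<lambda>i. L2sq L (snd (p i))) \<longlongrightarrow> 0) F"
      unfolding p_def snd_conv by (rule L2sq_tendsto_0[OF H1_square_integrable(1)[OF H(3)] L0 bd(4) lims(4)])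
    have "L2sq L (dy L (p i)) = L2sq L (y' i)" for i
      by (rule L2sq_cong_AE[OF _ square_integrable_measurable[OF H1_square_integrable(1)[OF dp(2)]]
            square_integrable_measurable[OF H1_square_integrable(1)[OF H(2)]]])
         (use HY(2)[of _ i] in \<open>auto simp: p_def\<close>)
    then show "((\<lambda>i. L2sq L (dy L (p i))) \<longlongrightarrow> 0) F"
      using L2sq_tendsto_0[OF H1_square_integrable(1)[OF H(2)] L0 bd(2) lims(2)] by simp
    have "L2sq L (ddy L (p i)) = L2sq L (y'' i)" for i
      by (rule L2sq_cong_AE[OF _ square_integrable_measurable[OF H1_square_integrable(2)[OF dp(2)]]
            square_integrable_measurable[OF H1_square_integrable(2)[OF H(2)]]])
         (use HY(3)[of i] in \<open>simp add: p_def\<close>)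
    then show "((\<lambda>i. L2sq L (ddy L (p i))) \<longlongrightarrow> 0) F"
      using L2sq_tendsto_0[OF H1_square_integrable(2)[OF H(2)] L0 bd(3) lims(3)] by simp
    have "L2sq L (db L (p i)) = L2sq L (b' i)" for i
      by (rule L2sq_cong_AE[OF _ square_integrable_measurable[OF H1_square_integrable(2)[OF dp(3)]]
            square_integrable_measurable[OF H1_square_integrable(2)[OF H(3)]]])
         (use HB(2)[of i] in \<open>simp add: p_def\<close>)
    then show "((\<lambda>i. L2sq L (db L (p i))) \<longlongrightarrow> 0) F"
      using L2sq_tendsto_0[OF H1_square_integrable(2)[OF H(3)] L0 bd(5) tendsto_norm_zero[OF cds(3)]] by simp
  qed
  obtain C where C: "\<And>v. v \<in> V L \<Longrightarrow> norm (Lbc v) \<le> C * V_norm L v"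
    using B unfolding boundary_operator_def bounded_linear_V_def by blast
  have "Lbc (u i) = Lbc (w i) - Lbc v" for i
  proof -
    have "Lbc (lincomb 1 (w i) (-1) v) = 1 *\<^sub>R Lbc (w i) + (-1) *\<^sub>R Lbc v"
      using B w v unfolding boundary_operator_def bounded_linear_V_def by blast
    then show ?thesis by (simp add: u_def)
  qed
  then have "norm (Lbc (w i) - Lbc v) \<le> C * V_norm L (p i)" for i
    using C[OF pV[of i]] Lu[of i] by simp
  then have "((\<lambda>i. Lbc (w i) - Lbc v) \<longlongrightarrow> 0) F"
    by (intro Lim_null_comparison[OF _ tendsto_mult_right_zero[OF Vp]] always_eventually allI)
  then show ?thesis by (rule LIM_zero_cancel)
qed

section \<open>The energy densities\<close>

definition Qform :: "real \<Rightarrow> real^3 \<Rightarrow> real^3 \<Rightarrow> real" where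
  "Qform t A B = (1 - t\<^sup>2) * (norm A)\<^sup>2 + 2 * (1 + t) * (norm B)\<^sup>2"

text \<open>The maximizer over t in [0,1]. With a = |A|^2 and b = |B|^2, the t-dependent part -t^2 a
  + 2 t b is stationary at t = b/a; this is capped at 1, which also covers A = 0.\<close>

definition Qslope :: "real^3 \<Rightarrow> real^3 \<Rightarrow> real" where
  "Qslope A B = (if norm B < norm A then (norm B)\<^sup>2 / (norm A)\<^sup>2 else 1)"

abbreviation Qlim :: "real^3 \<Rightarrow> real^3 \<Rightarrow> real" where
  "Qlim A B \<equiv> Qbar (norm A) (norm B)"

lemma Qslope_bounds: "0 \<le> Qslope A B" "Qslope A B \<le> 1"
proof -
  show "0 \<le> Qslope A B" by (simp add: Qslope_def)
  have "(norm B)\<^sup>2 / (norm A)\<^sup>2 \<le> 1" if "norm B < norm A"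
  proof -
    have "(norm B)\<^sup>2 \<le> (norm A)\<^sup>2" using that by (intro power_mono) auto
    moreover have "0 < norm A" using that norm_ge_zero[of B] by linarith
    ultimately show ?thesis by simp
  qed
  then show "Qslope A B \<le> 1" by (simp add: Qslope_def)
qed

lemma Qlim_eq_Qform: "Qlim A B = Qform (Qslope A B) A B"
proof (cases "norm B < norm A")
  case True
  then have "norm A \<noteq> 0" by (metis norm_ge_zero not_less)
  then show ?thesis using True
    by (simp add: Qbar_def Qform_def Qslope_def field_simps power2_eq_square)
next
  case False
  then show ?thesis by (simp add: Qbar_def Qform_def Qslope_def)
qed

text \<open>With a = |A|^2 and b = |B|^2 the gap is (b - t a)^2 / a in the first regime and (1 -
  t)(2b - (1 + t) a) in the second, where a <= b and t <= 1 make the last factor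
  nonnegative.\<close>

lemma Qform_le_Qlim:
  assumes t: "0 \<le> t" "t \<le> 1"
  shows "Qform t A B \<le> Qlim A B"
proof (cases "norm B < norm A")
  case True
  define a b where "a = (norm A)\<^sup>2" and "b = (norm B)\<^sup>2"
  have "0 < norm A" using True by (metis norm_ge_zero le_less_trans)
  then have a: "0 < a" by (simp add: a_def)
  have "(a + b)\<^sup>2 / a - ((1 - t\<^sup>2) * a + 2 * (1 + t) * b) = (b - t * a)\<^sup>2 / a"
    using a by (simp add: field_simps power2_eq_square)
  moreover have "0 \<le> (b - t * a)\<^sup>2 / a" using a by simp
  ultimately have "(1 - t\<^sup>2) * a + 2 * (1 + t) * b \<le> (a + b)\<^sup>2 / a" by linarith
  then show ?thesis using True by (simp add: Qbar_def Qform_def a_def b_def)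
next
  case False
  define a b where "a = (norm A)\<^sup>2" and "b = (norm B)\<^sup>2"
  have ab: "0 \<le> a" "a \<le> b" using False by (auto simp: a_def b_def intro!: power_mono)
  have "(1 + t) * a \<le> 2 * b" using mult_mono[of "1 + t" 2 a b] ab t by simp
  then have "0 \<le> (1 - t) * (2 * b - (1 + t) * a)" using t by simp
  then have "(1 - t\<^sup>2) * a + 2 * (1 + t) * b \<le> 4 * b"
    by (simp add: algebra_simps power2_eq_square)
  then show ?thesis using False by (simp add: Qbar_def Qform_def a_def b_def)
qed

lemma Qlim_convex:
  "Qlim A B + 2 * (1 - (Qslope A B)\<^sup>2) * (A \<bullet> (A' - A)) + 4 * (1 + Qslope A B) * (B \<bullet> (B' - B)) \<le> Qlim A' B'"
proof -
  let ?t = "Qslope A B"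
  note t = Qslope_bounds[of A B]
  have sq: "(norm C)\<^sup>2 + 2 * (C \<bullet> (C' - C)) \<le> (norm C')\<^sup>2" for C C' :: "real^3"
  proof -
    have "(norm C')\<^sup>2 - ((norm C)\<^sup>2 + 2 * (C \<bullet> (C' - C))) = (norm (C' - C))\<^sup>2"
      by (simp add: power2_norm_eq_inner inner_diff_left inner_diff_right inner_commute)
    then show ?thesis using zero_le_power2[of "norm (C' - C)"] by linarith
  qed
  have "?t\<^sup>2 \<le> 1" using t by (simp add: power_le_one)
  then have "(1 - ?t\<^sup>2) * ((norm A)\<^sup>2 + 2 * (A \<bullet> (A' - A))) \<le> (1 - ?t\<^sup>2) * (norm A')\<^sup>2"
    by (intro mult_left_mono sq) simp
  moreover have "2 * (1 + ?t) * ((norm B)\<^sup>2 + 2 * (B \<bullet> (B' - B))) \<le> 2 * (1 + ?t) * (norm B')\<^sup>2"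
    using t by (intro mult_left_mono sq) simp
  ultimately have "Qform ?t A B + 2 * (1 - ?t\<^sup>2) * (A \<bullet> (A' - A)) + 4 * (1 + ?t) * (B \<bullet> (B' - B)) \<le> Qform ?t A' B'"
    unfolding Qform_def by (simp add: algebra_simps)
  also have "\<dots> \<le> Qlim A' B'" by (rule Qform_le_Qlim[OF t])
  finally show ?thesis unfolding Qlim_eq_Qform[of A B] .
qed

lemma Qlim_bounds: "0 \<le> Qlim A B" "Qlim A B \<le> (norm A)\<^sup>2 + 4 * (norm B)\<^sup>2"
proof -
  show "0 \<le> Qlim A B" by (simp add: Qbar_def)
  note t = Qslope_bounds[of A B]
  have "(1 - (Qslope A B)\<^sup>2) * (norm A)\<^sup>2 \<le> 1 * (norm A)\<^sup>2" by (intro mult_right_mono) auto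
  moreover have "2 * (1 + Qslope A B) * (norm B)\<^sup>2 \<le> 4 * (norm B)\<^sup>2" using t by (intro mult_right_mono) auto
  ultimately show "Qlim A B \<le> (norm A)\<^sup>2 + 4 * (norm B)\<^sup>2" unfolding Qlim_eq_Qform Qform_def by linarith
qed

text \<open>Evaluate both sides at the maximizer of the larger one; for t in [0,1] the coefficients
  of the two squared norms are at most 1 and 4. This bound is what turns strong L^2 convergence into
  convergence of the density.\<close>

lemma Qlim_diff_le:
  "\<bar>Qlim A' B' - Qlim A B\<bar> \<le> \<bar>(norm A')\<^sup>2 - (norm A)\<^sup>2\<bar> + 4 * \<bar>(norm B')\<^sup>2 - (norm B)\<^sup>2\<bar>"
proof -
  have *: "Qlim A' B' - Qlim A B \<le> \<bar>(norm A')\<^sup>2 - (norm A)\<^sup>2\<bar> + 4 * \<bar>(norm B')\<^sup>2 - (norm B)\<^sup>2\<bar>" for A B A' B'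
  proof -
    let ?t = "Qslope A' B'"
    note t = Qslope_bounds[of A' B']
    have "Qlim A' B' - Qlim A B \<le> Qform ?t A' B' - Qform ?t A B"
      using Qform_le_Qlim[OF t, of A B] unfolding Qlim_eq_Qform[of A' B'] by linarith
    also have "\<dots> = (1 - ?t\<^sup>2) * ((norm A')\<^sup>2 - (norm A)\<^sup>2) + 2 * (1 + ?t) * ((norm B')\<^sup>2 - (norm B)\<^sup>2)"
      by (simp add: Qform_def algebra_simps)
    also have "\<dots> \<le> 1 * \<bar>(norm A')\<^sup>2 - (norm A)\<^sup>2\<bar> + 4 * \<bar>(norm B')\<^sup>2 - (norm B)\<^sup>2\<bar>"
    proof (rule add_mono)
      have "?t\<^sup>2 \<le> 1" using t by (simp add: power_le_one)
      then have "(1 - ?t\<^sup>2) * ((norm A')\<^sup>2 - (norm A)\<^sup>2) \<le> (1 - ?t\<^sup>2) * \<bar>(norm A')\<^sup>2 - (norm A)\<^sup>2\<bar>"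
        by (intro mult_left_mono) auto
      also have "\<dots> \<le> 1 * \<bar>(norm A')\<^sup>2 - (norm A)\<^sup>2\<bar>" by (intro mult_right_mono) auto
      finally show "(1 - ?t\<^sup>2) * ((norm A')\<^sup>2 - (norm A)\<^sup>2) \<le> 1 * \<bar>(norm A')\<^sup>2 - (norm A)\<^sup>2\<bar>" .
      have "2 * (1 + ?t) * ((norm B')\<^sup>2 - (norm B)\<^sup>2) \<le> 2 * (1 + ?t) * \<bar>(norm B')\<^sup>2 - (norm B)\<^sup>2\<bar>"
        using t by (intro mult_left_mono) auto
      also have "\<dots> \<le> 4 * \<bar>(norm B')\<^sup>2 - (norm B)\<^sup>2\<bar>" using t by (intro mult_right_mono) auto
      finally show "2 * (1 + ?t) * ((norm B')\<^sup>2 - (norm B)\<^sup>2) \<le> 4 * \<bar>(norm B')\<^sup>2 - (norm B)\<^sup>2\<bar>" .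
    qed
    finally show ?thesis by simp
  qed
  show ?thesis using *[of A' B' A B] *[of A B A' B'] by (simp add: abs_le_iff abs_minus_commute)
qed

section \<open>The regularized density\<close>

definition Qreg :: "(real \<Rightarrow> real \<Rightarrow> real) \<Rightarrow> real \<Rightarrow> real^3 \<Rightarrow> real^3 \<Rightarrow> real" where
  "Qreg m \<delta> A B = 1/2 * ((norm A)\<^sup>2 + 5 * (norm B)\<^sup>2 + psi m \<delta> ((norm A)\<^sup>2) ((norm B)\<^sup>2))"

lemma regularized_modulusD:
  assumes "regularized_modulus c0 c1 c2 cuni m" "0 < \<delta>"
  shows "0 < m \<delta> x" "\<bar>m \<delta> x - \<bar>x\<bar>\<bar> \<le> cuni * \<delta>" "continuous_on UNIV (m \<delta>)" "0 < cuni"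
proof -
  have "c0 * \<delta> \<le> m \<delta> x" "0 < c0" using assms unfolding regularized_modulus_def by blast+
  then show "0 < m \<delta> x" using assms(2) by (meson mult_pos_pos less_le_trans)
  show "\<bar>m \<delta> x - \<bar>x\<bar>\<bar> \<le> cuni * \<delta>" "0 < cuni" using assms unfolding regularized_modulus_def by blast+
  have "Ck_on 2 UNIV (m \<delta>)" using assms unfolding regularized_modulus_def by blast
  then obtain D where D: "\<forall>x\<in>UNIV. D 0 x = m \<delta> x" "\<forall>i\<le>(2::nat). continuous_on UNIV (D i)"
    unfolding Ck_on_def by blast
  then have "D 0 = m \<delta>" by (simp add: fun_eq_iff)
  then show "continuous_on UNIV (m \<delta>)" using D(2) by (metis le0)
qed

lemma psi_nonneg:
  assumes "regularized_modulus c0 c1 c2 cuni m" "0 < \<delta>" "0 \<le> a" "0 \<le> b"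
  shows "0 \<le> psi m \<delta> a b"
  using regularized_modulusD(1)[OF assms(1,2), of "a - b"] assms(3,4) by (simp add: psi_def)

text \<open>Inserting the exact modulus M = |a - b| into the regularized formula returns the limit
  density. The map k -> k + 4 b^2 / (a + b + k) has Lipschitz constant 1 + 4, because b / (a + b +
  k) and b / (a + b + M) are at most 1; the prefactor 1/2 gives 5/2.\<close>

lemma Qreg_Qlim:
  assumes m: "regularized_modulus c0 c1 c2 cuni m" and \<delta>: "0 < \<delta>"
  shows "\<bar>Qreg m \<delta> A B - Qlim A B\<bar> \<le> 5/2 * (cuni * \<delta>)"
proof -
  define a b k M where "a = (norm A)\<^sup>2" and "b = (norm B)\<^sup>2" and "k = m \<delta> (a - b)" and "M = \<bar>a - b\<bar>"
  note mD = regularized_modulusD[OF m \<delta>]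
  have ab: "0 \<le> a" "0 \<le> b" by (auto simp: a_def b_def)
  have k: "0 < k" "\<bar>k - M\<bar> \<le> cuni * \<delta>" using mD(1,2)[of "a - b"] by (auto simp: k_def M_def)
  have Q: "Qlim A B = 1/2 * (a + 5 * b + (M + 4 * b\<^sup>2 / (a + b + M)))"
  proof (cases "norm B < norm A")
    case True
    then have "b < a" unfolding a_def b_def by (intro power_strict_mono) auto
    then have M: "M = a - b" "0 < a" using ab by (auto simp: M_def)
    have "(a + b)\<^sup>2 / a = 1/2 * (a + 5 * b + ((a - b) + 4 * b\<^sup>2 / (a + b + (a - b))))"
      using M(2) by (simp add: field_simps power2_eq_square)
    then show ?thesis using True unfolding M(1) by (simp add: Qbar_def a_def b_def)
  next
    case False
    then have "a \<le> b" unfolding a_def b_def by (intro power_mono) auto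
    then have M: "M = b - a" by (auto simp: M_def)
    have "4 * b = 1/2 * (a + 5 * b + ((b - a) + 4 * b\<^sup>2 / (a + b + (b - a))))"
      by (cases "b = 0") (simp_all add: field_simps power2_eq_square)
    then show ?thesis using False unfolding M by (simp add: Qbar_def b_def)
  qed
  have d: "\<bar>4 * b\<^sup>2 / (a + b + k) - 4 * b\<^sup>2 / (a + b + M)\<bar> \<le> 4 * (cuni * \<delta>)"
  proof (cases "b = 0")
    case True
    then show ?thesis using mD(4) \<delta> by simp
  next
    case False
    then have b: "0 < b" using ab by simp
    have p: "0 < a + b + k" "0 < a + b + M" using b ab k by (auto simp: M_def)
    have "4 * b\<^sup>2 / (a + b + k) - 4 * b\<^sup>2 / (a + b + M) = 4 * ((b / (a + b + k)) * (b / (a + b + M))) * (M - k)"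
      using p by (simp add: field_simps power2_eq_square)
    then have "\<bar>4 * b\<^sup>2 / (a + b + k) - 4 * b\<^sup>2 / (a + b + M)\<bar> = 4 * ((b / (a + b + k)) * (b / (a + b + M))) * \<bar>M - k\<bar>"
      using p b by (simp add: abs_mult)
    also have "\<dots> \<le> 4 * (1 * 1) * (cuni * \<delta>)"
    proof (intro mult_mono)
      show "b / (a + b + k) \<le> 1" "b / (a + b + M) \<le> 1" using p ab k by (auto simp: M_def)
      show "\<bar>M - k\<bar> \<le> cuni * \<delta>" using k by (simp add: abs_minus_commute)
    qed (use p b in auto)
    finally show ?thesis by simp
  qed
  have Qr: "Qreg m \<delta> A B = 1/2 * (a + 5 * b + (k + 4 * b\<^sup>2 / (a + b + k)))"
    unfolding Qreg_def psi_def a_def[symmetric] b_def[symmetric] k_def[symmetric] ..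
  \<comment> \<open>The quotients are abstracted to p and q, which leaves linear arithmetic.\<close>
  have gen: "\<bar>1/2 * (s + (k + p)) - 1/2 * (s + (M + q))\<bar> \<le> 5/2 * r"
    if "\<bar>p - q\<bar> \<le> 4 * r" "\<bar>k - M\<bar> \<le> r" for p q r s :: real
  proof -
    have "p - q \<le> 4 * r" "q - p \<le> 4 * r" "k - M \<le> r" "M - k \<le> r" using that by (simp_all add: abs_le_iff)
    then show ?thesis by (intro abs_leI) (simp_all add: field_simps)
  qed
  show ?thesis unfolding Q Qr by (rule gen[OF d k(2)])
qed

lemma Qreg_ge:
  assumes "regularized_modulus c0 c1 c2 cuni m" "0 < \<delta>"
  shows "1/2 * ((norm A)\<^sup>2 + (norm B)\<^sup>2) \<le> Qreg m \<delta> A B"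
  using psi_nonneg[OF assms, of "(norm A)\<^sup>2" "(norm B)\<^sup>2"] unfolding Qreg_def by simp

lemma Qlim_measurable:
  assumes [measurable]: "f \<in> borel_measurable M" "g \<in> borel_measurable M"
  shows "(\<lambda>x. Qlim (f x) (g x)) \<in> borel_measurable M"
  unfolding Qbar_def by measurable

lemma Qslope_measurable:
  assumes [measurable]: "f \<in> borel_measurable M" "g \<in> borel_measurable M"
  shows "(\<lambda>x. Qslope (f x) (g x)) \<in> borel_measurable M"
  unfolding Qslope_def by measurable

lemma Qreg_measurable:
  assumes m: "continuous_on UNIV (m \<delta>)" 
    and [measurable]: "f \<in> borel_measurable M" "g \<in> borel_measurable M"
  shows "(\<lambda>x. Qreg m \<delta> (f x) (g x)) \<in> borel_measurable M"
proof -
  have [measurable]: "m \<delta> \<in> borel_measurable borel" by (rule borel_measurable_continuous_onI[OF m])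
  show ?thesis unfolding Qreg_def psi_def by measurable
qed

lemma Qlim_integrable:
  assumes f: "square_integrable L f" and g: "square_integrable L g"
  shows "integrable (I0 L) (\<lambda>x. Qlim (f x) (g x))"
proof (rule Bochner_Integration.integrable_bound)
  show "integrable (I0 L) (\<lambda>x. (norm (f x))\<^sup>2 + 4 * (norm (g x))\<^sup>2)"
    by (intro integrable_plus integrable_mult_right square_integrableD f g)
  show "(\<lambda>x. Qlim (f x) (g x)) \<in> borel_measurable (I0 L)"
    by (intro Qlim_measurable square_integrable_measurable f g)
  have "norm (Qlim A B) \<le> norm ((norm A)\<^sup>2 + 4 * (norm B)\<^sup>2)" for A B
    using Qlim_bounds[of A B] by simp
  then show "AE x in I0 L. norm (Qlim (f x) (g x)) \<le> norm ((norm (f x))\<^sup>2 + 4 * (norm (g x))\<^sup>2)"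
    by (intro AE_I2)
qed

lemma Qreg_integrable:
  assumes m: "regularized_modulus c0 c1 c2 cuni m" and \<delta>: "0 < \<delta>"
    and f: "square_integrable L f" and g: "square_integrable L g"
  shows "integrable (I0 L) (\<lambda>x. Qreg m \<delta> (f x) (g x))"
proof (rule Bochner_Integration.integrable_bound)
  show "integrable (I0 L) (\<lambda>x. Qlim (f x) (g x) + 5/2 * (cuni * \<delta>))"
    by (intro integrable_plus Qlim_integrable f g integrable_I0_const)
  show "(\<lambda>x. Qreg m \<delta> (f x) (g x)) \<in> borel_measurable (I0 L)"
    by (intro Qreg_measurable regularized_modulusD(3)[OF m \<delta>] square_integrable_measurable f g)
  have "norm (Qreg m \<delta> A B) \<le> norm (Qlim A B + 5/2 * (cuni * \<delta>))" for A B
  proof -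
    have "0 \<le> Qreg m \<delta> A B"
      by (rule order_trans[OF _ Qreg_ge[OF m \<delta>]]) simp
    then show ?thesis using Qreg_Qlim[OF m \<delta>, of A B] unfolding real_norm_def by linarith
  qed
  then show "AE x in I0 L. norm (Qreg m \<delta> (f x) (g x)) \<le> norm (Qlim (f x) (g x) + 5/2 * (cuni * \<delta>))"
    by (intro AE_I2)
qed

lemma LINT_Qreg_Qlim:
  assumes m: "regularized_modulus c0 c1 c2 cuni m" and \<delta>: "0 < \<delta>" and L: "0 \<le> L"
    and f: "square_integrable L f" and g: "square_integrable L g"
  shows "\<bar>(LINT x|I0 L. Qreg m \<delta> (f x) (g x)) - (LINT x|I0 L. Qlim (f x) (g x))\<bar> \<le> 5/2 * (cuni * \<delta>) * L"
proof -
  note i = Qreg_integrable[OF m \<delta> f g] Qlim_integrable[OF f g]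
  have "\<bar>(LINT x|I0 L. Qreg m \<delta> (f x) (g x)) - (LINT x|I0 L. Qlim (f x) (g x))\<bar> =
     \<bar>LINT x|I0 L. Qreg m \<delta> (f x) (g x) - Qlim (f x) (g x)\<bar>"
    by (subst LINT_minus[OF i]) simp
  also have "\<dots> \<le> (LINT x|I0 L. \<bar>Qreg m \<delta> (f x) (g x) - Qlim (f x) (g x)\<bar>)"
    by (rule integral_abs_bound)
  also have "\<dots> \<le> (LINT x|I0 L. 5/2 * (cuni * \<delta>))"
    by (intro integral_mono integrable_abs integrable_minus_fun i
        integrable_I0_const Qreg_Qlim[OF m \<delta>])
  also have "\<dots> = 5/2 * (cuni * \<delta>) * L" using measure_I0[OF L] by simp
  finally show ?thesis .
qed

section \<open>Energies as real numbers and admissible frames\<close>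

lemma L2_inner_bounded_integrable:
  assumes u: "continuous_on {0..L} u" and g: "square_integrable L g"
  shows "integrable (I0 L) (\<lambda>x. (u x \<bullet> g x)\<^sup>2)"
proof -
  obtain B where B: "\<forall>x\<in>{0..L}. norm (u x) \<le> B" using continuous_on_Icc_bounded[OF u] by blast
  show ?thesis
  proof (rule Bochner_Integration.integrable_bound)
    show "integrable (I0 L) (\<lambda>x. B\<^sup>2 * (norm (g x))\<^sup>2)" by (rule integrable_mult_right[OF square_integrableD[OF g]])
    show "(\<lambda>x. (u x \<bullet> g x)\<^sup>2) \<in> borel_measurable (I0 L)"
      by (intro borel_measurable_power borel_measurable_inner continuous_measurable_I0 u square_integrable_measurable g)
    show "AE x in I0 L. norm ((u x \<bullet> g x)\<^sup>2) \<le> norm (B\<^sup>2 * (norm (g x))\<^sup>2)"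
    proof (rule AE_I2)
      fix x assume x: "x \<in> space (I0 L)"
      have "\<bar>u x \<bullet> g x\<bar> \<le> norm (u x) * norm (g x)" by (rule Cauchy_Schwarz_ineq2)
      also have "\<dots> \<le> B * norm (g x)" using B x by (intro mult_right_mono) auto
      finally have "\<bar>u x \<bullet> g x\<bar>\<^sup>2 \<le> (B * norm (g x))\<^sup>2" by (intro power_mono) auto
      then show "norm ((u x \<bullet> g x)\<^sup>2) \<le> norm (B\<^sup>2 * (norm (g x))\<^sup>2)" by (simp add: power_mult_distrib)
    qed
  qed
qed

text \<open>At admissible configurations the extended functionals are finite; their real
  counterparts allow subtraction and limits in the reals, and extended values are left to the two
  conversion lemmas.\<close>

definition limit_energy :: "real \<Rightarrow> real \<Rightarrow> conf \<Rightarrow> real" where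
  "limit_energy L \<epsilon>2 v = (LINT x|I0 L. Qlim (ddy L v x) (db L v x)) +
     1 / (2 * \<epsilon>2) * (LINT x|I0 L. (dy L v x \<bullet> db L v x)\<^sup>2)"

definition discrete_energy :: "real \<Rightarrow> (real \<Rightarrow> real \<Rightarrow> real) \<Rightarrow> real \<Rightarrow> real \<Rightarrow> real \<Rightarrow> conf \<Rightarrow> real" where
  "discrete_energy L m \<delta> \<epsilon>1 \<epsilon>2 v = (LINT x|I0 L. Qreg m \<delta> (ddy L v x) (db L v x)) +
     1 / (2 * \<epsilon>1) * (LINT x|I0 L. (dy L v x \<bullet> snd v x)\<^sup>2) +
     1 / (2 * \<epsilon>2) * (LINT x|I0 L. (dy L v x \<bullet> db L v x)\<^sup>2)"

lemma E_limit_eq: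
  assumes v: "v \<in> A_frame L Lbc lbc" and e: "0 < \<epsilon>2"
  shows "E_limit L Lbc lbc \<epsilon>2 v = ennreal (limit_energy L \<epsilon>2 v)"
proof -
  have vV: "v \<in> V L" using v by (auto simp: A_frame_def)
  note d = V_D[OF vV]
  note i1 = Qlim_integrable[OF H1_square_integrable(2)[OF d(2)] H1_square_integrable(2)[OF d(3)]]
  note i2 = L2_inner_bounded_integrable[OF H1_square_integrable(3)[OF d(2)] H1_square_integrable(2)[OF d(3)]]
  have 1: "(\<integral>\<^sup>+x. ennreal (Qlim (ddy L v x) (db L v x)) \<partial>I0 L) = ennreal (LINT x|I0 L. Qlim (ddy L v x) (db L v x))"
    by (rule nn_integral_eq_integral[OF i1]) (simp add: Qlim_bounds)
  have 2: "(\<integral>\<^sup>+x. ennreal ((dy L v x \<bullet> db L v x)\<^sup>2) \<partial>I0 L) = ennreal (LINT x|I0 L. (dy L v x \<bullet> db L v x)\<^sup>2)"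
    by (rule nn_integral_eq_integral[OF i2]) simp
  have "E_limit L Lbc lbc \<epsilon>2 v = (\<integral>\<^sup>+x. ennreal (Qlim (ddy L v x) (db L v x)) \<partial>I0 L) +
      ennreal (1 / (2 * \<epsilon>2)) * (\<integral>\<^sup>+x. ennreal ((dy L v x \<bullet> db L v x)\<^sup>2) \<partial>I0 L)"
    using v by (simp add: E_limit_def case_prod_beta)
  also have "\<dots> = ennreal (limit_energy L \<epsilon>2 v)"
    unfolding 1 2 limit_energy_def using e
    by (simp add: ennreal_mult'[symmetric] ennreal_plus[symmetric] Qlim_bounds del: ennreal_plus)
  finally show ?thesis .
qed

lemma E_discrete_eq:
  assumes v: "v \<in> discrete_admissible L Lbc lbc N X" and e: "0 < \<epsilon>1" "0 < \<epsilon>2"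
    and m: "regularized_modulus c0 c1 c2 cuni m" and \<delta>: "0 < \<delta>"
  shows "E_discrete L Lbc lbc m \<delta> \<epsilon>1 \<epsilon>2 N X v = ennreal (discrete_energy L m \<delta> \<epsilon>1 \<epsilon>2 v)"
proof -
  have vV: "v \<in> V L" using v by (auto simp: discrete_admissible_def Vh_def)
  note d = V_D[OF vV]
  note i1 = Qreg_integrable[OF m \<delta> H1_square_integrable(2)[OF d(2)] H1_square_integrable(2)[OF d(3)]]
  note i2 = L2_inner_bounded_integrable[OF H1_square_integrable(3)[OF d(2)] H1_square_integrable(2)[OF d(3)]]
  note i3 = L2_inner_bounded_integrable[OF H1_square_integrable(3)[OF d(2)] H1_square_integrable(1)[OF d(3)]]
  have Q0: "0 \<le> Qreg m \<delta> A B" for A B by (rule order_trans[OF _ Qreg_ge[OF m \<delta>]]) simp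
  have half: "ennreal (1/2) * ennreal (2 * r) = ennreal r" for r
    by (subst ennreal_mult'[symmetric]) simp_all
  have twice: "2 * Qreg m \<delta> A B = (norm A)\<^sup>2 + 5 * (norm B)\<^sup>2 + psi m \<delta> ((norm A)\<^sup>2) ((norm B)\<^sup>2)" for A B
    by (simp add: Qreg_def)
  have mQ: "(\<lambda>x. ennreal (2 * Qreg m \<delta> (ddy L v x) (db L v x))) \<in> borel_measurable (I0 L)"
    by (rule measurable_compose[OF _ measurable_ennreal]) (rule borel_measurable_integrable[OF integrable_mult_right[OF i1]])
  have "ennreal (1/2) * (\<integral>\<^sup>+x. ennreal (2 * Qreg m \<delta> (ddy L v x) (db L v x)) \<partial>I0 L) =
     (\<integral>\<^sup>+x. ennreal (Qreg m \<delta> (ddy L v x) (db L v x)) \<partial>I0 L)"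
    by (simp only: nn_integral_cmult[OF mQ, symmetric] half)
  also have "\<dots> = ennreal (LINT x|I0 L. Qreg m \<delta> (ddy L v x) (db L v x))"
    by (rule nn_integral_eq_integral[OF i1]) (simp add: Q0)
  finally have 1: "ennreal (1/2) * (\<integral>\<^sup>+x. ennreal (2 * Qreg m \<delta> (ddy L v x) (db L v x)) \<partial>I0 L) =
    ennreal (LINT x|I0 L. Qreg m \<delta> (ddy L v x) (db L v x))" .
  have 2: "(\<integral>\<^sup>+x. ennreal ((dy L v x \<bullet> db L v x)\<^sup>2) \<partial>I0 L) = ennreal (LINT x|I0 L. (dy L v x \<bullet> db L v x)\<^sup>2)"
    by (rule nn_integral_eq_integral[OF i2]) simp
  have 3: "(\<integral>\<^sup>+x. ennreal ((dy L v x \<bullet> snd v x)\<^sup>2) \<partial>I0 L) = ennreal (LINT x|I0 L. (dy L v x \<bullet> snd v x)\<^sup>2)"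
    by (rule nn_integral_eq_integral[OF i3]) simp
  have "E_discrete L Lbc lbc m \<delta> \<epsilon>1 \<epsilon>2 N X v =
      ennreal (1/2) * (\<integral>\<^sup>+x. ennreal (2 * Qreg m \<delta> (ddy L v x) (db L v x)) \<partial>I0 L) +
      ennreal (1 / (2 * \<epsilon>1)) * (\<integral>\<^sup>+x. ennreal ((dy L v x \<bullet> snd v x)\<^sup>2) \<partial>I0 L) +
      ennreal (1 / (2 * \<epsilon>2)) * (\<integral>\<^sup>+x. ennreal ((dy L v x \<bullet> db L v x)\<^sup>2) \<partial>I0 L)"
    using v by (simp add: E_discrete_def twice case_prod_beta)
  also have "\<dots> = ennreal (discrete_energy L m \<delta> \<epsilon>1 \<epsilon>2 v)"
    unfolding 1 2 3 discrete_energy_def using e Q0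
    by (simp add: ennreal_mult'[symmetric] ennreal_plus[symmetric] del: ennreal_plus)
  finally show ?thesis .
qed

text \<open>The Gram matrix of the columns t, b and t x b decides orthogonality. The third column is
  orthogonal to the others by construction, its length follows from Lagrange's identity, and the
  determinant equals |t x b|^2, hence is 1.\<close>

lemma rotation_matrix_frame_iff:
  "rotation_matrix (frame t b) \<longleftrightarrow> norm t = 1 \<and> norm b = 1 \<and> t \<bullet> b = 0"
proof -
  have comp: "frame t b $ i $ 1 = t $ i" "frame t b $ i $ 2 = b $ i" "frame t b $ i $ 3 = cross3 t b $ i" for i
    by (simp_all add: frame_def)
  have g: "(transpose (frame t b) ** frame t b) $ 1 $ 1 = t \<bullet> t" "(transpose (frame t b) ** frame t b) $ 2 $ 2 = b \<bullet> b"
    "(transpose (frame t b) ** frame t b) $ 1 $ 2 = t \<bullet> b" "(transpose (frame t b) ** frame t b) $ 2 $ 1 = t \<bullet> b"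
    "(transpose (frame t b) ** frame t b) $ 1 $ 3 = t \<bullet> cross3 t b" "(transpose (frame t b) ** frame t b) $ 3 $ 1 = t \<bullet> cross3 t b"
    "(transpose (frame t b) ** frame t b) $ 2 $ 3 = b \<bullet> cross3 t b" "(transpose (frame t b) ** frame t b) $ 3 $ 2 = b \<bullet> cross3 t b"
    "(transpose (frame t b) ** frame t b) $ 3 $ 3 = cross3 t b \<bullet> cross3 t b"
    by (simp_all add: matrix_matrix_mult_def transpose_def comp inner_vec_def inner_commute mult.commute)
  have lag: "cross3 t b \<bullet> cross3 t b = (t \<bullet> t) * (b \<bullet> b) - (t \<bullet> b)\<^sup>2"
    by (simp add: cross3_def inner_vec_def sum_3 power2_eq_square algebra_simps)
  have det: "det (frame t b) = cross3 t b \<bullet> cross3 t b"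
    unfolding det_3 comp by (simp add: cross3_def inner_vec_def sum_3 power2_eq_square algebra_simps)
  have n: "norm a = 1 \<longleftrightarrow> a \<bullet> a = 1" for a :: "real^3"
    by (simp add: norm_eq_sqrt_inner)
  show ?thesis
  proof
    assume "rotation_matrix (frame t b)"
    then have "transpose (frame t b) ** frame t b = mat 1"
      by (simp add: rotation_matrix_def orthogonal_matrix)
    then show "norm t = 1 \<and> norm b = 1 \<and> t \<bullet> b = 0"
      using g(1,2,3) unfolding n by (simp add: mat_def)
  next
    assume A: "norm t = 1 \<and> norm b = 1 \<and> t \<bullet> b = 0"
    have z: "t \<bullet> cross3 t b = 0" "b \<bullet> cross3 t b = 0" by (simp_all add: dot_cross_self)
    have "transpose (frame t b) ** frame t b = mat 1"
      using A unfolding n by (simp add: vec_eq_iff forall_3 g lag z mat_def)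
    then show "rotation_matrix (frame t b)"
      using A unfolding n by (simp add: rotation_matrix_def orthogonal_matrix det lag)
  qed
qed

text \<open>Continuity of y' and b upgrades the almost everywhere condition to every point of [0,L].
  The interpolant needs this, since its constraints sit at individual nodes.\<close>

lemma A_frame_iff:
  assumes L: "0 < L"
  shows "v \<in> A_frame L Lbc lbc \<longleftrightarrow> v \<in> V L \<and> Lbc v = lbc \<and>
     (\<forall>x\<in>{0..L}. norm (dy L v x) = 1 \<and> norm (snd v x) = 1 \<and> dy L v x \<bullet> snd v x = 0)"
proof
  assume A: "v \<in> A_frame L Lbc lbc"
  then have vV: "v \<in> V L" and ae: "AE x in I0 L. norm (dy L v x) = 1 \<and> norm (snd v x) = 1 \<and> dy L v x \<bullet> snd v x = 0"
    and "Lbc v = lbc"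
    by (auto simp: A_frame_def rotation_matrix_frame_iff)
  note c = H1_square_integrable(3)[OF V_D(2)[OF vV]] H1_square_integrable(3)[OF V_D(3)[OF vV]]
  have "norm (dy L v x) - 1 = 0" if "x \<in> {0..L}" for x
    by (rule continuous_AE_eq_0[OF _ L _ that])
       (intro continuous_on_diff continuous_on_norm continuous_on_const c, use ae in \<open>auto elim: eventually_mono\<close>)
  moreover have "norm (snd v x) - 1 = 0" if "x \<in> {0..L}" for x
    by (rule continuous_AE_eq_0[OF _ L _ that])
       (intro continuous_on_diff continuous_on_norm continuous_on_const c, use ae in \<open>auto elim: eventually_mono\<close>)
  moreover have "dy L v x \<bullet> snd v x = 0" if "x \<in> {0..L}" for x
    by (rule continuous_AE_eq_0[OF continuous_on_inner[OF c] L _ that]) (use ae in \<open>auto elim: eventually_mono\<close>)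
  ultimately show "v \<in> V L \<and> Lbc v = lbc \<and>
     (\<forall>x\<in>{0..L}. norm (dy L v x) = 1 \<and> norm (snd v x) = 1 \<and> dy L v x \<bullet> snd v x = 0)"
    using vV \<open>Lbc v = lbc\<close> by simp
next
  assume A: "v \<in> V L \<and> Lbc v = lbc \<and>
     (\<forall>x\<in>{0..L}. norm (dy L v x) = 1 \<and> norm (snd v x) = 1 \<and> dy L v x \<bullet> snd v x = 0)"
  have "AE x in I0 L. norm (dy L v x) = 1 \<and> norm (snd v x) = 1 \<and> dy L v x \<bullet> snd v x = 0"
    by (rule AE_I2) (use A in auto)
  then show "v \<in> A_frame L Lbc lbc"
    using A by (simp add: A_frame_def rotation_matrix_frame_iff case_prod_beta)
qed

section \<open>The lower bound\<close>

lemma partition_node_close: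
  assumes X: "partition L N X" and x: "x \<in> {0..L}"
  shows "\<exists>j\<le>N. \<bar>x - X j\<bar> \<le> mesh_size N X \<and> \<bar>x - X j\<bar> \<le> L \<and> X j \<in> {0..L}"
proof -
  obtain j where j: "j < N" "x \<in> {X j..X (Suc j)}" using partition_closed_elem[OF X x] by blast
  have "\<bar>x - X j\<bar> \<le> mesh_size N X" using partition_mesh[OF X j(1)] j(2) by simp
  moreover have "X j \<in> {0..L}" using partition_range[OF X, of j] j(1) by simp
  ultimately show ?thesis using j(1) x by (intro exI[of _ j]) auto
qed

text \<open>Every point has a node within the mesh size, where the length is exactly 1. The first
  bound makes the constraint exact in the limit; the second is uniform in the mesh and serves as a
  dominating constant.\<close>

lemma H1_nodal_unit_close:
  assumes X: "partition L N X" and u: "has_H1_derivative L u g" and g: "L2sq L g \<le> C"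
    and one: "\<And>j. j \<le> N \<Longrightarrow> norm (u (X j)) = 1" and x: "x \<in> {0..L}"
  shows "\<bar>norm (u x) - 1\<bar> \<le> sqrt (mesh_size N X) * sqrt C" "norm (u x) \<le> 1 + sqrt L * sqrt C"
proof -
  obtain j where j: "j \<le> N" "\<bar>x - X j\<bar> \<le> mesh_size N X" "\<bar>x - X j\<bar> \<le> L" "X j \<in> {0..L}"
    using partition_node_close[OF X x] by blast
  have "norm (u x - u (X j)) \<le> sqrt \<bar>x - X j\<bar> * sqrt (L2sq L g)"
    by (rule H1_holder_global[OF u j(4) x])
  moreover have "\<bar>norm (u x) - 1\<bar> \<le> norm (u x - u (X j))"
    using norm_triangle_ineq3[of "u x" "u (X j)"] one[OF j(1)] by simp
  ultimately have *: "\<bar>norm (u x) - 1\<bar> \<le> sqrt \<bar>x - X j\<bar> * sqrt (L2sq L g)" by linarith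
  also have "\<dots> \<le> sqrt (mesh_size N X) * sqrt C"
    using j g L2sq_nonneg[of L g] by (intro mult_mono) auto
  finally show "\<bar>norm (u x) - 1\<bar> \<le> sqrt (mesh_size N X) * sqrt C" .
  have "sqrt \<bar>x - X j\<bar> * sqrt (L2sq L g) \<le> sqrt L * sqrt C"
    using j g x L2sq_nonneg[of L g] by (intro mult_mono) auto
  then show "norm (u x) \<le> 1 + sqrt L * sqrt C" using * by linarith
qed

lemma nodal_unit_limit:
  assumes X: "\<And>n. partition L (N n) (X n)" and h: "(\<lambda>n. mesh_size (N n) (X n)) \<longlonglongrightarrow> 0"
    and u: "\<And>n. has_H1_derivative L (u n) (g n)" and g: "\<And>n. L2sq L (g n) \<le> C"
    and one: "\<And>n j. j \<le> N n \<Longrightarrow> norm (u n (X n j)) = 1" and x: "x \<in> {0..L}"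
    and lim: "(\<lambda>n. u n x) \<longlonglongrightarrow> l"
  shows "norm l = 1"
proof -
  have "(\<lambda>n. sqrt (mesh_size (N n) (X n)) * sqrt C) \<longlonglongrightarrow> sqrt 0 * sqrt C"
    by (intro tendsto_intros h)
  then have z: "(\<lambda>n. sqrt (mesh_size (N n) (X n)) * sqrt C) \<longlonglongrightarrow> 0" by simp
  have "(\<lambda>n. norm (u n x) - 1) \<longlonglongrightarrow> 0"
  proof (rule Lim_null_comparison[OF _ z], rule always_eventually, rule allI)
    fix n show "norm (norm (u n x) - 1) \<le> sqrt (mesh_size (N n) (X n)) * sqrt C"
      using H1_nodal_unit_close(1)[OF X u g one x] by simp
  qed
  moreover have "(\<lambda>n. norm (u n x) - 1) \<longlonglongrightarrow> norm l - 1" by (intro tendsto_intros lim)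
  ultimately have "norm l - 1 = 0" by (rule LIMSEQ_unique[rotated])
  then show ?thesis by simp
qed

text \<open>The tangent inequality at the limit, integrated: the linear corrections pair the weakly
  null differences with fixed L^2 functions. Producing a convergent minorant q instead of a liminf
  lets the contributions be added by ordinary limit rules.\<close>

lemma Qlim_weak_lower_bound:
  assumes A: "square_integrable L A" and B: "square_integrable L B"
    and A': "\<And>n. square_integrable L (A' n)" and B': "\<And>n. square_integrable L (B' n)"
    and wA: "\<And>g. square_integrable L g \<Longrightarrow> (\<lambda>n. LINT x|I0 L. A' n x \<bullet> g x) \<longlonglongrightarrow> (LINT x|I0 L. A x \<bullet> g x)"
    and wB: "\<And>g. square_integrable L g \<Longrightarrow> (\<lambda>n. LINT x|I0 L. B' n x \<bullet> g x) \<longlonglongrightarrow> (LINT x|I0 L. B x \<bullet> g x)"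
  shows "\<exists>q. q \<longlonglongrightarrow> (LINT x|I0 L. Qlim (A x) (B x)) \<and> (\<forall>n. q n \<le> (LINT x|I0 L. Qlim (A' n x) (B' n x)))"
proof -
  define t where "t x = Qslope (A x) (B x)" for x
  define S where "S x = (2 * (1 - (t x)\<^sup>2)) *\<^sub>R A x" for x
  define T where "T x = (4 * (1 + t x)) *\<^sub>R B x" for x
  have t01: "0 \<le> t x" "t x \<le> 1" for x using Qslope_bounds by (simp_all add: t_def)
  have t2: "(t x)\<^sup>2 \<le> 1" for x using t01[of x] by (simp add: power_le_one)
  have tm: "t \<in> borel_measurable (I0 L)"
    unfolding t_def[abs_def] by (rule Qslope_measurable[OF square_integrable_measurable[OF A] square_integrable_measurable[OF B]])
  have S: "square_integrable L S" unfolding S_def[abs_def]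
  proof (rule square_integrable_bounded_scaleR[OF A, where B = 2])
    show "(\<lambda>x. 2 * (1 - (t x)\<^sup>2)) \<in> borel_measurable (I0 L)"
      using tm by (intro borel_measurable_times borel_measurable_diff borel_measurable_power borel_measurable_const)
    show "\<bar>2 * (1 - (t x)\<^sup>2)\<bar> \<le> 2" for x using t2[of x] by simp
  qed
  have T: "square_integrable L T" unfolding T_def[abs_def]
  proof (rule square_integrable_bounded_scaleR[OF B, where B = 8])
    show "(\<lambda>x. 4 * (1 + t x)) \<in> borel_measurable (I0 L)"
      using tm by (intro borel_measurable_times borel_measurable_add borel_measurable_const)
    show "\<bar>4 * (1 + t x)\<bar> \<le> 8" for x using t01[of x] by simp
  qed
  define q where "q n = (LINT x|I0 L. Qlim (A x) (B x)) + (LINT x|I0 L. (A' n x - A x) \<bullet> S x) + (LINT x|I0 L. (B' n x - B x) \<bullet> T x)" for n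
  have split: "(LINT x|I0 L. (f x - g x) \<bullet> k x) = (LINT x|I0 L. f x \<bullet> k x) - (LINT x|I0 L. g x \<bullet> k x)"
    if "square_integrable L f" "square_integrable L g" "square_integrable L k" for f g k
    unfolding inner_diff_left by (rule LINT_minus[OF square_integrable_inner[OF that(1,3)] square_integrable_inner[OF that(2,3)]])
  have "q \<longlonglongrightarrow> (LINT x|I0 L. Qlim (A x) (B x)) + ((LINT x|I0 L. A x \<bullet> S x) - (LINT x|I0 L. A x \<bullet> S x)) +
      ((LINT x|I0 L. B x \<bullet> T x) - (LINT x|I0 L. B x \<bullet> T x))"
    unfolding q_def split[OF A' A S] split[OF B' B T]
    by (intro tendsto_add tendsto_diff tendsto_const wA[OF S] wB[OF T])
  then have "q \<longlonglongrightarrow> (LINT x|I0 L. Qlim (A x) (B x))" by simp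
  moreover have "q n \<le> (LINT x|I0 L. Qlim (A' n x) (B' n x))" for n
  proof -
    note i = Qlim_integrable[OF A B] square_integrable_inner[OF square_integrable_diff[OF A' A] S, of n]
      square_integrable_inner[OF square_integrable_diff[OF B' B] T, of n]
    have "q n = (LINT x|I0 L. Qlim (A x) (B x) + (A' n x - A x) \<bullet> S x) + (LINT x|I0 L. (B' n x - B x) \<bullet> T x)"
      unfolding q_def LINT_plus[OF i(1,2)] ..
    also have "\<dots> = (LINT x|I0 L. Qlim (A x) (B x) + (A' n x - A x) \<bullet> S x + (B' n x - B x) \<bullet> T x)"
      by (rule LINT_plus[OF integrable_plus[OF i(1,2)] i(3), symmetric])
    also have "\<dots> \<le> (LINT x|I0 L. Qlim (A' n x) (B' n x))"
    proof (rule integral_mono[OF integrable_plus[OF integrable_plus[OF i(1,2)] i(3)] Qlim_integrable[OF A' B']])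
      fix x
      show "Qlim (A x) (B x) + (A' n x - A x) \<bullet> S x + (B' n x - B x) \<bullet> T x \<le> Qlim (A' n x) (B' n x)"
        using Qlim_convex[of "A x" "B x" "A' n x" "B' n x"]
        by (simp add: S_def T_def t_def inner_commute)
    qed
    finally show ?thesis .
  qed
  ultimately show ?thesis by blast
qed

text \<open>With g = D.B from the limit, (D'.B')^2 >= 2 g (D'.B') - g^2. The right side is linear in
  the weakly convergent B', tested with g D', which converges strongly to g D because D' is bounded
  and converges pointwise.\<close>

lemma coupling_weak_lower_bound:
  assumes D: "continuous_on {0..L} D" and D': "\<And>n. continuous_on {0..L} (D' n)"
    and B: "square_integrable L B" and B': "\<And>n. square_integrable L (B' n)" and C: "\<And>n. L2sq L (B' n) \<le> C"
    and K: "\<And>n x. x \<in> {0<..<L} \<Longrightarrow> norm (D' n x) \<le> K"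
    and pw: "\<And>x. x \<in> {0<..<L} \<Longrightarrow> (\<lambda>n. D' n x) \<longlonglongrightarrow> D x"
    and wB: "\<And>g. square_integrable L g \<Longrightarrow> (\<lambda>n. LINT x|I0 L. B' n x \<bullet> g x) \<longlonglongrightarrow> (LINT x|I0 L. B x \<bullet> g x)"
  shows "\<exists>q. q \<longlonglongrightarrow> (LINT x|I0 L. (D x \<bullet> B x)\<^sup>2) \<and> (\<forall>n. q n \<le> (LINT x|I0 L. (D' n x \<bullet> B' n x)\<^sup>2))"
proof -
  define g where "g x = D x \<bullet> B x" for x
  have gi: "integrable (I0 L) (\<lambda>x. (g x)\<^sup>2)"
    unfolding g_def by (rule L2_inner_bounded_integrable[OF D B])
  have gm: "g \<in> borel_measurable (I0 L)"
    unfolding g_def[abs_def] by (intro borel_measurable_inner continuous_measurable_I0 D square_integrable_measurable B)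
  \<comment> \<open>The test functions g u are square integrable since u is bounded and g, a bounded
    function paired with B, lies in L^2.\<close>
  have gu: "square_integrable L (\<lambda>x. g x *\<^sub>R u x)" if u: "continuous_on {0..L} u" for u
  proof -
    obtain M where M: "\<forall>x\<in>{0..L}. norm (u x) \<le> M" using continuous_on_Icc_bounded[OF u] by blast
    show ?thesis
    proof (rule square_integrable_bound[OF _ integrable_mult_right[OF gi, of "M\<^sup>2"]])
      show "(\<lambda>x. g x *\<^sub>R u x) \<in> borel_measurable (I0 L)"
        by (intro borel_measurable_scaleR gm continuous_measurable_I0 u)
      show "(norm (g x *\<^sub>R u x))\<^sup>2 \<le> M\<^sup>2 * (g x)\<^sup>2" if "x \<in> {0<..<L}" for x
      proof -
        have "(norm (u x))\<^sup>2 \<le> M\<^sup>2" using M that by (intro power_mono) auto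
        then show ?thesis by (simp add: power_mult_distrib mult.commute[of "(g x)\<^sup>2"] mult_right_mono)
      qed
    qed
  qed
  have cd: "continuous_on {0..L} (\<lambda>x. D' n x - D x)" for n by (rule continuous_on_diff[OF D' D])
  \<comment> \<open>The pointwise limit inherits the bound; together they give 2K for the difference
    and hence the dominating function.\<close>
  have K': "norm (D x) \<le> K" if "x \<in> {0<..<L}" for x
    by (rule LIMSEQ_le_const2[OF tendsto_norm[OF pw[OF that]]]) (use K[OF that] in blast)
  have "(\<lambda>n. L2sq L (\<lambda>x. g x *\<^sub>R (D' n x - D x))) \<longlonglongrightarrow> (LINT x|I0 L. 0)"
    unfolding L2sq_def
  proof (rule integral_dominated_convergence)
    show "(\<lambda>x. (norm (g x *\<^sub>R (D' n x - D x)))\<^sup>2) \<in> borel_measurable (I0 L)" for n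
      by (rule borel_measurable_integrable[OF square_integrableD[OF gu[OF cd]]])
    show "integrable (I0 L) (\<lambda>x. (2 * K)\<^sup>2 * (g x)\<^sup>2)" by (rule integrable_mult_right[OF gi])
    show "AE x in I0 L. (\<lambda>n. (norm (g x *\<^sub>R (D' n x - D x)))\<^sup>2) \<longlonglongrightarrow> 0"
    proof (rule AE_I2)
      fix x assume "x \<in> space (I0 L)"
      then have "x \<in> {0<..<L}" by simp
      then have "(\<lambda>n. (norm (g x *\<^sub>R (D' n x - D x)))\<^sup>2) \<longlonglongrightarrow> (norm (g x *\<^sub>R (D x - D x)))\<^sup>2"
        by (intro tendsto_power tendsto_norm tendsto_scaleR tendsto_diff tendsto_const pw)
      then show "(\<lambda>n. (norm (g x *\<^sub>R (D' n x - D x)))\<^sup>2) \<longlonglongrightarrow> 0" by simp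
    qed
    show "AE x in I0 L. norm ((norm (g x *\<^sub>R (D' n x - D x)))\<^sup>2) \<le> (2 * K)\<^sup>2 * (g x)\<^sup>2" for n
    proof (rule AE_I2)
      fix x assume "x \<in> space (I0 L)"
      then have x: "x \<in> {0<..<L}" by simp
      have "norm (D' n x - D x) \<le> 2 * K"
        using norm_triangle_ineq4[of "D' n x" "D x"] K[OF x, of n] K'[OF x] by simp
      then have "(norm (D' n x - D x))\<^sup>2 \<le> (2 * K)\<^sup>2" by (rule power_mono) simp
      then have "(g x)\<^sup>2 * (norm (D' n x - D x))\<^sup>2 \<le> (g x)\<^sup>2 * (2 * K)\<^sup>2" by (rule mult_left_mono) simp
      then show "norm ((norm (g x *\<^sub>R (D' n x - D x)))\<^sup>2) \<le> (2 * K)\<^sup>2 * (g x)\<^sup>2"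
        by (simp only: norm_scaleR power_mult_distrib power2_abs real_norm_def abs_mult abs_power2 mult.commute)
    qed
  qed simp
  then have "(\<lambda>n. sqrt C * sqrt (L2sq L (\<lambda>x. g x *\<^sub>R (D' n x - D x)))) \<longlonglongrightarrow> sqrt C * sqrt 0"
    by (intro tendsto_intros) simp
  then have z: "(\<lambda>n. sqrt C * sqrt (L2sq L (\<lambda>x. g x *\<^sub>R (D' n x - D x)))) \<longlonglongrightarrow> 0" by simp
  have r0: "(\<lambda>n. LINT x|I0 L. B' n x \<bullet> (g x *\<^sub>R (D' n x - D x))) \<longlonglongrightarrow> 0"
  proof (rule Lim_null_comparison[OF _ z], rule always_eventually, rule allI)
    fix n
    have "norm (LINT x|I0 L. B' n x \<bullet> (g x *\<^sub>R (D' n x - D x))) \<le> sqrt (L2sq L (B' n)) * sqrt (L2sq L (\<lambda>x. g x *\<^sub>R (D' n x - D x)))"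
      unfolding real_norm_def by (rule L2_inner_le[OF B' gu[OF cd]])
    also have "\<dots> \<le> sqrt C * sqrt (L2sq L (\<lambda>x. g x *\<^sub>R (D' n x - D x)))"
      using C[of n] by (intro mult_right_mono) (auto simp: L2sq_nonneg)
    finally show "norm (LINT x|I0 L. B' n x \<bullet> (g x *\<^sub>R (D' n x - D x))) \<le> sqrt C * sqrt (L2sq L (\<lambda>x. g x *\<^sub>R (D' n x - D x)))" .
  qed
  define r where "r n = (LINT x|I0 L. B' n x \<bullet> (g x *\<^sub>R D' n x))" for n
  have r_eq: "r n = (LINT x|I0 L. B' n x \<bullet> (g x *\<^sub>R D x)) + (LINT x|I0 L. B' n x \<bullet> (g x *\<^sub>R (D' n x - D x)))" for n
  proof -
    have "r n = (LINT x|I0 L. B' n x \<bullet> (g x *\<^sub>R D x) + B' n x \<bullet> (g x *\<^sub>R (D' n x - D x)))"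
      unfolding r_def by (rule LINT_cong) (auto simp: algebra_simps inner_diff_right)
    also have "\<dots> = (LINT x|I0 L. B' n x \<bullet> (g x *\<^sub>R D x)) + (LINT x|I0 L. B' n x \<bullet> (g x *\<^sub>R (D' n x - D x)))"
      by (rule LINT_plus[OF square_integrable_inner[OF B' gu[OF D]] square_integrable_inner[OF B' gu[OF cd]]])
    finally show ?thesis .
  qed
  have "r \<longlonglongrightarrow> (LINT x|I0 L. B x \<bullet> (g x *\<^sub>R D x)) + 0"
    unfolding r_eq by (intro tendsto_add wB gu D r0)
  moreover have "(LINT x|I0 L. B x \<bullet> (g x *\<^sub>R D x)) = (LINT x|I0 L. (g x)\<^sup>2)"
    by (rule LINT_cong) (auto simp: g_def power2_eq_square inner_commute)
  ultimately have r: "r \<longlonglongrightarrow> (LINT x|I0 L. (g x)\<^sup>2)" by simp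
  define q where "q n = 2 * r n - (LINT x|I0 L. (g x)\<^sup>2)" for n
  have "q \<longlonglongrightarrow> 2 * (LINT x|I0 L. (g x)\<^sup>2) - (LINT x|I0 L. (g x)\<^sup>2)"
    unfolding q_def by (intro tendsto_intros r)
  then have "q \<longlonglongrightarrow> (LINT x|I0 L. (D x \<bullet> B x)\<^sup>2)" by (simp add: g_def)
  moreover have "q n \<le> (LINT x|I0 L. (D' n x \<bullet> B' n x)\<^sup>2)" for n
  proof -
    note i = integrable_mult_right[OF square_integrable_inner[OF B' gu[OF D']], of 2 n n]
    have "q n = (LINT x|I0 L. 2 * (B' n x \<bullet> (g x *\<^sub>R D' n x)) - (g x)\<^sup>2)"
      unfolding q_def r_def LINT_minus[OF i gi] integral_mult_right_zero ..
    also have "\<dots> \<le> (LINT x|I0 L. (D' n x \<bullet> B' n x)\<^sup>2)"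
    proof (rule integral_mono[OF integrable_minus_fun[OF i gi] L2_inner_bounded_integrable[OF D' B']])
      fix x
      show "2 * (B' n x \<bullet> (g x *\<^sub>R D' n x)) - (g x)\<^sup>2 \<le> (D' n x \<bullet> B' n x)\<^sup>2"
        using sum_squares_bound[of "g x" "D' n x \<bullet> B' n x"] by (simp add: inner_commute mult.assoc)
    qed
    finally show ?thesis .
  qed
  ultimately show ?thesis by blast
qed

text \<open>Bounded pointwise convergence passes the penalty integral to the limit, where it is the
  integral of a continuous nonnegative function and equals 0.\<close>

lemma orthogonality_limit:
  assumes D: "continuous_on {0..L} D" and D': "\<And>n. continuous_on {0..L} (D' n)"
    and b: "continuous_on {0..L} b" and b': "\<And>n. continuous_on {0..L} (b' n)"
    and K: "\<And>n x. x \<in> {0<..<L} \<Longrightarrow> norm (D' n x) \<le> K" "\<And>n x. x \<in> {0<..<L} \<Longrightarrow> norm (b' n x) \<le> K"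
    and pw: "\<And>x. x \<in> {0<..<L} \<Longrightarrow> (\<lambda>n. D' n x) \<longlonglongrightarrow> D x" "\<And>x. x \<in> {0<..<L} \<Longrightarrow> (\<lambda>n. b' n x) \<longlonglongrightarrow> b x"
    and z: "(\<lambda>n. LINT x|I0 L. (D' n x \<bullet> b' n x)\<^sup>2) \<longlonglongrightarrow> 0" and L: "0 < L" and x: "x \<in> {0..L}"
  shows "D x \<bullet> b x = 0"
proof -
  have c: "continuous_on {0..L} (\<lambda>x. (D x \<bullet> b x)\<^sup>2)" by (intro continuous_on_power continuous_on_inner D b)
  have c': "continuous_on {0..L} (\<lambda>x. (D' n x \<bullet> b' n x)\<^sup>2)" for n by (intro continuous_on_power continuous_on_inner D' b')
  have "(\<lambda>n. LINT x|I0 L. (D' n x \<bullet> b' n x)\<^sup>2) \<longlonglongrightarrow> (LINT x|I0 L. (D x \<bullet> b x)\<^sup>2)"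
  proof (rule integral_dominated_convergence)
    show "(\<lambda>x. (D x \<bullet> b x)\<^sup>2) \<in> borel_measurable (I0 L)" by (rule continuous_measurable_I0[OF c])
    show "(\<lambda>x. (D' n x \<bullet> b' n x)\<^sup>2) \<in> borel_measurable (I0 L)" for n by (rule continuous_measurable_I0[OF c'])
    show "integrable (I0 L) (\<lambda>x. (K * K)\<^sup>2)" by (rule integrable_I0_const)
    show "AE x in I0 L. (\<lambda>n. (D' n x \<bullet> b' n x)\<^sup>2) \<longlonglongrightarrow> (D x \<bullet> b x)\<^sup>2"
      by (rule AE_I2) (intro tendsto_power tendsto_inner pw, simp_all)
    show "AE x in I0 L. norm ((D' n x \<bullet> b' n x)\<^sup>2) \<le> (K * K)\<^sup>2" for n
    proof (rule AE_I2)
      fix x assume "x \<in> space (I0 L)"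
      then have x: "x \<in> {0<..<L}" by simp
      have "\<bar>D' n x \<bullet> b' n x\<bar> \<le> norm (D' n x) * norm (b' n x)" by (rule Cauchy_Schwarz_ineq2)
      also have "\<dots> \<le> K * K"
        using K[OF x, of n] by (intro mult_mono) (auto intro: order_trans[OF norm_ge_zero])
      finally have "\<bar>D' n x \<bullet> b' n x\<bar>\<^sup>2 \<le> (K * K)\<^sup>2" by (rule power_mono) simp
      then show "norm ((D' n x \<bullet> b' n x)\<^sup>2) \<le> (K * K)\<^sup>2" by simp
    qed
  qed
  then have "(LINT x|I0 L. (D x \<bullet> b x)\<^sup>2) = 0" using z by (rule LIMSEQ_unique)
  then have "AE x in I0 L. (D x \<bullet> b x)\<^sup>2 = 0"
    using integral_nonneg_eq_0_iff_AE[OF integrable_I0_continuous[OF c]] by simp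
  then have "(D x \<bullet> b x)\<^sup>2 = 0" by (rule continuous_AE_eq_0[OF c L _ x])
  then show ?thesis by simp
qed

text \<open>Stated for a fixed real energy level c along a sequence. A finite bound supplies both
  admissibility of every term and the derivative bounds; the conclusion in turn contains the
  admissibility of the limit, since otherwise its energy would be infinite.\<close>

lemma liminf_sequence:
  fixes Lbc :: "conf \<Rightarrow> 'w::real_normed_vector" and w :: "nat \<Rightarrow> conf"
  assumes L: "0 < L" and e2: "0 < \<epsilon>2" and B: "boundary_operator L Lbc"
    and m: "regularized_modulus c0 c1 c2 cuni m"
    and v: "v \<in> V L" and w: "\<And>n. w n \<in> V L" and conv: "weakly_convergent_V L w v sequentially"
    and X: "\<And>n. partition L (N n) (X n)" and h: "(\<lambda>n. mesh_size (N n) (X n)) \<longlonglongrightarrow> 0"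
    and d: "\<And>n. 0 < \<delta> n" "\<delta> \<longlonglongrightarrow> 0" and e1: "\<And>n. 0 < \<epsilon>1 n" "\<epsilon>1 \<longlonglongrightarrow> 0"
    and E: "\<And>n. E_discrete L Lbc lbc m (\<delta> n) (\<epsilon>1 n) \<epsilon>2 (N n) (X n) (w n) \<le> ennreal c" and c: "0 \<le> c"
  shows "E_limit L Lbc lbc \<epsilon>2 v \<le> ennreal c"
proof -
  \<comment> \<open>The functional is infinite off the admissible set, so the bound c excludes that
    case.\<close>
  have adm: "w n \<in> discrete_admissible L Lbc lbc (N n) (X n)" for n
  proof (rule ccontr)
    assume "w n \<notin> discrete_admissible L Lbc lbc (N n) (X n)"
    then have "E_discrete L Lbc lbc m (\<delta> n) (\<epsilon>1 n) \<epsilon>2 (N n) (X n) (w n) = \<infinity>"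
      by (simp add: E_discrete_def case_prod_beta)
    then show False using E[of n] by (simp add: top_unique)
  qed
  have node: "norm (dy L (w n) (X n j)) = 1" "norm (snd (w n) (X n j)) = 1" if "j \<le> N n" for n j
    using adm[of n] that by (auto simp: discrete_admissible_def)
  have lbc: "Lbc (w n) = lbc" for n using adm[of n] by (auto simp: discrete_admissible_def)
  have en: "discrete_energy L m (\<delta> n) (\<epsilon>1 n) \<epsilon>2 (w n) \<le> c" for n
    using E[of n] unfolding E_discrete_eq[OF adm e1(1) e2 m d(1)] by (simp add: c)
  note dw = V_D[OF w] and dv = V_D[OF v] and wl = weakly_convergent_V_D[OF conv L]
  note A = H1_square_integrable(2)[OF dw(2)] and Bp = H1_square_integrable(2)[OF dw(3)]
  note cD = H1_square_integrable(3)[OF dw(2)] and cb = H1_square_integrable(3)[OF dw(3)]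
  define I1 I2 I3 where "I1 n = (LINT x|I0 L. Qreg m (\<delta> n) (ddy L (w n) x) (db L (w n) x))"
    and "I2 n = (LINT x|I0 L. (dy L (w n) x \<bullet> snd (w n) x)\<^sup>2)"
    and "I3 n = (LINT x|I0 L. (dy L (w n) x \<bullet> db L (w n) x)\<^sup>2)" for n
  have en': "I1 n + 1 / (2 * \<epsilon>1 n) * I2 n + 1 / (2 * \<epsilon>2) * I3 n \<le> c" for n
    using en[of n] unfolding discrete_energy_def I1_def I2_def I3_def .
  have I23: "0 \<le> I2 n" "0 \<le> I3 n" for n by (simp_all add: I2_def I3_def)
  have p23: "0 \<le> 1 / (2 * \<epsilon>1 n) * I2 n" "0 \<le> 1 / (2 * \<epsilon>2) * I3 n" for n
    using I23[of n] e1(1)[of n] e2 by simp_all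
  \<comment> \<open>Coercivity: \<open>psi\<close> is nonnegative, so the density controls both
    squared norms with the factor 1/2.\<close>
  have L2: "L2sq L (ddy L (w n)) + L2sq L (db L (w n)) \<le> 2 * I1 n" for n
  proof -
    note i = square_integrableD[OF A[of n]] square_integrableD[OF Bp[of n]]
    have "1/2 * (L2sq L (ddy L (w n)) + L2sq L (db L (w n))) =
      (LINT x|I0 L. 1/2 * ((norm (ddy L (w n) x))\<^sup>2 + (norm (db L (w n) x))\<^sup>2))"
      unfolding L2sq_def integral_mult_right_zero LINT_plus[OF i] ..
    also have "\<dots> \<le> I1 n"
      unfolding I1_def
      by (rule integral_mono[OF integrable_mult_right[OF integrable_plus[OF i]]
            Qreg_integrable[OF m d(1) A Bp]]) (rule Qreg_ge[OF m d(1)])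
    finally show ?thesis by simp
  qed
  have I1: "0 \<le> I1 n" "I1 n \<le> c" for n
    using L2[of n] L2sq_nonneg[of L "ddy L (w n)"] L2sq_nonneg[of L "db L (w n)"] en'[of n] p23[of n]
    by linarith+
  have C: "L2sq L (ddy L (w n)) \<le> 2 * c" "L2sq L (db L (w n)) \<le> 2 * c" for n
    using L2[of n] I1[of n] L2sq_nonneg[of L "ddy L (w n)"] L2sq_nonneg[of L "db L (w n)"]
    by linarith+
  define K where "K = 1 + sqrt L * sqrt (2 * c)"
  have K: "norm (dy L (w n) x) \<le> K" "norm (snd (w n) x) \<le> K" if "x \<in> {0<..<L}" for n x
    unfolding K_def
    using H1_nodal_unit_close(2)[OF X dw(2) C(1) node(1), of n x] H1_nodal_unit_close(2)[OF X dw(3) C(2) node(2), of n x] that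
    by simp_all
  have pw: "(\<lambda>n. dy L (w n) x) \<longlonglongrightarrow> dy L v x" "(\<lambda>n. snd (w n) x) \<longlonglongrightarrow> snd v x" if "x \<in> {0<..<L}" for x
    using wl(4)[of x] wl(5)[of x] that by simp_all
  have unit: "norm (dy L v x) = 1" "norm (snd v x) = 1" if "x \<in> {0..L}" for x
    using nodal_unit_limit[OF X h dw(2) C(1) node(1) that wl(4)[OF that]]
      nodal_unit_limit[OF X h dw(3) C(2) node(2) that wl(5)[OF that]] by simp_all
  \<comment> \<open>The penalty is bounded by c, so its integral is at most 2 c \<epsilon>1, which
    vanishes.\<close>
  have z: "I2 \<longlonglongrightarrow> 0"
  proof (rule tendsto_sandwich[OF always_eventually always_eventually tendsto_const])
    show "\<forall>n. 0 \<le> I2 n" using I23 by simp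
    show "\<forall>n. I2 n \<le> 2 * c * \<epsilon>1 n"
    proof
      fix n
      have "1 / (2 * \<epsilon>1 n) * I2 n \<le> c" using en'[of n] I1[of n] p23[of n] by linarith
      then show "I2 n \<le> 2 * c * \<epsilon>1 n" using e1(1)[of n] by (simp add: field_simps)
    qed
    show "(\<lambda>n. 2 * c * \<epsilon>1 n) \<longlonglongrightarrow> 0" by (rule tendsto_mult_right_zero[OF e1(2)])
  qed
  have orth: "dy L v x \<bullet> snd v x = 0" if "x \<in> {0..L}" for x
    by (rule orthogonality_limit[OF H1_square_integrable(3)[OF dv(2)] cD H1_square_integrable(3)[OF dv(3)] cb K pw
          z[unfolded I2_def[abs_def]] L that])
  have "(\<lambda>n. Lbc (w n)) \<longlonglongrightarrow> Lbc v" by (rule boundary_operator_weakly_continuous[OF B L w v conv])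
  then have "Lbc v = lbc" unfolding lbc by (rule LIMSEQ_unique[OF _ tendsto_const])
  then have fr: "v \<in> A_frame L Lbc lbc" using A_frame_iff[OF L] v unit orth by blast
  obtain q where q: "q \<longlonglongrightarrow> (LINT x|I0 L. Qlim (ddy L v x) (db L v x))"
      "\<And>n. q n \<le> (LINT x|I0 L. Qlim (ddy L (w n) x) (db L (w n) x))"
    using Qlim_weak_lower_bound[OF H1_square_integrable(2)[OF dv(2)] H1_square_integrable(2)[OF dv(3)] A Bp wl(1,2)] by blast
  obtain p where p: "p \<longlonglongrightarrow> (LINT x|I0 L. (dy L v x \<bullet> db L v x)\<^sup>2)"
      "\<And>n. p n \<le> I3 n"
    using coupling_weak_lower_bound[OF H1_square_integrable(3)[OF dv(2)] cD H1_square_integrable(2)[OF dv(3)] Bp C(2) K(1) pw(1) wl(2)]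
    unfolding I3_def by blast
  \<comment> \<open>Sum of the two minorants, corrected by the uniform distance between regularized
    and limit density. The nonnegative \<epsilon>1 term is dropped.\<close>
  have lim: "(\<lambda>n. q n - 5/2 * (cuni * \<delta> n) * L + 1 / (2 * \<epsilon>2) * p n) \<longlonglongrightarrow>
      (LINT x|I0 L. Qlim (ddy L v x) (db L v x)) - 5/2 * (cuni * 0) * L +
      1 / (2 * \<epsilon>2) * (LINT x|I0 L. (dy L v x \<bullet> db L v x)\<^sup>2)"
    by (intro tendsto_add tendsto_diff tendsto_mult tendsto_const q(1) p(1) d(2))
  have "q n - 5/2 * (cuni * \<delta> n) * L + 1 / (2 * \<epsilon>2) * p n \<le> c" for n
  proof -
    have "\<bar>I1 n - (LINT x|I0 L. Qlim (ddy L (w n) x) (db L (w n) x))\<bar> \<le> 5/2 * (cuni * \<delta> n) * L"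
      unfolding I1_def by (rule LINT_Qreg_Qlim[OF m d(1) _ A Bp]) (use L in simp)
    then have "q n - 5/2 * (cuni * \<delta> n) * L \<le> I1 n" using q(2)[of n] by linarith
    moreover have "1 / (2 * \<epsilon>2) * p n \<le> 1 / (2 * \<epsilon>2) * I3 n" using p(2)[of n] e2 by (intro mult_left_mono) auto
    ultimately show ?thesis using en'[of n] p23(1)[of n] by linarith
  qed
  then have "limit_energy L \<epsilon>2 v \<le> c"
    using LIMSEQ_le_const2[OF lim] unfolding limit_energy_def by simp
  then show ?thesis unfolding E_limit_eq[OF fr e2] by (rule ennreal_leI)
qed

section \<open>Recovery sequences\<close>

lemma L2sq_diff_commute: "L2sq L (\<lambda>x. f x - g x) = L2sq L (\<lambda>x. g x - f x)"
  by (simp add: L2sq_def norm_minus_commute)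

text \<open>From |f|^2 - |g|^2 = |f - g|^2 + 2 g.(f - g). The difference is measured in L^1 because
  the density is compared through squared norms.\<close>

lemma LINT_norm_sq_diff_le:
  assumes f: "square_integrable L f" and g: "square_integrable L g"
  shows "(LINT x|I0 L. \<bar>(norm (f x))\<^sup>2 - (norm (g x))\<^sup>2\<bar>) \<le>
    L2sq L (\<lambda>x. f x - g x) + 2 * (sqrt (L2sq L g) * sqrt (L2sq L (\<lambda>x. f x - g x)))"
proof -
  note d = square_integrable_diff[OF f g]
  note i1 = square_integrableD[OF d] and i2 = integrable_mult_right[OF square_integrable_norm_mult[OF g d], of 2]
  have "(LINT x|I0 L. \<bar>(norm (f x))\<^sup>2 - (norm (g x))\<^sup>2\<bar>) \<le>
     (LINT x|I0 L. (norm (f x - g x))\<^sup>2 + 2 * (norm (g x) * norm (f x - g x)))"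
  proof (rule integral_mono)
    show "integrable (I0 L) (\<lambda>x. \<bar>(norm (f x))\<^sup>2 - (norm (g x))\<^sup>2\<bar>)"
      by (intro integrable_abs integrable_minus_fun square_integrableD f g)
    show "integrable (I0 L) (\<lambda>x. (norm (f x - g x))\<^sup>2 + 2 * (norm (g x) * norm (f x - g x)))"
      by (rule integrable_plus[OF i1 i2])
    fix x
    have "(norm (f x))\<^sup>2 - (norm (g x))\<^sup>2 = (norm (f x - g x))\<^sup>2 + 2 * (g x \<bullet> (f x - g x))"
      by (simp add: power2_norm_eq_inner inner_diff_left inner_diff_right inner_commute)
    moreover have "\<bar>g x \<bullet> (f x - g x)\<bar> \<le> norm (g x) * norm (f x - g x)" by (rule Cauchy_Schwarz_ineq2)
    moreover have "0 \<le> (norm (f x - g x))\<^sup>2" by simp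
    ultimately show "\<bar>(norm (f x))\<^sup>2 - (norm (g x))\<^sup>2\<bar> \<le> (norm (f x - g x))\<^sup>2 + 2 * (norm (g x) * norm (f x - g x))"
      by linarith
  qed
  also have "\<dots> = L2sq L (\<lambda>x. f x - g x) + 2 * (LINT x|I0 L. norm (g x) * norm (f x - g x))"
    unfolding LINT_plus[OF i1 i2] L2sq_def by simp
  finally show ?thesis using L2_Cauchy_Schwarz[OF g d] by linarith
qed

lemma LINT_norm_sq_diff_tendsto:
  assumes f: "\<And>i. square_integrable L (f i)" and g: "square_integrable L g"
    and lim: "((\<lambda>i. L2sq L (\<lambda>x. f i x - g x)) \<longlongrightarrow> 0) F"
  shows "((\<lambda>i. LINT x|I0 L. \<bar>(norm (f i x))\<^sup>2 - (norm (g x))\<^sup>2\<bar>) \<longlongrightarrow> 0) F"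
proof (rule tendsto_sandwich[OF always_eventually always_eventually tendsto_const])
  show "\<forall>i. 0 \<le> (LINT x|I0 L. \<bar>(norm (f i x))\<^sup>2 - (norm (g x))\<^sup>2\<bar>)" by simp
  show "\<forall>i. (LINT x|I0 L. \<bar>(norm (f i x))\<^sup>2 - (norm (g x))\<^sup>2\<bar>) \<le>
      L2sq L (\<lambda>x. f i x - g x) + 2 * (sqrt (L2sq L g) * sqrt (L2sq L (\<lambda>x. f i x - g x)))"
    by (intro allI LINT_norm_sq_diff_le f g)
  have "((\<lambda>i. L2sq L (\<lambda>x. f i x - g x) + 2 * (sqrt (L2sq L g) * sqrt (L2sq L (\<lambda>x. f i x - g x)))) \<longlongrightarrow>
     0 + 2 * (sqrt (L2sq L g) * sqrt 0)) F"
    by (intro tendsto_intros lim)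
  then show "((\<lambda>i. L2sq L (\<lambda>x. f i x - g x) + 2 * (sqrt (L2sq L g) * sqrt (L2sq L (\<lambda>x. f i x - g x)))) \<longlongrightarrow> 0) F"
    by simp
qed

lemma LINT_norm_sq_tendsto:
  assumes f: "\<And>i. square_integrable L (f i)" and g: "square_integrable L g"
    and lim: "((\<lambda>i. L2sq L (\<lambda>x. f i x - g x)) \<longlongrightarrow> 0) F"
  shows "((\<lambda>i. L2sq L (f i)) \<longlongrightarrow> L2sq L g) F"
proof -
  have "((\<lambda>i. L2sq L (f i) - L2sq L g) \<longlongrightarrow> 0) F"
  proof (rule Lim_null_comparison[OF _ LINT_norm_sq_diff_tendsto[OF f g lim]], rule always_eventually, rule allI)
    fix i
    have "L2sq L (f i) - L2sq L g = (LINT x|I0 L. (norm (f i x))\<^sup>2 - (norm (g x))\<^sup>2)"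
      unfolding L2sq_def by (rule LINT_minus[OF square_integrableD[OF f] square_integrableD[OF g], symmetric])
    then show "norm (L2sq L (f i) - L2sq L g) \<le> (LINT x|I0 L. \<bar>(norm (f i x))\<^sup>2 - (norm (g x))\<^sup>2\<bar>)"
      by (simp add: integral_abs_bound)
  qed
  then show ?thesis by (rule LIM_zero_cancel)
qed

lemma Qlim_strong_continuity:
  assumes A: "square_integrable L A" and B: "square_integrable L B"
    and A': "\<And>i. square_integrable L (A' i)" and B': "\<And>i. square_integrable L (B' i)"
    and lim: "((\<lambda>i. L2sq L (\<lambda>x. A' i x - A x)) \<longlongrightarrow> 0) F" "((\<lambda>i. L2sq L (\<lambda>x. B' i x - B x)) \<longlongrightarrow> 0) F"
  shows "((\<lambda>i. LINT x|I0 L. Qlim (A' i x) (B' i x)) \<longlongrightarrow> (LINT x|I0 L. Qlim (A x) (B x))) F"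
proof -
  have "((\<lambda>i. (LINT x|I0 L. \<bar>(norm (A' i x))\<^sup>2 - (norm (A x))\<^sup>2\<bar>) + 4 * (LINT x|I0 L. \<bar>(norm (B' i x))\<^sup>2 - (norm (B x))\<^sup>2\<bar>)) \<longlongrightarrow> 0 + 4 * 0) F"
    by (intro tendsto_add tendsto_mult tendsto_const LINT_norm_sq_diff_tendsto A B A' B' lim)
  then have z: "((\<lambda>i. (LINT x|I0 L. \<bar>(norm (A' i x))\<^sup>2 - (norm (A x))\<^sup>2\<bar>) + 4 * (LINT x|I0 L. \<bar>(norm (B' i x))\<^sup>2 - (norm (B x))\<^sup>2\<bar>)) \<longlongrightarrow> 0) F"
    by simp
  have "((\<lambda>i. (LINT x|I0 L. Qlim (A' i x) (B' i x)) - (LINT x|I0 L. Qlim (A x) (B x))) \<longlongrightarrow> 0) F"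
  proof (rule Lim_null_comparison[OF _ z], rule always_eventually, rule allI)
    fix i
    note q = Qlim_integrable[OF A' B', of i i] Qlim_integrable[OF A B]
    have i1: "integrable (I0 L) (\<lambda>x. \<bar>(norm (A' i x))\<^sup>2 - (norm (A x))\<^sup>2\<bar>)"
      by (intro integrable_abs integrable_minus_fun square_integrableD A A')
    have i2: "integrable (I0 L) (\<lambda>x. 4 * \<bar>(norm (B' i x))\<^sup>2 - (norm (B x))\<^sup>2\<bar>)"
      by (intro integrable_mult_right integrable_abs integrable_minus_fun square_integrableD B B')
    have "norm ((LINT x|I0 L. Qlim (A' i x) (B' i x)) - (LINT x|I0 L. Qlim (A x) (B x))) =
        \<bar>LINT x|I0 L. Qlim (A' i x) (B' i x) - Qlim (A x) (B x)\<bar>"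
      unfolding LINT_minus[OF q] by simp
    also have "\<dots> \<le> (LINT x|I0 L. \<bar>Qlim (A' i x) (B' i x) - Qlim (A x) (B x)\<bar>)" by (rule integral_abs_bound)
    also have "\<dots> \<le> (LINT x|I0 L. \<bar>(norm (A' i x))\<^sup>2 - (norm (A x))\<^sup>2\<bar> + 4 * \<bar>(norm (B' i x))\<^sup>2 - (norm (B x))\<^sup>2\<bar>)"
      by (rule integral_mono[OF integrable_abs[OF integrable_minus_fun[OF q]] integrable_plus[OF i1 i2]])
         (rule Qlim_diff_le)
    also have "\<dots> = (LINT x|I0 L. \<bar>(norm (A' i x))\<^sup>2 - (norm (A x))\<^sup>2\<bar>) + 4 * (LINT x|I0 L. \<bar>(norm (B' i x))\<^sup>2 - (norm (B x))\<^sup>2\<bar>)"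
      unfolding LINT_plus[OF i1 i2] integral_mult_right_zero ..
    finally show "norm ((LINT x|I0 L. Qlim (A' i x) (B' i x)) - (LINT x|I0 L. Qlim (A x) (B x))) \<le>
      (LINT x|I0 L. \<bar>(norm (A' i x))\<^sup>2 - (norm (A x))\<^sup>2\<bar>) + 4 * (LINT x|I0 L. \<bar>(norm (B' i x))\<^sup>2 - (norm (B x))\<^sup>2\<bar>)" .
  qed
  then show ?thesis by (rule LIM_zero_cancel)
qed

lemma LINT_inner_sq_le:
  assumes D: "continuous_on {0..L} D" and b: "square_integrable L b" and M: "\<And>x. x \<in> {0<..<L} \<Longrightarrow> norm (D x) \<le> M"
  shows "(LINT x|I0 L. (D x \<bullet> b x)\<^sup>2) \<le> M\<^sup>2 * L2sq L b"
proof -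
  have "(LINT x|I0 L. (D x \<bullet> b x)\<^sup>2) \<le> (LINT x|I0 L. M\<^sup>2 * (norm (b x))\<^sup>2)"
  proof (rule integral_mono[OF L2_inner_bounded_integrable[OF D b] integrable_mult_right[OF square_integrableD[OF b]]])
    fix x assume x: "x \<in> space (I0 L)"
    have "\<bar>D x \<bullet> b x\<bar> \<le> norm (D x) * norm (b x)" by (rule Cauchy_Schwarz_ineq2)
    also have "\<dots> \<le> M * norm (b x)" using M[of x] x by (intro mult_right_mono) auto
    finally have "\<bar>D x \<bullet> b x\<bar>\<^sup>2 \<le> (M * norm (b x))\<^sup>2" by (rule power_mono) simp
    then show "(D x \<bullet> b x)\<^sup>2 \<le> M\<^sup>2 * (norm (b x))\<^sup>2" by (simp add: power_mult_distrib)
  qed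
  then show ?thesis unfolding L2sq_def by simp
qed

text \<open>Serves both the penalty and the coupling term: a difference of inner products is split
  by the product rule into two parts, each a bounded factor times an L^2 factor.\<close>

lemma LINT_inner_sum_sq_le:
  assumes D: "continuous_on {0..L} D" "square_integrable L b" and D': "continuous_on {0..L} D'" "square_integrable L b'"
    and c: "\<And>x. x \<in> {0<..<L} \<Longrightarrow> c x = D x \<bullet> b x + D' x \<bullet> b' x" and ci: "integrable (I0 L) (\<lambda>x. (c x)\<^sup>2)"
    and M: "\<And>x. x \<in> {0<..<L} \<Longrightarrow> norm (D x) \<le> M" and M': "\<And>x. x \<in> {0<..<L} \<Longrightarrow> norm (D' x) \<le> M'"
  shows "(LINT x|I0 L. (c x)\<^sup>2) \<le> 2 * (M\<^sup>2 * L2sq L b) + 2 * (M'\<^sup>2 * L2sq L b')"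
proof -
  note i = integrable_mult_right[OF L2_inner_bounded_integrable[OF D], of 2] integrable_mult_right[OF L2_inner_bounded_integrable[OF D'], of 2]
  have "(LINT x|I0 L. (c x)\<^sup>2) \<le> (LINT x|I0 L. 2 * (D x \<bullet> b x)\<^sup>2 + 2 * (D' x \<bullet> b' x)\<^sup>2)"
  proof (rule integral_mono[OF ci integrable_plus[OF i]])
    fix x assume "x \<in> space (I0 L)"
    then have "c x = D x \<bullet> b x + D' x \<bullet> b' x" using c by simp
    then show "(c x)\<^sup>2 \<le> 2 * (D x \<bullet> b x)\<^sup>2 + 2 * (D' x \<bullet> b' x)\<^sup>2"
      using sum_squares_bound[of "D x \<bullet> b x" "D' x \<bullet> b' x"] by (simp add: power2_sum)
  qed
  also have "\<dots> = 2 * (LINT x|I0 L. (D x \<bullet> b x)\<^sup>2) + 2 * (LINT x|I0 L. (D' x \<bullet> b' x)\<^sup>2)"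
    unfolding LINT_plus[OF i] integral_mult_right_zero ..
  finally show ?thesis using LINT_inner_sq_le[OF D M] LINT_inner_sq_le[OF D' M'] by linarith
qed

lemma H1_zero_sup_bound:
  assumes u: "has_H1_derivative L u g" and 0: "u 0 = 0" and L: "0 < L" and x: "x \<in> {0..L}"
  shows "norm (u x) \<le> sqrt L * sqrt (L2sq L g)"
proof -
  have "norm (u x - u 0) \<le> sqrt \<bar>x - 0\<bar> * sqrt (L2sq L g)"
    by (rule H1_holder_global[OF u]) (use x L in auto)
  also have "\<dots> \<le> sqrt L * sqrt (L2sq L g)" using x by (intro mult_right_mono) (auto simp: L2sq_nonneg)
  finally show ?thesis using 0 by simp
qed

text \<open>0 and L are nodes, so all six boundary values are copied from v and the boundary
  operator cannot tell the two apart; the unit lengths are copied at the nodes.\<close>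

lemma nodal_interpolant_admissible:
  fixes Lbc :: "conf \<Rightarrow> 'w::real_normed_vector"
  assumes X: "partition L N X" and v: "v \<in> A_frame L Lbc lbc" and w: "nodal_interpolant L N X v w"
    and B: "boundary_operator L Lbc" and L: "0 < L"
  shows "w \<in> discrete_admissible L Lbc lbc N X"
proof -
  note W = nodal_interpolantD[OF w]
  have v': "v \<in> V L" "Lbc v = lbc" "\<And>x. x \<in> {0..L} \<Longrightarrow> norm (dy L v x) = 1 \<and> norm (snd v x) = 1"
    using v A_frame_iff[OF L, of v Lbc lbc] by auto
  have X0: "X 0 = 0" "X N = L" using X by (auto simp: partition_def)
  have "boundary_values L w = boundary_values L v"
    using W(3-5)[of 0] W(3-5)[of N] X0 by (simp add: boundary_values_def case_prod_beta)
  then have "Lbc w = lbc" using B W(2) v'(1,2) unfolding boundary_operator_def by metis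
  moreover have "norm (dy L w (X j)) = 1 \<and> norm (snd w (X j)) = 1" if "j \<le> N" for j
    using W(4,5)[OF that] v'(3)[of "X j"] partition_range[OF X that] by simp
  ultimately show ?thesis using W(1) by (simp add: discrete_admissible_def case_prod_beta)
qed

lemma eventually_at_within_in: "eventually (\<lambda>h. h \<in> H) (at a within H)"
  by (simp add: eventually_at_filter)

text \<open>The interpolants converge in the norm of \<open>V\<close>, which gives weak convergence.
  The density follows from its continuity under strong convergence and the uniform error in
  \<delta>; the penalty and the coupling need separate product estimates.\<close>

lemma recovery_sequence:
  fixes Lbc :: "conf \<Rightarrow> 'w::real_normed_vector"
  assumes L: "0 < L" and e2: "0 < \<epsilon>2" and B: "boundary_operator L Lbc"
    and m: "regularized_modulus c0 c1 c2 cuni m" and H: "H \<subseteq> {0<..}"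
    and X: "\<And>h. h \<in> H \<Longrightarrow> partition L (N h) (X h)" "\<And>h. h \<in> H \<Longrightarrow> mesh_size (N h) (X h) = h"
    and d: "\<And>h. h \<in> H \<Longrightarrow> 0 < \<delta> h" and e1: "\<And>h. h \<in> H \<Longrightarrow> 0 < \<epsilon>1 h"
    and dl: "(\<delta> \<longlongrightarrow> 0) (at 0 within H)" and he: "((\<lambda>h. h\<^sup>2 / \<epsilon>1 h) \<longlongrightarrow> 0) (at 0 within H)"
    and v: "v \<in> A_frame L Lbc lbc"
  shows "\<exists>w. (\<forall>i. w i \<in> V L) \<and> weakly_convergent_V L w v (at 0 within H) \<and>
     ((\<lambda>h. E_discrete L Lbc lbc m (\<delta> h) (\<epsilon>1 h) \<epsilon>2 (N h) (X h) (w h)) \<longlongrightarrow> E_limit L Lbc lbc \<epsilon>2 v) (at 0 within H)"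
proof -
  let ?F = "at 0 within H"
  have vA: "v \<in> V L" "\<And>x. x \<in> {0..L} \<Longrightarrow> norm (dy L v x) = 1"
     "\<And>x. x \<in> {0..L} \<Longrightarrow> norm (snd v x) = 1" "\<And>x. x \<in> {0..L} \<Longrightarrow> dy L v x \<bullet> snd v x = 0"
    using v A_frame_iff[OF L, of v Lbc lbc] by auto
  \<comment> \<open>The family must lie in \<open>V\<close> for every index, so v itself is the
    default for h outside \<open>H\<close>.\<close>
  define w where "w h = (if h \<in> H then SOME w. nodal_interpolant L (N h) (X h) v w else v)" for h
  have nod: "nodal_interpolant L (N h) (X h) v (w h)" if "h \<in> H" for h
    using someI_ex[OF nodal_interpolant_exists[OF X(1)[OF that] L]] that by (simp add: w_def)
  have wV: "w h \<in> V L" for h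
  proof (cases "h \<in> H")
    case True
    then show ?thesis by (rule nodal_interpolantD(2)[OF nod])
  next
    case False
    then show ?thesis using vA(1) by (simp add: w_def)
  qed
  have inH: "eventually (\<lambda>h. h \<in> H) ?F" by (rule eventually_at_within_in)
  have h0: "((\<lambda>h. h) \<longlongrightarrow> 0) ?F" by (rule tendsto_ident_at)
  note dv = V_D[OF vA(1)] and dw = V_D[OF wV]
  note y1 = has_H1_derivative_diff[OF dw(1) dv(1)] and y2 = has_H1_derivative_diff[OF dw(2) dv(2)]
    and b1 = has_H1_derivative_diff[OF dw(3) dv(3)]
  define eA where "eA h = L2sq L (\<lambda>x. ddy L (w h) x - ddy L v x)" for h
  define eB where "eB h = L2sq L (\<lambda>x. db L (w h) x - db L v x)" for h
  have e0: "0 \<le> eA h" "0 \<le> eB h" for h by (simp_all add: eA_def eB_def L2sq_nonneg)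
  have small: "eventually (\<lambda>h. eA h < e \<and> eB h < e) ?F" if "0 < e" for e
  proof -
    obtain r where r: "0 < r" "\<And>N X w. partition L N X \<Longrightarrow> mesh_size N X < r \<Longrightarrow> nodal_interpolant L N X v w \<Longrightarrow>
        L2sq L (\<lambda>x. ddy L v x - ddy L w x) < e \<and> L2sq L (\<lambda>x. db L v x - db L w x) < e"
      using nodal_interpolant_converges[OF vA(1) L \<open>0 < e\<close>] by blast
    have "eventually (\<lambda>h. h < r) ?F" using r(1) by (rule order_tendstoD(2)[OF h0])
    then show ?thesis using inH
    proof eventually_elim
      case (elim h)
      have "mesh_size (N h) (X h) < r" using X(2) elim by simp
      from r(2)[OF X(1)[OF elim(2)] this nod[OF elim(2)]] show ?case
        unfolding eA_def eB_def L2sq_diff_commute[of L "ddy L v"] L2sq_diff_commute[of L "db L v"] .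
    qed
  qed
  have eA: "(eA \<longlongrightarrow> 0) ?F" and eB: "(eB \<longlongrightarrow> 0) ?F"
  proof -
    show "(eA \<longlongrightarrow> 0) ?F"
      by (rule tendstoI) (rule eventually_mono[OF small], use e0 in auto)
    show "(eB \<longlongrightarrow> 0) ?F"
      by (rule tendstoI) (rule eventually_mono[OF small], use e0 in auto)
  qed
  have node0: "fst (w h) (X h j) - fst v (X h j) = 0" "dy L (w h) (X h j) - dy L v (X h j) = 0"
      "snd (w h) (X h j) - snd v (X h j) = 0" if "h \<in> H" "j \<le> N h" for h j
    using nodal_interpolantD(3-5)[OF nod[OF that(1)] that(2)] by simp_all
  have D2: "L2sq L (\<lambda>x. dy L (w h) x - dy L v x) \<le> h\<^sup>2 * eA h" if "h \<in> H" for h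
    using L2sq_nodal_zero_le[OF X(1)[OF that] y2 node0(2)[OF that]] X(2)[OF that] by (simp add: eA_def)
  have Y2: "L2sq L (\<lambda>x. fst (w h) x - fst v x) \<le> h\<^sup>2 * L2sq L (\<lambda>x. dy L (w h) x - dy L v x)" if "h \<in> H" for h
    using L2sq_nodal_zero_le[OF X(1)[OF that] y1 node0(1)[OF that]] X(2)[OF that] by simp
  have B2: "L2sq L (\<lambda>x. snd (w h) x - snd v x) \<le> h\<^sup>2 * eB h" if "h \<in> H" for h
    using L2sq_nodal_zero_le[OF X(1)[OF that] b1 node0(3)[OF that]] X(2)[OF that] by (simp add: eB_def)
  have lim0: "((\<lambda>h. h\<^sup>2 * k h) \<longlongrightarrow> 0) ?F" if "(k \<longlongrightarrow> 0) ?F" for k :: "real \<Rightarrow> real"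
    using tendsto_mult[OF tendsto_power[OF h0, of 2] that] by simp
  have sand: "(k \<longlongrightarrow> 0) ?F" if "(l \<longlongrightarrow> 0) ?F" "\<And>h. 0 \<le> k h" "\<And>h. h \<in> H \<Longrightarrow> k h \<le> l h" for k l :: "real \<Rightarrow> real"
    by (rule tendsto_sandwich[OF always_eventually eventually_mono[OF inH] tendsto_const that(1)]) (use that in auto)
  have D2l: "((\<lambda>h. L2sq L (\<lambda>x. dy L (w h) x - dy L v x)) \<longlongrightarrow> 0) ?F"
    by (rule sand[OF lim0[OF eA] L2sq_nonneg D2])
  have Y2l: "((\<lambda>h. L2sq L (\<lambda>x. fst (w h) x - fst v x)) \<longlongrightarrow> 0) ?F"
    by (rule sand[OF lim0[OF D2l] L2sq_nonneg Y2])
  have B2l: "((\<lambda>h. L2sq L (\<lambda>x. snd (w h) x - snd v x)) \<longlongrightarrow> 0) ?F"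
    by (rule sand[OF lim0[OF eB] L2sq_nonneg B2])
  define u where "u h = lincomb 1 (w h) (-1) v" for h
  note lc = V_lincomb[OF wV vA(1) L, where r = 1 and s = "-1", folded u_def]
  have "((\<lambda>h. V_norm L (u h)) \<longlongrightarrow> 0) ?F"
  proof (rule V_norm_tendsto_0[OF lc(1)])
    note du = V_D[OF lc(1)]
    have "fst (u h) = (\<lambda>x. fst (w h) x - fst v x)" "snd (u h) = (\<lambda>x. snd (w h) x - snd v x)" for h
      by (simp_all add: u_def lincomb_def)
    then show "((\<lambda>h. L2sq L (fst (u h))) \<longlongrightarrow> 0) ?F" "((\<lambda>h. L2sq L (snd (u h))) \<longlongrightarrow> 0) ?F"
      using Y2l B2l by simp_all
    have "L2sq L (dy L (u h)) = L2sq L (\<lambda>x. dy L (w h) x - dy L v x)" for h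
      by (rule L2sq_cong_AE[OF AE_I2 square_integrable_measurable[OF H1_square_integrable(1)[OF du(2)]]
            square_integrable_measurable[OF H1_square_integrable(1)[OF y2]]]) (simp add: lc(2))
    then show "((\<lambda>h. L2sq L (dy L (u h))) \<longlongrightarrow> 0) ?F" using D2l by simp
    have "L2sq L (ddy L (u h)) = eA h" for h
      unfolding eA_def
      by (rule L2sq_cong_AE[OF _ square_integrable_measurable[OF H1_square_integrable(2)[OF du(2)]]
            square_integrable_measurable[OF H1_square_integrable(2)[OF y2]]]) (use lc(3)[of h] in simp)
    then show "((\<lambda>h. L2sq L (ddy L (u h))) \<longlongrightarrow> 0) ?F" using eA by simp
    have "L2sq L (db L (u h)) = eB h" for h
      unfolding eB_def
      by (rule L2sq_cong_AE[OF _ square_integrable_measurable[OF H1_square_integrable(2)[OF du(3)]]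
            square_integrable_measurable[OF H1_square_integrable(2)[OF b1]]]) (use lc(4)[of h] in simp)
    then show "((\<lambda>h. L2sq L (db L (u h))) \<longlongrightarrow> 0) ?F" using eB by simp
  qed
  then have "((\<lambda>h. f (w h)) \<longlongrightarrow> f v) ?F" if "bounded_linear_V L f" for f :: "conf \<Rightarrow> real"
    unfolding u_def by (rule bounded_linear_V_tendsto[OF that L wV vA(1)])
  then have weak: "weakly_convergent_V L w v ?F" by (simp add: weakly_convergent_V_def)
  note A = H1_square_integrable(2)[OF dw(2)] and Bp = H1_square_integrable(2)[OF dw(3)]
    and A0 = H1_square_integrable(2)[OF dv(2)] and Bp0 = H1_square_integrable(2)[OF dv(3)]
    and cD = H1_square_integrable(3)[OF dw(2)] and cD0 = H1_square_integrable(3)[OF dv(2)]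
    and cb = H1_square_integrable(3)[OF dw(3)] and cb0 = H1_square_integrable(3)[OF dv(3)]
    and cdD = H1_square_integrable(3)[OF y2] and cdb = H1_square_integrable(1)[OF b1]
  \<comment> \<open>The slope error vanishes at the node 0, so its sup norm is controlled by its
    derivative.\<close>
  have Dsup: "norm (dy L (w h) x - dy L v x) \<le> sqrt L * sqrt (eA h)" if "h \<in> H" "x \<in> {0..L}" for h x
    unfolding eA_def using H1_zero_sup_bound[OF y2 _ L that(2)] node0(2)[OF that(1), of 0] X(1)[OF that(1)]
    by (simp add: partition_def)
  have bsup: "norm (snd (w h) x) \<le> 1 + sqrt L * sqrt (eB h)" if "h \<in> H" "x \<in> {0..L}" for h x
  proof -
    have "norm (snd (w h) x - snd v x) \<le> sqrt L * sqrt (eB h)"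
      unfolding eB_def using H1_zero_sup_bound[OF b1 _ L that(2)] node0(3)[OF that(1), of 0] X(1)[OF that(1)]
      by (simp add: partition_def)
    then show ?thesis using norm_triangle_ineq2[of "snd (w h) x" "snd v x"] vA(3)[OF that(2)] by linarith
  qed
  have T1: "((\<lambda>h. LINT x|I0 L. Qreg m (\<delta> h) (ddy L (w h) x) (db L (w h) x)) \<longlongrightarrow>
      (LINT x|I0 L. Qlim (ddy L v x) (db L v x))) ?F"
  proof -
    have q: "((\<lambda>h. LINT x|I0 L. Qlim (ddy L (w h) x) (db L (w h) x)) \<longlongrightarrow>
        (LINT x|I0 L. Qlim (ddy L v x) (db L v x))) ?F"
      by (rule Qlim_strong_continuity[OF A0 Bp0 A Bp eA[unfolded eA_def[abs_def]] eB[unfolded eB_def[abs_def]]])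
    have "((\<lambda>h. 5/2 * (cuni * \<delta> h) * L) \<longlongrightarrow> 5/2 * (cuni * 0) * L) ?F" by (intro tendsto_intros dl)
    then have z: "((\<lambda>h. 5/2 * (cuni * \<delta> h) * L) \<longlongrightarrow> 0) ?F" by simp
    have "((\<lambda>h. (LINT x|I0 L. Qreg m (\<delta> h) (ddy L (w h) x) (db L (w h) x)) -
        (LINT x|I0 L. Qlim (ddy L (w h) x) (db L (w h) x))) \<longlongrightarrow> 0) ?F"
      by (rule Lim_null_comparison[OF eventually_mono[OF inH] z])
         (unfold real_norm_def, rule LINT_Qreg_Qlim[OF m d _ A Bp], use L in simp_all)
    from tendsto_add[OF this q] show ?thesis by simp
  qed
  have T2: "((\<lambda>h. 1 / (2 * \<epsilon>1 h) * (LINT x|I0 L. (dy L (w h) x \<bullet> snd (w h) x)\<^sup>2)) \<longlongrightarrow> 0) ?F"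
  proof -
    define M where "M h = 1 + sqrt L * sqrt (eB h)" for h
    \<comment> \<open>Since y'.b = 0, the product y_h'.b_h equals b_h.(y_h' - y') + y'.(b_h - b).
      Both errors vanish at the nodes, hence have squared norms at most h^2 \<open>eA h\<close> and
      h^2 \<open>eB h\<close>; the factor 2 from squaring a sum cancels the one in 1/(2
      \<epsilon>1).\<close>
    have le: "1 / (2 * \<epsilon>1 h) * (LINT x|I0 L. (dy L (w h) x \<bullet> snd (w h) x)\<^sup>2) \<le> h\<^sup>2 / \<epsilon>1 h * ((M h)\<^sup>2 * eA h + eB h)" if h: "h \<in> H" for h
    proof -
      have "(LINT x|I0 L. (dy L (w h) x \<bullet> snd (w h) x)\<^sup>2) \<le>
          2 * ((M h)\<^sup>2 * L2sq L (\<lambda>x. dy L (w h) x - dy L v x)) + 2 * (1\<^sup>2 * L2sq L (\<lambda>x. snd (w h) x - snd v x))"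
      proof (rule LINT_inner_sum_sq_le[OF cb H1_square_integrable(1)[OF y2] cD0 cdb])
        fix x assume "x \<in> {0<..<L}"
        then have x: "x \<in> {0..L}" by simp
        show "dy L (w h) x \<bullet> snd (w h) x = snd (w h) x \<bullet> (dy L (w h) x - dy L v x) +
            dy L v x \<bullet> (snd (w h) x - snd v x)"
          using vA(4)[OF x] by (simp add: inner_diff_right inner_commute)
        show "norm (snd (w h) x) \<le> M h" unfolding M_def by (rule bsup[OF h x])
        show "norm (dy L v x) \<le> 1" using vA(2)[OF x] by simp
      qed (rule L2_inner_bounded_integrable[OF cD H1_square_integrable(1)[OF dw(3)]])
      also have "\<dots> \<le> 2 * ((M h)\<^sup>2 * (h\<^sup>2 * eA h)) + 2 * (1\<^sup>2 * (h\<^sup>2 * eB h))"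
        using D2[OF h] B2[OF h] by (intro add_mono mult_left_mono) auto
      also have "\<dots> = 2 * (h\<^sup>2 * ((M h)\<^sup>2 * eA h + eB h))" by (simp add: algebra_simps)
      finally have "1 / (2 * \<epsilon>1 h) * (LINT x|I0 L. (dy L (w h) x \<bullet> snd (w h) x)\<^sup>2) \<le>
          1 / (2 * \<epsilon>1 h) * (2 * (h\<^sup>2 * ((M h)\<^sup>2 * eA h + eB h)))"
        using e1[OF h] by (intro mult_left_mono) auto
      also have "\<dots> = h\<^sup>2 / \<epsilon>1 h * ((M h)\<^sup>2 * eA h + eB h)" by simp
      finally show ?thesis .
    qed
    have "((\<lambda>h. h\<^sup>2 / \<epsilon>1 h * ((M h)\<^sup>2 * eA h + eB h)) \<longlongrightarrow> 0 * ((1 + sqrt L * sqrt 0)\<^sup>2 * 0 + 0)) ?F"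
      unfolding M_def by (intro tendsto_intros he eA eB)
    then have z: "((\<lambda>h. h\<^sup>2 / \<epsilon>1 h * ((M h)\<^sup>2 * eA h + eB h)) \<longlongrightarrow> 0) ?F" by simp
    show ?thesis
    proof (rule Lim_null_comparison[OF eventually_mono[OF inH] z])
      fix h assume h: "h \<in> H"
      have "0 \<le> 1 / (2 * \<epsilon>1 h) * (LINT x|I0 L. (dy L (w h) x \<bullet> snd (w h) x)\<^sup>2)"
        using e1[OF h] by simp
      then show "norm (1 / (2 * \<epsilon>1 h) * (LINT x|I0 L. (dy L (w h) x \<bullet> snd (w h) x)\<^sup>2)) \<le> h\<^sup>2 / \<epsilon>1 h * ((M h)\<^sup>2 * eA h + eB h)"
        using le[OF h] by simp
    qed
  qed
  have T3: "((\<lambda>h. LINT x|I0 L. (dy L (w h) x \<bullet> db L (w h) x)\<^sup>2) \<longlongrightarrow>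
     (LINT x|I0 L. (dy L v x \<bullet> db L v x)\<^sup>2)) ?F"
  proof -
    \<comment> \<open>Scalars are embedded isometrically into R^3, so that the convergence of norms
      proved for vector fields also applies to y_h'.b_h'.\<close>
    define emb where "emb r = r *\<^sub>R (axis 1 1 :: real^3)" for r
    have en: "norm (emb r) = \<bar>r\<bar>" for r by (simp add: emb_def)
    have ed: "emb r - emb s = emb (r - s)" for r s by (simp add: emb_def scaleR_diff_left)
    have sq: "square_integrable L (\<lambda>x. emb (D x \<bullet> b x))" if "continuous_on {0..L} D" "square_integrable L b" for D b
    proof (rule square_integrable_bound[OF _ L2_inner_bounded_integrable[OF that]])
      show "(\<lambda>x. emb (D x \<bullet> b x)) \<in> borel_measurable (I0 L)"
        unfolding emb_def by (intro borel_measurable_scaleR borel_measurable_inner borel_measurable_const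
            continuous_measurable_I0 square_integrable_measurable that)
    qed (simp add: en)
    have l2: "L2sq L (\<lambda>x. emb (f x)) = (LINT x|I0 L. (f x)\<^sup>2)" for f by (simp add: L2sq_def en)
    define k where "k h = 2 * ((sqrt L * sqrt (eA h))\<^sup>2 * L2sq L (db L (w h))) + 2 * (1\<^sup>2 * eB h)" for h
    have le: "L2sq L (\<lambda>x. emb (dy L (w h) x \<bullet> db L (w h) x) - emb (dy L v x \<bullet> db L v x)) \<le> k h"
      if h: "h \<in> H" for h
      unfolding ed l2 k_def eB_def
    proof (rule LINT_inner_sum_sq_le[OF cdD Bp cD0 H1_square_integrable(2)[OF b1]])
      fix x assume "x \<in> {0<..<L}"
      then have x: "x \<in> {0..L}" by simp
      show "dy L (w h) x \<bullet> db L (w h) x - dy L v x \<bullet> db L v x =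
        (dy L (w h) x - dy L v x) \<bullet> db L (w h) x + dy L v x \<bullet> (db L (w h) x - db L v x)"
        by (simp add: inner_diff_left inner_diff_right)
      show "norm (dy L (w h) x - dy L v x) \<le> sqrt L * sqrt (eA h)" by (rule Dsup[OF h x])
      show "norm (dy L v x) \<le> 1" using vA(2)[OF x] by simp
    next
      show "integrable (I0 L) (\<lambda>x. (dy L (w h) x \<bullet> db L (w h) x - dy L v x \<bullet> db L v x)\<^sup>2)"
        using square_integrableD[OF square_integrable_diff[OF sq[OF cD Bp, of h h] sq[OF cD0 Bp0]]] unfolding ed en by simp
    qed
    have "(k \<longlongrightarrow> 2 * ((sqrt L * sqrt 0)\<^sup>2 * L2sq L (db L v)) + 2 * (1\<^sup>2 * 0)) ?F"
      unfolding k_def by (intro tendsto_intros eA eB LINT_norm_sq_tendsto[OF Bp Bp0 eB[unfolded eB_def[abs_def]]])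
    then have kz: "(k \<longlongrightarrow> 0) ?F" by simp
    have "((\<lambda>h. L2sq L (\<lambda>x. emb (dy L (w h) x \<bullet> db L (w h) x))) \<longlongrightarrow> L2sq L (\<lambda>x. emb (dy L v x \<bullet> db L v x))) ?F"
      by (rule LINT_norm_sq_tendsto[OF sq[OF cD Bp] sq[OF cD0 Bp0] sand[OF kz L2sq_nonneg le]])
    then show ?thesis unfolding l2 .
  qed
  have "((\<lambda>h. discrete_energy L m (\<delta> h) (\<epsilon>1 h) \<epsilon>2 (w h)) \<longlongrightarrow>
     (LINT x|I0 L. Qlim (ddy L v x) (db L v x)) + 0 +
     1 / (2 * \<epsilon>2) * (LINT x|I0 L. (dy L v x \<bullet> db L v x)\<^sup>2)) ?F"
    unfolding discrete_energy_def by (intro tendsto_add T1 T2 tendsto_mult[OF tendsto_const T3])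
  then have "((\<lambda>h. discrete_energy L m (\<delta> h) (\<epsilon>1 h) \<epsilon>2 (w h)) \<longlongrightarrow> limit_energy L \<epsilon>2 v) ?F"
    by (simp add: limit_energy_def)
  then have "((\<lambda>h. ennreal (discrete_energy L m (\<delta> h) (\<epsilon>1 h) \<epsilon>2 (w h))) \<longlongrightarrow> E_limit L Lbc lbc \<epsilon>2 v) ?F"
    unfolding E_limit_eq[OF v e2] by (rule tendsto_ennrealI)
  moreover have "eventually (\<lambda>h. ennreal (discrete_energy L m (\<delta> h) (\<epsilon>1 h) \<epsilon>2 (w h)) =
      E_discrete L Lbc lbc m (\<delta> h) (\<epsilon>1 h) \<epsilon>2 (N h) (X h) (w h)) ?F"
    by (rule eventually_mono[OF inH])
       (simp add: E_discrete_eq[OF nodal_interpolant_admissible[OF X(1) v nod B L] e1 e2 m d])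
  ultimately have "((\<lambda>h. E_discrete L Lbc lbc m (\<delta> h) (\<epsilon>1 h) \<epsilon>2 (N h) (X h) (w h)) \<longlongrightarrow> E_limit L Lbc lbc \<epsilon>2 v) ?F"
    by (rule Lim_transform_eventually)
  then show ?thesis using wV weak by blast
qed

text \<open>By contradiction: a level y below the limit energy that is not eventually exceeded gives
  mesh sizes accumulating at 0 with energy at most y. Along a sequence of them the sequential bound
  applies with c = y.\<close>

lemma liminf_inequality:
  fixes Lbc :: "conf \<Rightarrow> 'w::real_normed_vector"
  assumes L: "0 < L" and e2: "0 < \<epsilon>2" and B: "boundary_operator L Lbc"
    and m: "regularized_modulus c0 c1 c2 cuni m"
    and X: "\<And>h. h \<in> H \<Longrightarrow> partition L (N h) (X h)" "\<And>h. h \<in> H \<Longrightarrow> mesh_size (N h) (X h) = h"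
    and d: "\<And>h. h \<in> H \<Longrightarrow> 0 < \<delta> h" and e1: "\<And>h. h \<in> H \<Longrightarrow> 0 < \<epsilon>1 h"
    and dl: "(\<delta> \<longlongrightarrow> 0) (at 0 within H)" and el: "(\<epsilon>1 \<longlongrightarrow> 0) (at 0 within H)"
    and v: "v \<in> V L" and w: "\<And>h. w h \<in> V L" and conv: "weakly_convergent_V L w v (at 0 within H)"
  shows "E_limit L Lbc lbc \<epsilon>2 v \<le> Liminf (at 0 within H) (\<lambda>h. E_discrete L Lbc lbc m (\<delta> h) (\<epsilon>1 h) \<epsilon>2 (N h) (X h) (w h))"
  unfolding le_Liminf_iff
proof (intro allI impI)
  let ?E = "\<lambda>h. E_discrete L Lbc lbc m (\<delta> h) (\<epsilon>1 h) \<epsilon>2 (N h) (X h) (w h)"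
  fix y assume y: "y < E_limit L Lbc lbc \<epsilon>2 v"
  show "eventually (\<lambda>h. y < ?E h) (at 0 within H)"
  proof (rule ccontr)
    assume n: "\<not> eventually (\<lambda>h. y < ?E h) (at 0 within H)"
    have "y \<noteq> \<infinity>" using less_le_trans[OF y top_greatest] by simp
    then obtain c where c: "0 \<le> c" "y = ennreal c" by (cases y) auto
    \<comment> \<open>The indices with low energy. Failure of the eventual inequality means that
      they accumulate at 0, and a limit point yields a sequence avoiding 0.\<close>
    define H' where "H' = {h \<in> H. ?E h \<le> y}"
    have "0 islimpt H'"
      unfolding islimpt_approachable
    proof (intro allI impI)
      fix e :: real assume "0 < e"
      then obtain h where "h \<in> H" "h \<noteq> 0" "dist h 0 < e" "\<not> y < ?E h"
        using n unfolding eventually_at by blast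
      then show "\<exists>x'\<in>H'. x' \<noteq> 0 \<and> dist x' 0 < e" unfolding H'_def by (intro bexI[of _ h]) auto
    qed
    then obtain s where s: "\<And>n. s n \<in> H' - {0}" "s \<longlonglongrightarrow> 0"
      unfolding islimpt_sequential by blast
    have sH: "s n \<in> H" "?E (s n) \<le> ennreal c" for n using s(1)[of n] c(2) by (auto simp: H'_def)
    have fl: "filterlim s (at 0 within H) sequentially"
      unfolding filterlim_at using s sH by auto
    have "E_limit L Lbc lbc \<epsilon>2 v \<le> ennreal c"
    proof (rule liminf_sequence[OF L e2 B m v w])
      show "weakly_convergent_V L (\<lambda>n. w (s n)) v sequentially"
        unfolding weakly_convergent_V_def
      proof (intro allI impI)
        fix f :: "conf \<Rightarrow> real" assume "bounded_linear_V L f"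
        then have "((\<lambda>h. f (w h)) \<longlongrightarrow> f v) (at 0 within H)" using conv by (simp add: weakly_convergent_V_def)
        then show "(\<lambda>n. f (w (s n))) \<longlonglongrightarrow> f v" by (rule filterlim_compose[OF _ fl])
      qed
      show "partition L (N (s n)) (X (s n))" for n by (rule X(1)[OF sH(1)])
      show "(\<lambda>n. mesh_size (N (s n)) (X (s n))) \<longlonglongrightarrow> 0" using s(2) by (simp add: X(2)[OF sH(1)])
      show "0 < \<delta> (s n)" "0 < \<epsilon>1 (s n)" for n by (rule d[OF sH(1)], rule e1[OF sH(1)])
      show "(\<lambda>n. \<delta> (s n)) \<longlonglongrightarrow> 0" "(\<lambda>n. \<epsilon>1 (s n)) \<longlonglongrightarrow> 0"
        by (rule filterlim_compose[OF dl fl], rule filterlim_compose[OF el fl])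
      show "E_discrete L Lbc lbc m (\<delta> (s n)) (\<epsilon>1 (s n)) \<epsilon>2 (N (s n)) (X (s n)) (w (s n)) \<le> ennreal c" for n
        by (rule sH(2))
    qed (rule c(1))
    then show False using y c(2) by simp
  qed
qed

theorem corollary4p5:
  fixes L \<epsilon>2 c0 c1 c2 cuni :: real
    and Lbc :: "conf \<Rightarrow> 'w::real_normed_vector" and lbc :: 'w
    and m :: "real \<Rightarrow> real \<Rightarrow> real"
    and H :: "real set" and N :: "real \<Rightarrow> nat" and X :: "real \<Rightarrow> nat \<Rightarrow> real"
    and \<delta> \<epsilon>1 :: "real \<Rightarrow> real"
  assumes "0 < L" and "0 < \<epsilon>2"
    and "boundary_operator L Lbc"
    and "regularized_modulus c0 c1 c2 cuni m"
    and "H \<subseteq> {0<..}" and "0 islimpt H"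
    and "quasiuniform_family L H N X"
    and "\<And>h. h \<in> H \<Longrightarrow> 0 < \<delta> h" and "\<And>h. h \<in> H \<Longrightarrow> 0 < \<epsilon>1 h"
    and "(\<delta> \<longlongrightarrow> 0) (at 0 within H)" and "(\<epsilon>1 \<longlongrightarrow> 0) (at 0 within H)"
    and "((\<lambda>h. h\<^sup>2 / \<epsilon>1 h) \<longlongrightarrow> 0) (at 0 within H)"
  shows "Gamma_convergent_V L
           (\<lambda>h. E_discrete L Lbc lbc m (\<delta> h) (\<epsilon>1 h) \<epsilon>2 (N h) (X h))
           (E_limit L Lbc lbc \<epsilon>2)
           (at 0 within H)"
proof -
  let ?E = "\<lambda>h. E_discrete L Lbc lbc m (\<delta> h) (\<epsilon>1 h) \<epsilon>2 (N h) (X h)"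
  have X: "partition L (N h) (X h)" "mesh_size (N h) (X h) = h" if "h \<in> H" for h
    using assms(7) that by (auto simp: quasiuniform_family_def)
  note liminf = liminf_inequality[OF assms(1-4) X assms(8-11)]
  have "\<exists>w. (\<forall>i. w i \<in> V L) \<and> weakly_convergent_V L w v (at 0 within H) \<and>
     ((\<lambda>h. ?E h (w h)) \<longlongrightarrow> E_limit L Lbc lbc \<epsilon>2 v) (at 0 within H)" if v: "v \<in> V L" for v
  proof (cases "v \<in> A_frame L Lbc lbc")
    case True
    show ?thesis
      by (rule recovery_sequence[OF assms(1-5) X assms(8-10,12) True])
  next
    case False
    then have inf: "E_limit L Lbc lbc \<epsilon>2 v = \<infinity>" by (simp add: E_limit_def case_prod_beta)
    \<comment> \<open>For an inadmissible v the constant family recovers the energy: the lower bound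
      already forces its discrete energies to infinity.\<close>
    have c: "weakly_convergent_V L (\<lambda>h. v) v (at 0 within H)" by (simp add: weakly_convergent_V_def)
    have "E_limit L Lbc lbc \<epsilon>2 v \<le> Liminf (at 0 within H) (\<lambda>h. ?E h v)"
      using liminf[OF _ _ _ _ v v c, where lbc = lbc] by simp
    then have "\<infinity> \<le> Liminf (at 0 within H) (\<lambda>h. ?E h v)"
      unfolding inf .
    then have "((\<lambda>h. ?E h v) \<longlongrightarrow> \<infinity>) (at 0 within H)"
      unfolding le_Liminf_iff by (intro order_tendstoI) auto
    then show ?thesis using v c unfolding inf by (intro exI[of _ "\<lambda>h. v"]) simp
  qed
  then show ?thesis
    unfolding Gamma_convergent_V_def using liminf by blast
qed

end
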